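(* Let $n \geq 2$, let $m \geq 2$ be even and let $k_1,\dots,k_n \in \mathbb{Z}$ be coprime to $m$. Let $$\varphi \colon \mathbb{C}^n \to \mathbb{C}^n, \qquad \varphi(z^1,\dots,z^n) := \big(e^{2\pi i k_1/m}z^1,\dots,e^{2\pi i k_n/m}z^n\big).$$ Let $\Sigma \subseteq \mathbb{C}^n$ be a compact and connected star-shaped hypersurface with $\varphi(\Sigma) = \Sigma$. Then the quotient contact manifold $\Sigma/\mathbb{Z}_m$ (where $\mathbb{Z}_m$ acts via $[k]\cdot z = \varphi^k(z)$) admits a noncontractible periodic Reeb orbit.
   Context: $\mathbb{C}^n$ carries the standard Liouville form $\lambda = \frac{1}{2}\sum_{j=1}^n (y^j dx^j - x^j dy^j)$, $z^j = x^j + i y^j$, with symplectic form $d\lambda$ and Liouville vector field $X = \frac12\sum_j (x^j\partial_{x^j} + y^j\partial_{y^j})$. A star-shaped hypersurface is the boundary of a compact domain which is star-shaped with respect to the origin and whose boundary is transverse to the radial (Liouville) vector field; then $\lambda|_\Sigma$ is a contact form. Since $\varphi^*\lambda = \lambda$ and the $\mathbb{Z}_m$-action on $\Sigma$ is free, $\lambda|_\Sigma$ descends to a contact form on the smooth manifold $\Sigma/\mathbb{Z}_m$. The Reeb vector field $R$ of a contact form $\alpha$ is defined by $i_R d\alpha = 0$, $\alpha(R) = 1$; a periodic Reeb orbit is a nonconstant closed orbit of its flow, and noncontractible means not freely null-homotopic in $\Sigma/\mathbb{Z}_m$. *)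

theory Defs
  imports "HOL-Analysis.Analysis"
begin

definition liouville_form :: "complex^'n \<Rightarrow> complex^'n \<Rightarrow> real" where
  "liouville_form z v = (1/2) * (\<Sum>j\<in>UNIV. Im (z$j) * Re (v$j) - Re (z$j) * Im (v$j))"

text \<open>d lambda = sum_j dy_j /\ dx_j (constant coefficients), evaluated on (u,v).\<close>
definition dliouville :: "complex^'n \<Rightarrow> complex^'n \<Rightarrow> real" where
  "dliouville u v = (\<Sum>j\<in>UNIV. Im (u$j) * Re (v$j) - Re (u$j) * Im (v$j))"

fun iter_deriv :: "('a::real_normed_vector \<Rightarrow> real) \<Rightarrow> 'a list \<Rightarrow> 'a \<Rightarrow> real" where
  "iter_deriv f [] = f"
| "iter_deriv f (v # vs) = (\<lambda>x. frechet_derivative (iter_deriv f vs) (at x) v)"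

definition smooth_on :: "'a::real_normed_vector set \<Rightarrow> ('a \<Rightarrow> real) \<Rightarrow> bool" where
  "smooth_on U f \<longleftrightarrow> (\<forall>vs. iter_deriv f vs differentiable_on U)"

definition smooth_hypersurface :: "'a::euclidean_space set \<Rightarrow> bool" where
  "smooth_hypersurface S \<longleftrightarrow>
     (\<forall>p\<in>S. \<exists>U f. open U \<and> p \<in> U \<and> smooth_on U f \<and>
        (\<forall>x\<in>U. frechet_derivative f (at x) \<noteq> (\<lambda>_. 0)) \<and>
        S \<inter> U = {x\<in>U. f x = 0})"

definition tangent_space :: "'a::euclidean_space set \<Rightarrow> 'a \<Rightarrow> 'a set" where
  "tangent_space S p =
     {v. \<exists>c::real \<Rightarrow> 'a. (\<forall>t. c t \<in> S) \<and> c 0 = p \<and> (c has_vector_derivative v) (at 0)}"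

text \<open>Boundary of a compact domain star-shaped w.r.t. the origin, which is a smooth hypersurface
  transverse to the radial (Liouville) vector field X(p) = p/2.\<close>
definition star_shaped_hypersurface :: "'a::euclidean_space set \<Rightarrow> bool" where
  "star_shaped_hypersurface S \<longleftrightarrow>
     (\<exists>D. compact D \<and> 0 \<in> D \<and> (\<forall>x\<in>D. closed_segment 0 x \<subseteq> D) \<and> S = frontier D) \<and>
     smooth_hypersurface S \<and>
     (\<forall>p\<in>S. (1/2) *\<^sub>R p \<notin> tangent_space S p)"

definition is_reeb_vector :: "(complex^'n) set \<Rightarrow> complex^'n \<Rightarrow> complex^'n \<Rightarrow> bool" where
  "is_reeb_vector S p v \<longleftrightarrow>
     v \<in> tangent_space S p \<and> liouville_form p v = 1 \<and>
     (\<forall>w\<in>tangent_space S p. dliouville v w = 0)"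

definition reeb_trajectory :: "(complex^'n) set \<Rightarrow> (real \<Rightarrow> complex^'n) \<Rightarrow> bool" where
  "reeb_trajectory S \<gamma> \<longleftrightarrow>
     (\<forall>t. \<gamma> t \<in> S \<and> (\<exists>v. (\<gamma> has_vector_derivative v) (at t) \<and> is_reeb_vector S (\<gamma> t) v))"

definition phi :: "('n \<Rightarrow> int) \<Rightarrow> nat \<Rightarrow> complex^'n \<Rightarrow> complex^'n" where
  "phi k m z = (\<chi> j. exp (2 * of_real pi * \<i> * of_int (k j) / of_nat m) * z$j)"

definition zm_orbit :: "('n \<Rightarrow> int) \<Rightarrow> nat \<Rightarrow> complex^'n \<Rightarrow> (complex^'n) set" where
  "zm_orbit k m z = {(phi k m ^^ l) z | l. l < m}"

definition quotient_topology :: "'a topology \<Rightarrow> ('a \<Rightarrow> 'b) \<Rightarrow> 'b topology" where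
  "quotient_topology X q =
     topology (\<lambda>U. U \<subseteq> q ` topspace X \<and> openin X {x \<in> topspace X. q x \<in> U})"

lemma istopology_quotient:
  "istopology (\<lambda>U. U \<subseteq> q ` topspace X \<and> openin X {x \<in> topspace X. q x \<in> U})"
proof -
  have 1: "{x \<in> topspace X. q x \<in> S \<inter> T} = {x \<in> topspace X. q x \<in> S} \<inter> {x \<in> topspace X. q x \<in> T}" for S T
    by auto
  have 2: "{x \<in> topspace X. q x \<in> \<Union>K} = (\<Union>S\<in>K. {x \<in> topspace X. q x \<in> S})" for K
    by auto
  show ?thesis
    unfolding istopology_def 1 2 by (auto intro!: openin_Int openin_Union)
qed

lemma openin_quotient_topology:
  "openin (quotient_topology X q) U \<longleftrightarrow> U \<subseteq> q ` topspace X \<and> openin X {x \<in> topspace X. q x \<in> U}"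
  unfolding quotient_topology_def using topology_inverse'[OF istopology_quotient, of q X] by simp

definition zm_quotient :: "('n \<Rightarrow> int) \<Rightarrow> nat \<Rightarrow> (complex^'n) set \<Rightarrow> ((complex^'n) set) topology" where
  "zm_quotient k m S = quotient_topology (top_of_set S) (zm_orbit k m)"

definition noncontractible_loop :: "'b topology \<Rightarrow> (real \<Rightarrow> 'b) \<Rightarrow> bool" where
  "noncontractible_loop Y c \<longleftrightarrow>
     continuous_map (top_of_set {0..1}) Y c \<and> c 0 = c 1 \<and>
     \<not> (\<exists>y. homotopic_with (\<lambda>h. h 0 = h 1) (top_of_set {0..1}) Y c (\<lambda>_. y))"

end

theory Submission
  imports Defs "HOL-Homology.Brouwer_Degree" "HOL-Complex_Analysis.Great_Picard"
begin

text \<open>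
  Since m is even and all k j are odd, the power m div 2 of phi is minus the identity. It therefore
  suffices to find a Reeb orbit with gamma T = - gamma 0: its image in the quotient lifts to a path
  that does not close up, so it is not contractible.

  Let H be the square of the gauge of Sigma, which is positively homogeneous of degree 2 and C^1.
  Antiperiodic Reeb orbits are, up to time scaling, critical points of the quotient of the
  symplectic action by the integral of H on antiperiodic loops; constant loops are excluded, so
  the action is nondegenerate. Loops are replaced by sequences of N points, with a staggered
  difference quotient (the symplectic Euler scheme), so that the action is the sum of
  p j times the difference quotient of q at j. It is non-positive on the subspace p = - Dq and positive on the
  subspace p = Dq, and a linking argument based on the no-retraction theorem gives
  almost critical points whose critical values lie between two positive constants independent of N. Because
  the gradient of H grows linearly, these are uniformly Lipschitz, and Arzela--Ascoli yields a
  solution of the Reeb equation for N to infinity.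
\<close>

section \<open>The no-retraction theorem in coordinates\<close>

text \<open>The action is strongly indefinite: on loops it is positive and negative on
  infinite-dimensional subspaces, so minimisation is hopeless and Brouwer-type topology does not
  apply directly. For fixed \<open>N\<close> the linking is a statement about a finite-dimensional
  disc, and everything then hinges on estimates free of \<open>N\<close>. This dictates the two
  subspaces: on them the action is plus or minus the squared norm of Dq, which the Poincare
  inequality compares with the full norm, with the same constant for all \<open>N\<close>. A centred
  difference quotient would spoil this, since for odd \<open>N\<close> it annihilates the
  alternating antiperiodic sequences; the one-sided quotient is invertible. The gradient of H is
  merely continuous, so there is no gradient flow to deform with; an explicit step with a definite
  decrease is iterated instead. Action and integral of H are both homogeneous of degree 2, so the
  quotient is scale invariant, and its critical value plays the part of the unknown period: the
  lower bound keeps it from collapsing to 0, the upper bound from escaping.\<close>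

lemma no_retraction_nat:
  fixes f :: "(nat \<Rightarrow> real) \<Rightarrow> nat \<Rightarrow> real" and n :: nat
  defines "B \<equiv> {x. (\<Sum>i\<le>n. (x i)\<^sup>2) \<le> 1 \<and> (\<forall>i>n. x i = 0)}"
  assumes cont: "continuous_on B f"
    and nz: "\<And>x. x \<in> B \<Longrightarrow> \<exists>i\<le>n. f x i \<noteq> 0"
    and bd: "\<And>x i. x \<in> B \<Longrightarrow> (\<Sum>i\<le>n. (x i)\<^sup>2) = 1 \<Longrightarrow> i \<le> n \<Longrightarrow> f x i = x i"
  shows False
proof -
  define S :: "(nat \<Rightarrow> real) set" where "S = {x. (\<Sum>i\<le>n. (x i)\<^sup>2) = 1 \<and> (\<forall>i>n. x i = 0)}"
  have ns: "nsphere n = top_of_set S"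
    unfolding nsphere S_def euclidean_product_topology by simp
  define g where "g y = (\<lambda>i. if i \<le> n then y i / sqrt (\<Sum>j\<le>n. (y j)\<^sup>2) else 0)" for y :: "nat \<Rightarrow> real"
  define sc where "sc p = (\<lambda>i. (1 - fst p) * snd p i)" for p :: "real \<times> (nat \<Rightarrow> real)"
  \<comment> \<open>The contradiction: \<open>h\<close> runs through the spheres of radius 1 - t and
    projects their images under \<open>f\<close> radially back to the unit sphere, starting from the
    identity by \<open>bd\<close> and ending at a constant. It would contract the sphere.\<close>
  define h where "h p = g (f (sc p))" for p
  have scB: "sc p \<in> B" if "p \<in> {0..1} \<times> S" for p
  proof -
    have "(\<Sum>i\<le>n. (sc p i)\<^sup>2) = (1 - fst p)\<^sup>2 * (\<Sum>i\<le>n. (snd p i)\<^sup>2)"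
      unfolding sc_def by (simp add: power_mult_distrib sum_distrib_left)
    also have "\<dots> \<le> 1" using that by (auto simp: S_def power_le_one)
    finally show ?thesis using that by (auto simp: B_def S_def sc_def)
  qed
  have pos: "(\<Sum>j\<le>n. (f x j)\<^sup>2) > 0" if x: "x \<in> B" for x
  proof -
    obtain i where "i \<le> n" "f x i \<noteq> 0" using nz[OF x] by auto
    then show ?thesis by (intro sum_pos2[of _ i]) auto
  qed
  have cc: "continuous_on ({0..1} \<times> S) (\<lambda>p. f (sc p))"
  proof -
    have "continuous_on ({0..1} \<times> S) sc"
      unfolding sc_def
      by (intro continuous_on_coordinatewise_then_product continuous_intros
          continuous_on_product_then_coordinatewise[OF continuous_on_snd])
    then show ?thesis
      using scB by (intro continuous_on_compose2[OF cont]) auto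
  qed
  have ch: "continuous_on ({0..1} \<times> S) h"
    unfolding h_def g_def
  proof (rule continuous_on_coordinatewise_then_product)
    fix i
    have ci: "continuous_on ({0..1} \<times> S) (\<lambda>p. f (sc p) j)" for j
      by (rule continuous_on_product_then_coordinatewise[OF cc])
    show "continuous_on ({0..1} \<times> S) (\<lambda>x. if i \<le> n then f (sc x) i / sqrt (\<Sum>j\<le>n. (f (sc x) j)\<^sup>2) else 0)"
    proof (cases "i \<le> n")
      case True
      have "\<forall>x\<in>{0..1} \<times> S. sqrt (\<Sum>j\<le>n. (f (sc x) j)\<^sup>2) \<noteq> 0"
        using pos scB by fastforce
      with True show ?thesis by (auto intro!: continuous_intros ci)
    qed auto
  qed
  have gS: "g (f x) \<in> S" if x: "x \<in> B" for x
  proof -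
    have "(\<Sum>i\<le>n. (g (f x) i)\<^sup>2) = (\<Sum>i\<le>n. (f x i)\<^sup>2 / (\<Sum>j\<le>n. (f x j)\<^sup>2))"
      unfolding g_def using pos[OF x] by (intro sum.cong) (auto simp: power_divide)
    also have "\<dots> = 1" using pos[OF x] by (simp flip: sum_divide_distrib)
    finally show ?thesis by (auto simp: S_def g_def)
  qed
  have "contractible_space (nsphere n)"
    unfolding contractible_space_def ns
  proof (intro exI)
    show "homotopic_with_canon (\<lambda>x. True) S S id (\<lambda>x. g (f (\<lambda>i. 0)))"
    proof (subst homotopic_with, simp, intro exI conjI ballI)
      show "continuous_map (prod_topology (top_of_set {0..1}) (top_of_set S)) (top_of_set S) h"
        using ch gS scB by (auto simp: h_def)
      fix x assume "x \<in> topspace (top_of_set S)"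
      then have x: "x \<in> S" "x \<in> B" by (auto simp: S_def B_def)
      have s: "sc (0, x) = x" by (simp add: sc_def)
      have b: "f x i = x i" if "i \<le> n" for i using x bd that by (auto simp: S_def)
      have e: "(\<Sum>i\<le>n. (f x i)\<^sup>2) = 1" using x b by (simp add: S_def)
      show "h (0, x) = id x"
        unfolding h_def s g_def e using x b by (auto simp: S_def)
      show "h (1, x) = g (f (\<lambda>i. 0))" by (simp add: h_def sc_def)
    qed auto
  qed
  with non_contractible_space_nsphere[of n] show False by (rule notE)
qed

text \<open>Enumerating the pairs of a basis vector and an index below \<open>N\<close> turns
  vector-valued sequences into coordinate sequences. Entries from \<open>N\<close> on are left free
  in \<open>B\<close>, in keeping with the discrete loops below.\<close>

lemma no_retraction:
  fixes P :: "(nat \<Rightarrow> 'a::euclidean_space) \<Rightarrow> nat \<Rightarrow> 'a" and N :: nat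
  defines "B \<equiv> {r. (\<Sum>j<N. (norm (r j))\<^sup>2) \<le> 1}"
  assumes N: "N > 0" and cont: "\<And>j. continuous_on B (\<lambda>r. P r j)"
    and nz: "\<And>r. r \<in> B \<Longrightarrow> \<exists>j<N. P r j \<noteq> 0"
    and bd: "\<And>r j. r \<in> B \<Longrightarrow> (\<Sum>j<N. (norm (r j))\<^sup>2) = 1 \<Longrightarrow> j < N \<Longrightarrow> P r j = r j"
  shows False
proof -
  define I where "I = (Basis :: 'a set) \<times> {..<N}"
  have I: "finite I" "I \<noteq> {}" using N by (auto simp: I_def)
  then obtain n where n: "card I = Suc n" by (metis card_0_eq not0_implies_Suc)
  obtain e where "bij_betw e {0..<card I} I" using ex_bij_betw_nat_finite I(1) by blast
  then have e: "bij_betw e {..n} I" using n by (simp add: atLeast0LessThan lessThan_Suc_atMost)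
  define dd where "dd = the_inv_into {..n} e"
  have ed: "dd (e i) = i" "e i \<in> I" if "i \<le> n" for i
    using bij_betw_apply[OF e] the_inv_into_f_f[OF bij_betw_imp_inj_on[OF e]] that
    by (simp_all add: dd_def)
  \<comment> \<open>For \<open>j\<close> not below \<open>N\<close> the index
    \<open>dd (b, j)\<close> is unspecified, but it is one fixed index, so \<open>dec\<close> is
    continuous in those entries too.\<close>
  define dec where "dec x = (\<lambda>j. \<Sum>b\<in>Basis. x (dd (b, j)) *\<^sub>R b)" for x :: "nat \<Rightarrow> real"
  define enc where "enc r = (\<lambda>i. if i \<le> n then r (snd (e i)) \<bullet> fst (e i) else 0)" for r :: "nat \<Rightarrow> 'a"
  have sq: "(\<Sum>j<N. (norm (r j))\<^sup>2) = (\<Sum>i\<le>n. (enc r i)\<^sup>2)" for r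
  proof -
    have "(\<Sum>j<N. (norm (r j))\<^sup>2) = (\<Sum>j<N. \<Sum>b\<in>Basis. (r j \<bullet> b)\<^sup>2)"
      by (intro sum.cong refl) (subst power2_norm_eq_inner, subst euclidean_inner, simp add: power2_eq_square)
    also have "\<dots> = (\<Sum>(b,j)\<in>I. (r j \<bullet> b)\<^sup>2)"
      unfolding I_def by (subst sum.swap) (simp add: sum.cartesian_product)
    also have "\<dots> = (\<Sum>i\<le>n. case e i of (b,j) \<Rightarrow> (r j \<bullet> b)\<^sup>2)"
      by (rule sum.reindex_bij_betw[OF e, symmetric])
    also have "\<dots> = (\<Sum>i\<le>n. (enc r i)\<^sup>2)"
      by (intro sum.cong refl) (simp add: enc_def case_prod_unfold)
    finally show ?thesis .
  qed
  have encdec: "enc (dec x) i = x i" if "i \<le> n" for x i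
  proof -
    have "fst (e i) \<in> Basis" using ed[OF that] by (auto simp: I_def)
    then have "(\<Sum>b\<in>Basis. x (dd (b, snd (e i))) *\<^sub>R b) \<bullet> fst (e i) = x (dd (fst (e i), snd (e i)))"
      by simp
    then show ?thesis using that ed by (simp add: enc_def dec_def)
  qed
  show False
  proof (rule no_retraction_nat[of n "\<lambda>x. enc (P (dec x))"])
    let ?B = "{x::nat\<Rightarrow>real. (\<Sum>i\<le>n. (x i)\<^sup>2) \<le> 1 \<and> (\<forall>i>n. x i = 0)}"
    have decB: "dec x \<in> B" if "x \<in> ?B" for x
      using that unfolding B_def mem_Collect_eq sq by (simp add: encdec)
    have "continuous_on ?B dec"
      unfolding dec_def
      by (intro continuous_on_coordinatewise_then_product continuous_intros
          continuous_on_product_then_coordinatewise[OF continuous_on_id])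
    then have c: "continuous_on ?B (\<lambda>x. P (dec x) j)" for j
      using decB by (intro continuous_on_compose2[OF cont]) auto
    show "continuous_on ?B (\<lambda>x. enc (P (dec x)))"
    proof (rule continuous_on_coordinatewise_then_product)
      show "continuous_on ?B (\<lambda>x. enc (P (dec x)) i)" for i
        unfolding enc_def by (cases "i \<le> n") (auto intro!: continuous_intros c)
    qed
    fix x assume x: "x \<in> ?B"
    show "\<exists>i\<le>n. enc (P (dec x)) i \<noteq> 0"
    proof -
      obtain j where j: "j < N" "P (dec x) j \<noteq> 0" using nz[OF decB[OF x]] by blast
      have "0 < (\<Sum>j<N. (norm (P (dec x) j))\<^sup>2)"
        using j by (intro sum_pos2[of _ j]) auto
      then have "(\<Sum>i\<le>n. (enc (P (dec x)) i)\<^sup>2) \<noteq> 0" unfolding sq by simp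
      then show ?thesis by (metis (mono_tags, lifting) atMost_iff sum.neutral zero_power2)
    qed
    fix i assume 1: "(\<Sum>i\<le>n. (x i)\<^sup>2) = 1" and i: "i \<le> n"
    have "(\<Sum>j<N. (norm (dec x j))\<^sup>2) = 1" unfolding sq using 1 by (simp add: encdec)
    moreover have "snd (e i) < N" using ed[OF i] by (auto simp: I_def)
    ultimately have "P (dec x) (snd (e i)) = dec x (snd (e i))" using bd decB[OF x] by blast
    then show "enc (P (dec x)) i = x i"
      using encdec[OF i, of x] i by (simp add: enc_def)
  qed
qed

section \<open>Hamiltonians homogeneous of degree two\<close>

text \<open>Allowing negative \<open>t\<close> in \<open>hom\<close> makes H even, which is what
  makes its Hamiltonian equation compatible with antiperiodicity. Continuity of the gradient is
  asked for off the origin only, where a squared gauge can be computed; at the origin it follows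
  from linear growth.\<close>

locale quadratic_hamiltonian =
  fixes H :: "'a::euclidean_space \<times> 'a \<Rightarrow> real" and g :: "'a \<times> 'a \<Rightarrow> 'a \<times> 'a"
  assumes der: "\<And>z. (H has_derivative (\<lambda>w. g z \<bullet> w)) (at z)"
    and contg0: "continuous_on (- {0}) g"
    and hom: "\<And>t z. H (t *\<^sub>R z) = t\<^sup>2 * H z"
    and pos: "\<And>z. z \<noteq> 0 \<Longrightarrow> H z > 0"
begin

lemma H_0 [simp]: "H 0 = 0"
  using hom[of 0 0] by simp

lemma H_nonneg: "H z \<ge> 0"
  using pos[of z] by (cases "z = 0") auto

lemma contH: "continuous_on UNIV H"
  by (meson der differentiable_def differentiable_imp_continuous_on differentiable_on_def differentiable_at_withinI)

text \<open>Differentiate \<open>hom\<close> and cancel one factor \<open>t\<close>. For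
  \<open>t = 0\<close> evenness is used instead: it makes the gradient at 0 its own
  negative.\<close>

lemma g_hom: "g (t *\<^sub>R z) = t *\<^sub>R g z"
proof (cases "t = 0")
  case True
  have "((\<lambda>z. H ((-1) *\<^sub>R z)) has_derivative (\<lambda>w. g ((-1) *\<^sub>R 0) \<bullet> ((-1) *\<^sub>R w))) (at 0)"
    by (rule has_derivative_compose[OF _ der]) (auto intro!: derivative_eq_intros)
  moreover have "(\<lambda>z. H ((-1) *\<^sub>R z)) = H" using hom[of "-1"] by simp
  ultimately have "(H has_derivative (\<lambda>w. - (g 0 \<bullet> w))) (at 0)" by simp
  from has_derivative_unique[OF this der[of 0]] have "- (g 0 \<bullet> g 0) = g 0 \<bullet> g 0" by metis
  then have "g 0 = 0" by simp
  with True show ?thesis by simp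
next
  case False
  have "((\<lambda>z. H (t *\<^sub>R z)) has_derivative (\<lambda>w. g (t *\<^sub>R z) \<bullet> (t *\<^sub>R w))) (at z)"
    by (rule has_derivative_compose[OF _ der]) (auto intro!: derivative_eq_intros)
  moreover have "((\<lambda>z. t\<^sup>2 * H z) has_derivative (\<lambda>w. t\<^sup>2 * (g z \<bullet> w))) (at z)"
    by (rule has_derivative_mult_right[OF der])
  ultimately have "(\<lambda>w. g (t *\<^sub>R z) \<bullet> (t *\<^sub>R w)) = (\<lambda>w. t\<^sup>2 * (g z \<bullet> w))"
    unfolding hom by (rule has_derivative_unique)
  then have e: "g (t *\<^sub>R z) \<bullet> (t *\<^sub>R w) = t\<^sup>2 * (g z \<bullet> w)" for w by meson
  have "g (t *\<^sub>R z) \<bullet> w = (t *\<^sub>R g z) \<bullet> w" for w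
    using e[of w] False by (simp add: power2_eq_square)
  then show ?thesis using vector_eq_rdot by blast
qed

lemma g_0 [simp]: "g 0 = 0"
  using g_hom[of 0 0] by simp

lemma euler: "g z \<bullet> z = 2 * H z"
proof -
  have "((\<lambda>t. H (t *\<^sub>R z)) has_derivative (\<lambda>t. g (1 *\<^sub>R z) \<bullet> (t *\<^sub>R z))) (at 1)"
    by (rule has_derivative_compose[OF _ der]) (auto intro!: derivative_eq_intros)
  moreover have "((\<lambda>t. t\<^sup>2 * H z) has_derivative (\<lambda>t. 2 * t * H z)) (at 1)"
    by (auto intro!: derivative_eq_intros)
  ultimately have "(\<lambda>t. g (1 *\<^sub>R z) \<bullet> (t *\<^sub>R z)) = (\<lambda>t. 2 * t * H z)"
    unfolding hom by (rule has_derivative_unique)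
  then have "g (1 *\<^sub>R z) \<bullet> (1 *\<^sub>R z) = 2 * 1 * H z" by meson
  then show ?thesis by simp
qed

lemma H_bounds:
  obtains K1 K2 where "K1 > 0" "K2 > 0" "\<And>z. K1 * (norm z)\<^sup>2 \<le> H z" "\<And>z. H z \<le> K2 * (norm z)\<^sup>2"
proof -
  define S where "S = (sphere 0 1 :: ('a \<times> 'a) set)"
  obtain b :: 'a where b: "b \<in> Basis" using nonempty_Basis by blast
  have "(b, 0) \<in> S" using b by (simp add: S_def norm_Pair)
  then have S: "compact S" "S \<noteq> {}" unfolding S_def by auto
  have cS: "continuous_on S H" using contH continuous_on_subset by blast
  obtain x where x: "x \<in> S" "\<And>y. y \<in> S \<Longrightarrow> H x \<le> H y"
    using continuous_attains_inf[OF S cS] by blast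
  obtain y where y: "y \<in> S" "\<And>z. z \<in> S \<Longrightarrow> H z \<le> H y"
    using continuous_attains_sup[OF S cS] by blast
  have xp: "H x > 0" using x(1) by (intro pos) (auto simp: S_def)
  have yp: "H y > 0" using y(1) by (intro pos) (auto simp: S_def)
  have n: "H z = (norm z)\<^sup>2 * H (z /\<^sub>R norm z) \<and> z /\<^sub>R norm z \<in> S" if "z \<noteq> 0" for z
    using that by (simp add: hom S_def power_inverse)
  have "H x * (norm z)\<^sup>2 \<le> H z \<and> H z \<le> H y * (norm z)\<^sup>2" for z
  proof (cases "z = 0")
    case False
    from n[OF this] x(2) y(2) show ?thesis by (metis mult.commute mult_left_mono zero_le_power2)
  qed simp
  with xp yp show ?thesis using that by blast
qed

lemma g_bound:
  obtains K where "K > 0" "\<And>z. norm (g z) \<le> K * norm z"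
proof -
  have "continuous_on (sphere 0 1) g" by (rule continuous_on_subset[OF contg0]) auto
  then have "compact (g ` sphere 0 1)" by (rule compact_continuous_image) simp
  then obtain K where K: "K > 0" "\<And>z. z \<in> sphere 0 1 \<Longrightarrow> norm (g z) \<le> K"
    using compact_imp_bounded bounded_pos by (metis imageI)
  have "norm (g z) \<le> K * norm z" for z
  proof (cases "z = 0")
    case False
    have "g z = norm z *\<^sub>R g (z /\<^sub>R norm z)" using False by (simp flip: g_hom)
    moreover have "norm (g (z /\<^sub>R norm z)) \<le> K" using False by (intro K) simp
    ultimately show ?thesis by (metis abs_norm_cancel mult.commute mult_left_mono norm_ge_zero norm_scaleR)
  qed simp
  with K show ?thesis using that by blast
qed

lemma contg: "continuous_on UNIV g"
proof (rule continuous_at_imp_continuous_on, rule ballI)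
  fix z
  show "isCont g z"
  proof (cases "z = 0")
    case True
    obtain K where K: "K > 0" "\<And>z. norm (g z) \<le> K * norm z" using g_bound by blast
    have "(g \<longlongrightarrow> 0) (at 0)"
    proof (rule Lim_null_comparison)
      show "\<forall>\<^sub>F z in at 0. norm (g z) \<le> K * norm z" using K by simp
      show "((\<lambda>z. K * norm z) \<longlongrightarrow> 0) (at (0 :: 'a \<times> 'a))"
        by (rule tendsto_eq_intros refl)+ simp
    qed
    with True show ?thesis by (simp add: isCont_def)
  next
    case False
    then show ?thesis using contg0 by (simp add: continuous_on_eq_continuous_at open_Compl)
  qed
qed

text \<open>Uniform continuity of \<open>g\<close> on a ball settles R = 1, and homogeneity carries
  the estimate to every scale with the same \<delta>. The point \<open>z\<close> may be much smaller
  than R, because entries of a loop will be measured against the norm of the whole loop.\<close>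

lemma taylor:
  assumes "\<eta> > 0"
  obtains \<delta> where "\<delta> > 0"
    "\<And>R z w. R > 0 \<Longrightarrow> norm z \<le> R \<Longrightarrow> norm w \<le> \<delta> * R \<Longrightarrow> \<bar>H (z + w) - H z - g z \<bullet> w\<bar> \<le> \<eta> * R * norm w"
proof -
  have "uniformly_continuous_on (cball 0 2) g"
    using contg continuous_on_subset by (intro compact_uniformly_continuous) auto
  then obtain d where d: "d > 0" "\<And>x y. x \<in> cball 0 2 \<Longrightarrow> y \<in> cball 0 2 \<Longrightarrow> dist y x < d \<Longrightarrow> dist (g y) (g x) < \<eta>"
    unfolding uniformly_continuous_on_def using assms by metis
  define \<delta> where "\<delta> = min 1 (d/2)"
  have 1: "\<bar>H (z + w) - H z - g z \<bullet> w\<bar> \<le> \<eta> * norm w" if z: "norm z \<le> 1" and w: "norm w \<le> \<delta>" for z w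
  proof -
    have nw: "norm w \<le> 1" "norm w < d" using w d by (auto simp: \<delta>_def)
    have "norm (H (z + w) - H z - g z \<bullet> (z + w - z)) \<le> norm (z + w - z) * \<eta>"
    proof (rule differentiable_bound_linearization[where S = "ball z d \<inter> cball 0 2" and f' = "\<lambda>x. (\<bullet>) (g x)"])
      fix t :: real assume t: "t \<in> {0..1}"
      then have "norm (t *\<^sub>R w) \<le> norm w" by (simp add: mult_left_le_one_le)
      then show "z + t *\<^sub>R (z + w - z) \<in> ball z d \<inter> cball 0 2"
        using z nw norm_triangle_ineq[of z "t *\<^sub>R w"] by (auto simp: dist_norm[of z])
    next
      show "(H has_derivative (\<lambda>w. g x \<bullet> w)) (at x within ball z d \<inter> cball 0 2)" for x
        using der has_derivative_at_withinI by blast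
      show "z \<in> ball z d \<inter> cball 0 2" using d z by auto
      fix x assume x: "x \<in> ball z d \<inter> cball 0 2"
      then have gx: "norm (g x - g z) \<le> \<eta>"
        using d(2)[of z x] z by (auto simp: dist_commute dist_norm)
      show "onorm ((\<bullet>) (g x) - (\<bullet>) (g z)) \<le> \<eta>"
      proof (rule onorm_le)
        fix i
        have "norm (g x \<bullet> i - g z \<bullet> i) \<le> norm (g x - g z) * norm i"
          by (metis Cauchy_Schwarz_ineq2 inner_diff_left real_norm_def)
        also have "\<dots> \<le> \<eta> * norm i" using gx by (intro mult_right_mono) auto
        finally show "norm (((\<bullet>) (g x) - (\<bullet>) (g z)) i) \<le> \<eta> * norm i" by simp
      qed
    qed
    then show ?thesis by (simp add: mult.commute)
  qed
  have "\<bar>H (z + w) - H z - g z \<bullet> w\<bar> \<le> \<eta> * R * norm w" if R: "R > 0" and z: "norm z \<le> R" and w: "norm w \<le> \<delta> * R" for R z w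
  proof -
    have "\<bar>H (z /\<^sub>R R + w /\<^sub>R R) - H (z /\<^sub>R R) - g (z /\<^sub>R R) \<bullet> (w /\<^sub>R R)\<bar> \<le> \<eta> * norm (w /\<^sub>R R)"
      using R z w by (intro 1) (auto simp: field_simps)
    moreover have "H (z /\<^sub>R R + w /\<^sub>R R) = (1/R)\<^sup>2 * H (z + w)"
      by (simp flip: scaleR_add_right add: hom divide_inverse)
    moreover have "H (z /\<^sub>R R) = (1/R)\<^sup>2 * H z" by (simp add: hom divide_inverse)
    moreover have "g (z /\<^sub>R R) \<bullet> (w /\<^sub>R R) = (1/R)\<^sup>2 * (g z \<bullet> w)"
      by (simp add: g_hom divide_inverse power2_eq_square)
    ultimately have "\<bar>(1/R)\<^sup>2 * (H (z + w) - H z - g z \<bullet> w)\<bar> \<le> \<eta> * norm w / R"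
      using R by (simp add: algebra_simps divide_inverse)
    then have "(1/R)\<^sup>2 * \<bar>H (z + w) - H z - g z \<bullet> w\<bar> \<le> \<eta> * norm w / R"
      by (simp add: abs_mult)
    then show ?thesis using R by (simp add: field_simps power2_eq_square)
  qed
  moreover have "\<delta> > 0" using d by (simp add: \<delta>_def)
  ultimately show ?thesis using that by blast
qed

end

section \<open>Discrete antiperiodic loops\<close>

text \<open>Only the values at j < N of a sequence matter; position N carries the negative of the value at 0.
  Dq is a forward and Ds minus a backward difference quotient, so that they are adjoint, and Iq inverts Dq.\<close>

definition nxt :: "nat \<Rightarrow> (nat \<Rightarrow> 'a::real_inner) \<Rightarrow> nat \<Rightarrow> 'a" where
  "nxt N q j = (if Suc j < N then q (Suc j) else - q 0)"

definition prv :: "nat \<Rightarrow> (nat \<Rightarrow> 'a::real_inner) \<Rightarrow> nat \<Rightarrow> 'a" where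
  "prv N p j = (if j = 0 then - p (N - 1) else p (j - 1))"

definition Dq :: "nat \<Rightarrow> (nat \<Rightarrow> 'a::real_inner) \<Rightarrow> nat \<Rightarrow> 'a" where
  "Dq N q j = real N *\<^sub>R (nxt N q j - q j)"

definition Ds :: "nat \<Rightarrow> (nat \<Rightarrow> 'a::real_inner) \<Rightarrow> nat \<Rightarrow> 'a" where
  "Ds N p j = real N *\<^sub>R (prv N p j - p j)"

definition Iq :: "nat \<Rightarrow> (nat \<Rightarrow> 'a::real_inner) \<Rightarrow> nat \<Rightarrow> 'a" where
  "Iq N r j = (1 / real N) *\<^sub>R (\<Sum>i<j. r i) - (1 / (2 * real N)) *\<^sub>R (\<Sum>i<N. r i)"

definition n2 :: "nat \<Rightarrow> (nat \<Rightarrow> 'a::real_inner) \<Rightarrow> real" where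
  "n2 N z = (\<Sum>j<N. (norm (z j))\<^sup>2)"

text \<open>Summation by parts without boundary term: the sign of \<open>nxt\<close> at the last
  index matches that of \<open>prv\<close> at the first.\<close>

lemma Dq_adjoint:
  assumes "N > 0"
  shows "(\<Sum>j<N. p j \<bullet> Dq N q j) = (\<Sum>j<N. Ds N p j \<bullet> q j)"
proof -
  obtain M where N: "N = Suc M" using assms gr0_implies_Suc by blast
  have "(\<Sum>j<N. p j \<bullet> nxt N q j) = (\<Sum>j<N. prv N p j \<bullet> q j)"
  proof -
    have "(\<Sum>j<N. p j \<bullet> nxt N q j) = (\<Sum>j<M. p j \<bullet> q (Suc j)) - p M \<bullet> q 0"
      unfolding N by (simp add: nxt_def)
    also have "\<dots> = (\<Sum>j<N. prv N p j \<bullet> q j)"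
      unfolding N by (subst sum.lessThan_Suc_shift) (simp add: prv_def)
    finally show ?thesis .
  qed
  then show ?thesis
    unfolding Dq_def Ds_def by (simp add: inner_diff_left inner_diff_right sum_subtractf flip: sum_distrib_left)
qed

text \<open>The partial sums are a discrete primitive; half of the total sum is the constant of
  integration that makes the value at \<open>N\<close> the negative of the value at 0.\<close>

lemma Dq_Iq:
  assumes "j < N"
  shows "Dq N (Iq N r) j = r j"
proof (cases "Suc j < N")
  case True
  then show ?thesis by (simp add: Dq_def nxt_def Iq_def algebra_simps)
next
  case False
  then have N: "N = Suc j" using assms by auto
  define T where "T = (\<Sum>i<N. r i)"
  have h: "(1 / (2 * real N)) *\<^sub>R T = (1/2) *\<^sub>R ((1 / real N) *\<^sub>R T)" by simp
  have "Dq N (Iq N r) j = real N *\<^sub>R ((1 / real N) *\<^sub>R T - (1 / real N) *\<^sub>R (\<Sum>i<j. r i))"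
    using False unfolding Dq_def nxt_def Iq_def T_def[symmetric] h by (simp add: algebra_simps) (simp flip: scaleR_add_left)
  also have "\<dots> = T - (\<Sum>i<j. r i)" using N by (simp flip: scaleR_diff_right)
  also have "\<dots> = r j" unfolding T_def N by simp
  finally show ?thesis .
qed

lemma n2_nonneg [simp]: "n2 N z \<ge> 0"
  by (simp add: n2_def sum_nonneg)

lemma norm_le_n2: "j < N \<Longrightarrow> norm (z j) \<le> sqrt (n2 N z)"
  unfolding n2_def by (intro real_le_rsqrt member_le_sum[of j "{..<N}" "\<lambda>j. (norm (z j))\<^sup>2"]) auto

lemma n2_pos: "j < N \<Longrightarrow> z j \<noteq> 0 \<Longrightarrow> n2 N z > 0"
  unfolding n2_def by (intro sum_pos2[of _ j]) auto

text \<open>Antiperiodicity replaces a mean-zero condition: all differences together telescope to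
  \<open>- (2 * real N) *\<^sub>R q 0\<close>, so the total variation controls \<open>q 0\<close>
  and hence every entry. Cauchy-Schwarz passes to squares. The constant 4 is not sharp; what counts
  is that it is free of \<open>N\<close>.\<close>

lemma poincare:
  assumes N: "N > 0"
  shows "n2 N q \<le> 4 * n2 N (Dq N q)"
proof -
  have s: "(\<Sum>i<j. Dq N q i) = real N *\<^sub>R (q j - q 0)" if "j < N" for j
    using that by (induction j) (auto simp: Dq_def nxt_def algebra_simps)
  have s1: "(\<Sum>i<N. Dq N q i) = - (2 * real N) *\<^sub>R q 0"
  proof -
    obtain M where M: "N = Suc M" using assms gr0_implies_Suc by blast
    have "(\<Sum>i<N. Dq N q i) = (\<Sum>i<M. Dq N q i) + Dq N q M" unfolding M by simp
    also have "\<dots> = real N *\<^sub>R (q M - q 0) + real N *\<^sub>R (- q 0 - q M)"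
      using s[of M] M by (simp add: Dq_def nxt_def)
    also have "\<dots> = - (2 * real N) *\<^sub>R q 0" by (simp add: algebra_simps) (simp flip: scaleR_add_left)
    finally show ?thesis .
  qed
  define M where "M = (\<Sum>i<N. norm (Dq N q i))"
  have q0: "2 * real N * norm (q 0) \<le> M"
  proof -
    have "2 * real N * norm (q 0) = norm (\<Sum>i<N. Dq N q i)" unfolding s1 by simp
    then show ?thesis unfolding M_def by (simp add: norm_sum)
  qed
  have qj: "real N * norm (q j) \<le> 2 * M" if j: "j < N" for j
  proof -
    have "norm (\<Sum>i<j. Dq N q i) \<le> (\<Sum>i<j. norm (Dq N q i))" by (rule norm_sum)
    also have "\<dots> \<le> M" unfolding M_def using j by (intro sum_mono2) auto
    finally have "real N * norm (q j - q 0) \<le> M" unfolding s[OF j] by simp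
    moreover have "real N * norm (q j) \<le> real N * norm (q j - q 0) + real N * norm (q 0)"
      using norm_triangle_ineq[of "q j - q 0" "q 0"]
      unfolding distrib_left[symmetric] by (intro mult_left_mono) auto
    moreover have "real N * norm (q 0) \<ge> 0" by simp
    ultimately show ?thesis using q0 by linarith
  qed
  have M2: "M\<^sup>2 \<le> real N * n2 N (Dq N q)"
    unfolding M_def n2_def using sum_squared_le_sum_of_squares[of "\<lambda>i. norm (Dq N q i)" "{..<N}"]
    by (simp add: mult.commute)
  have "(norm (q j))\<^sup>2 \<le> 4 * n2 N (Dq N q) / real N" if j: "j < N" for j
  proof -
    have "(real N * norm (q j))\<^sup>2 \<le> (2 * M)\<^sup>2" by (rule power_mono[OF qj[OF j]]) simp
    then have "(real N)\<^sup>2 * (norm (q j))\<^sup>2 \<le> 4 * (real N * n2 N (Dq N q))"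
      using M2 by (simp add: power_mult_distrib)
    then show ?thesis using N by (simp add: field_simps power2_eq_square)
  qed
  then have "n2 N q \<le> (\<Sum>j<N. 4 * n2 N (Dq N q) / real N)" unfolding n2_def[of N q] by (intro sum_mono) auto
  then show ?thesis using N by simp
qed

lemma Iq_add: "Iq N (\<lambda>i. r i + s i) j = Iq N r j + Iq N s j"
  by (simp add: Iq_def sum.distrib algebra_simps)

text \<open>The primitive of a constant is linear with values from -c/2 up towards c/2, and 1/12 is
  the integral of (x - 1/2)^2 over the unit interval. The discrete sum lies slightly above N/12, so
  no error term is needed.\<close>

lemma n2_Iq_const:
  assumes "norm e = 1" "N > 0"
  shows "n2 N (Iq N (\<lambda>_. c *\<^sub>R e)) \<ge> c\<^sup>2 * real N / 12"
proof -
  have e: "Iq N (\<lambda>_. c *\<^sub>R e) j = (c * (real j / real N - 1/2)) *\<^sub>R e" for j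
    using assms(2) by (simp add: Iq_def sum_constant_scaleR algebra_simps flip: scaleR_diff_left)
  have "n2 N (Iq N (\<lambda>_. c *\<^sub>R e)) = (\<Sum>j<N. c\<^sup>2 * (real j / real N - 1/2)\<^sup>2)"
    unfolding n2_def e using assms(1) by (simp add: power_mult_distrib)
  also have "\<dots> = c\<^sup>2 * (\<Sum>j<N. (real j / real N - 1/2)\<^sup>2)" by (simp add: sum_distrib_left)
  also have "(\<Sum>j<N. (real j / real N - 1/2)\<^sup>2) = ((real N)\<^sup>2 + 2) / (12 * real N)"
  proof -
    \<comment> \<open>The centre \<open>a\<close> is kept independent of \<open>n\<close>, otherwise
      the induction would not go through; it becomes N/2 afterwards.\<close>
    have *: "12 * (\<Sum>j<n. (real j - a)\<^sup>2) = 2 * (real n - 1) * real n * (2 * real n - 1) - 12 * a * real n * (real n - 1) + 12 * real n * a\<^sup>2" for n a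
      by (induction n) (auto simp: algebra_simps power2_eq_square)
    have "(\<Sum>j<N. (real j / real N - 1/2)\<^sup>2) = (\<Sum>j<N. (real j - real N / 2)\<^sup>2 / (real N)\<^sup>2)"
      using assms(2) by (intro sum.cong refl) (simp add: field_simps power2_eq_square)
    also have "\<dots> = (12 * (\<Sum>j<N. (real j - real N / 2)\<^sup>2)) / (12 * (real N)\<^sup>2)"
      by (simp add: sum_divide_distrib)
    also have "\<dots> = ((real N)\<^sup>2 + 2) / (12 * real N)"
      unfolding * using assms(2) by (simp add: field_simps power2_eq_square)
    finally show ?thesis .
  qed
  also have "c\<^sup>2 * (((real N)\<^sup>2 + 2) / (12 * real N)) \<ge> c\<^sup>2 * (real N / 12)"
    using assms(2) by (intro mult_left_mono) (auto simp: field_simps power2_eq_square)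
  finally show ?thesis by simp
qed

context quadratic_hamiltonian
begin

section \<open>The discrete action and its linking geometry\<close>

text \<open>The gradient of the quadratic form \<open>act\<close>, with \<open>Ds\<close> entering
  as the adjoint of \<open>Dq\<close>.\<close>

definition LL :: "nat \<Rightarrow> (nat \<Rightarrow> 'a \<times> 'a) \<Rightarrow> nat \<Rightarrow> 'a \<times> 'a" where
  "LL N z j = (Ds N (\<lambda>i. snd (z i)) j, Dq N (\<lambda>i. fst (z i)) j)"

definition act :: "nat \<Rightarrow> (nat \<Rightarrow> 'a \<times> 'a) \<Rightarrow> real" where
  "act N z = (\<Sum>j<N. snd (z j) \<bullet> Dq N (\<lambda>i. fst (z i)) j)"

definition Phi :: "nat \<Rightarrow> (nat \<Rightarrow> 'a \<times> 'a) \<Rightarrow> real" where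
  "Phi N z = (\<Sum>j<N. H (z j))"

definition lam :: "nat \<Rightarrow> (nat \<Rightarrow> 'a \<times> 'a) \<Rightarrow> real" where
  "lam N z = act N z / Phi N z"

text \<open>The gradient of the quotient lam, up to the positive factor Phi N z.\<close>

definition VV :: "nat \<Rightarrow> (nat \<Rightarrow> 'a \<times> 'a) \<Rightarrow> nat \<Rightarrow> 'a \<times> 'a" where
  "VV N z j = LL N z j - lam N z *\<^sub>R g (z j)"

lemma Phi_pos: "n2 N z > 0 \<Longrightarrow> Phi N z > 0"
proof -
  assume "n2 N z > 0"
  have "\<exists>j<N. z j \<noteq> 0"
  proof (rule ccontr)
    assume "\<not> (\<exists>j<N. z j \<noteq> 0)"
    then have "n2 N z = 0" by (simp add: n2_def)
    with \<open>n2 N z > 0\<close> show False by simp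
  qed
  then obtain j where "j < N" "z j \<noteq> 0" by blast
  then show ?thesis
    unfolding Phi_def using pos H_nonneg by (intro sum_pos2[of _ j]) auto
qed

lemma act_LL:
  assumes "N > 0"
  shows "(\<Sum>j<N. LL N z j \<bullet> z j) = 2 * act N z"
proof -
  have "(\<Sum>j<N. LL N z j \<bullet> z j) = (\<Sum>j<N. Ds N (\<lambda>i. snd (z i)) j \<bullet> fst (z j)) + act N z"
    unfolding LL_def act_def by (simp add: inner_Pair_0 inner_prod_def sum.distrib inner_commute)
  also have "(\<Sum>j<N. Ds N (\<lambda>i. snd (z i)) j \<bullet> fst (z j)) = act N z"
    unfolding act_def by (rule Dq_adjoint[OF assms, symmetric])
  finally show ?thesis by simp
qed

lemma Dq_lin: "Dq N (\<lambda>i. q i - t *\<^sub>R w i) j = Dq N q j - t *\<^sub>R Dq N w j"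
  by (simp add: Dq_def nxt_def algebra_simps)

lemma act_expand:
  assumes "N > 0"
  shows "act N (\<lambda>j. z j - t *\<^sub>R w j) = act N z - t * (\<Sum>j<N. LL N z j \<bullet> w j) + t\<^sup>2 * act N w"
proof -
  have "(\<Sum>j<N. snd (w j) \<bullet> Dq N (\<lambda>i. fst (z i)) j) + (\<Sum>j<N. snd (z j) \<bullet> Dq N (\<lambda>i. fst (w i)) j)
      = (\<Sum>j<N. LL N z j \<bullet> w j)"
    unfolding Dq_adjoint[OF assms, of "\<lambda>j. snd (z j)"] LL_def
    by (simp add: inner_prod_def sum.distrib inner_commute)
  moreover have "act N (\<lambda>j. z j - t *\<^sub>R w j) = act N z - t * ((\<Sum>j<N. snd (w j) \<bullet> Dq N (\<lambda>i. fst (z i)) j)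
      + (\<Sum>j<N. snd (z j) \<bullet> Dq N (\<lambda>i. fst (w i)) j)) + t\<^sup>2 * act N w"
    unfolding act_def
    by (simp add: Dq_lin inner_diff_left inner_diff_right sum.distrib sum_subtractf sum_distrib_left
        algebra_simps power2_eq_square)
  ultimately show ?thesis by simp
qed

text \<open>Euler's identity for a function of degree 0: its gradient is orthogonal to the position.
  A step along \<open>VV\<close> therefore never decreases the norm and cannot run into the zero
  loop.\<close>

lemma VV_orth:
  assumes "N > 0" "n2 N z > 0"
  shows "(\<Sum>j<N. VV N z j \<bullet> z j) = 0"
proof -
  have "(\<Sum>j<N. VV N z j \<bullet> z j) = (\<Sum>j<N. LL N z j \<bullet> z j) - lam N z * (\<Sum>j<N. g (z j) \<bullet> z j)"
    unfolding VV_def by (simp add: inner_diff_left sum_subtractf sum_distrib_left)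
  also have "(\<Sum>j<N. g (z j) \<bullet> z j) = 2 * Phi N z"
    unfolding euler Phi_def by (simp add: sum_distrib_left)
  finally show ?thesis
    unfolding act_LL[OF assms(1)] lam_def using Phi_pos[OF assms(2)] by simp
qed

text \<open>This and the following crude bounds grow with \<open>N\<close>. They only fix the step
  length of the descent, which may depend on \<open>N\<close>.\<close>

lemma Dq_bound:
  assumes "j < N" "\<And>i. i < N \<Longrightarrow> norm (q i) \<le> R"
  shows "norm (Dq N q j) \<le> 2 * real N * R"
proof -
  have "norm (nxt N q j) \<le> R" using assms by (auto simp: nxt_def)
  then have "norm (nxt N q j - q j) \<le> 2 * R"
    using assms norm_triangle_ineq4[of "nxt N q j" "q j"] by (smt (verit))
  then have "real N * norm (nxt N q j - q j) \<le> real N * (2 * R)" by (intro mult_left_mono) auto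
  then show ?thesis by (simp add: Dq_def)
qed

lemma Ds_bound:
  assumes "j < N" "\<And>i. i < N \<Longrightarrow> norm (q i) \<le> R"
  shows "norm (Ds N q j) \<le> 2 * real N * R"
proof -
  have "norm (prv N q j) \<le> R" using assms by (auto simp: prv_def)
  then have "norm (prv N q j - q j) \<le> 2 * R"
    using assms norm_triangle_ineq4[of "prv N q j" "q j"] by (smt (verit))
  then have "real N * norm (prv N q j - q j) \<le> real N * (2 * R)" by (intro mult_left_mono) auto
  then show ?thesis by (simp add: Ds_def)
qed

lemma norm_fst_le': "norm z \<le> R \<Longrightarrow> norm (fst z) \<le> R"
  by (metis norm_fst_le order_trans prod.collapse)

lemma norm_snd_le': "norm z \<le> R \<Longrightarrow> norm (snd z) \<le> R"
  by (metis norm_snd_le order_trans prod.collapse)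

lemma LL_bound:
  assumes "j < N"
  shows "norm (LL N z j) \<le> 4 * real N * sqrt (n2 N z)"
proof -
  have "norm (LL N z j) \<le> norm (Ds N (\<lambda>i. snd (z i)) j) + norm (Dq N (\<lambda>i. fst (z i)) j)"
    unfolding LL_def by (rule norm_Pair_le)
  also have "norm (Ds N (\<lambda>i. snd (z i)) j) \<le> 2 * real N * sqrt (n2 N z)"
    by (intro Ds_bound assms norm_snd_le' norm_le_n2)
  also have "norm (Dq N (\<lambda>i. fst (z i)) j) \<le> 2 * real N * sqrt (n2 N z)"
    by (intro Dq_bound assms norm_fst_le' norm_le_n2)
  finally show ?thesis by simp
qed

lemma act_bound: "\<bar>act N z\<bar> \<le> 2 * (real N)\<^sup>2 * n2 N z"
proof -
  have "\<bar>act N z\<bar> \<le> (\<Sum>j<N. \<bar>snd (z j) \<bullet> Dq N (\<lambda>i. fst (z i)) j\<bar>)"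
    unfolding act_def by (rule sum_abs)
  also have "\<dots> \<le> (\<Sum>j<N. sqrt (n2 N z) * (2 * real N * sqrt (n2 N z)))"
  proof (rule sum_mono)
    fix j assume j: "j \<in> {..<N}"
    have "\<bar>snd (z j) \<bullet> Dq N (\<lambda>i. fst (z i)) j\<bar> \<le> norm (snd (z j)) * norm (Dq N (\<lambda>i. fst (z i)) j)"
      by (rule Cauchy_Schwarz_ineq2)
    also have "\<dots> \<le> sqrt (n2 N z) * (2 * real N * sqrt (n2 N z))"
      using j by (intro mult_mono Dq_bound norm_fst_le' norm_snd_le' norm_le_n2) auto
    finally show "\<bar>snd (z j) \<bullet> Dq N (\<lambda>i. fst (z i)) j\<bar> \<le> sqrt (n2 N z) * (2 * real N * sqrt (n2 N z))" .
  qed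
  also have "\<dots> = 2 * (real N)\<^sup>2 * n2 N z"
    by (simp add: power2_eq_square algebra_simps)
  finally show ?thesis .
qed

text \<open>Replacing z by z' = z - t V changes act - lam(z) Phi by - t |V|^2 plus the quadratic
  term of the action and the Taylor error of Phi, each of which costs at most a quarter of t |V|^2.
  Dividing by Phi(z'), itself at most a multiple of |V|^2, leaves a decrease proportional to t.
  Scale invariance lets one \<epsilon> and one \<kappa> serve for loops of any size.\<close>

lemma descent_step:
  assumes N: "N > 0" and C: "C \<ge> 0" and \<delta>: "\<delta> > 0"
  obtains \<epsilon> \<kappa> where "\<epsilon> > 0" "\<kappa> > 0"
    "\<And>z t. n2 N z > 0 \<Longrightarrow> \<bar>lam N z\<bar> \<le> C \<Longrightarrow> n2 N (VV N z) \<ge> \<delta>\<^sup>2 * n2 N z \<Longrightarrow> 0 \<le> t \<Longrightarrow> t \<le> \<epsilon>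
       \<Longrightarrow> lam N (\<lambda>j. z j - t *\<^sub>R VV N z j) \<le> lam N z - t * \<kappa>"
proof -
  obtain K1 K2 where K: "K1 > 0" "K2 > 0" "\<And>z. K1 * (norm z)\<^sup>2 \<le> H z" "\<And>z. H z \<le> K2 * (norm z)\<^sup>2"
    using H_bounds by blast
  obtain Kg where Kg: "Kg > 0" "\<And>z. norm (g z) \<le> Kg * norm z" using g_bound by blast
  \<comment> \<open>Chosen so that \<open>N\<close> Taylor errors times |lam| stay below t/4 |V|^2,
    using \<open>\<delta> * R \<le> RV\<close>; C + 1 instead of C because C may be 0.\<close>
  define \<eta> where "\<eta> = \<delta> / (4 * real N * (C + 1))"
  have \<eta>: "\<eta> > 0" using N C \<delta> by (simp add: \<eta>_def)
  obtain d where d: "d > 0" and tay: "\<And>R z w. R > 0 \<Longrightarrow> norm z \<le> R \<Longrightarrow> norm w \<le> d * R \<Longrightarrow>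
      \<bar>H (z + w) - H z - g z \<bullet> w\<bar> \<le> \<eta> * R * norm w"
    using taylor[OF \<eta>] by blast
  define B where "B = 4 * real N + C * Kg"
  have B: "B > 0" using N C Kg by (simp add: B_def add_pos_nonneg)
  \<comment> \<open>The three bounds serve, in order, the norm of z', the quadratic term of the
    action (see \<open>act_bound\<close>) and the range in which \<open>taylor\<close> applies, as
    \<open>B * R\<close> bounds the entries of V.\<close>
  define \<epsilon> where "\<epsilon> = min 1 (min (1 / (8 * (real N)\<^sup>2)) (d / B))"
  have e: "\<epsilon> > 0" "\<epsilon> \<le> 1" "\<epsilon> \<le> 1 / (8 * (real N)\<^sup>2)" "\<epsilon> \<le> d / B"
    using N d B by (auto simp: \<epsilon>_def)
  \<comment> \<open>The assumption on |V| gives |z'|^2 at most (1/\<delta>^2 + 1) |V|^2, hence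
    Phi(z') at most |V|^2 / (2 \<kappa>).\<close>
  define \<kappa> where "\<kappa> = 1 / (2 * (K2 * (1 / \<delta>\<^sup>2 + 1)))"
  have \<kappa>: "\<kappa> > 0" using K \<delta> by (simp add: \<kappa>_def add_pos_nonneg)
  show ?thesis
  proof (rule that[OF e(1) \<kappa>])
    fix z t assume z: "n2 N z > 0" and l: "\<bar>lam N z\<bar> \<le> C" and V: "n2 N (VV N z) \<ge> \<delta>\<^sup>2 * n2 N z"
      and t: "0 \<le> t" "t \<le> \<epsilon>"
    define R where "R = sqrt (n2 N z)"
    have R: "R > 0" "R\<^sup>2 = n2 N z" using z by (auto simp: R_def)
    define RV where "RV = sqrt (n2 N (VV N z))"
    have RV: "RV \<ge> 0" "RV\<^sup>2 = n2 N (VV N z)" by (auto simp: RV_def)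
    have RRV: "\<delta> * R \<le> RV"
      unfolding RV_def using V R \<delta> by (intro real_le_rsqrt) (simp add: power_mult_distrib)
    define z' where "z' j = z j - t *\<^sub>R VV N z j" for j
    have Vj: "norm (VV N z j) \<le> B * R" if j: "j < N" for j
    proof -
      have "norm (VV N z j) \<le> norm (LL N z j) + \<bar>lam N z\<bar> * norm (g (z j))"
        unfolding VV_def by (metis norm_scaleR norm_triangle_ineq4)
      also have "\<bar>lam N z\<bar> * norm (g (z j)) \<le> C * (Kg * R)"
        using l Kg(2)[of "z j"] Kg(1) norm_le_n2[OF j, of z] C unfolding R_def
        by (intro mult_mono) (auto intro: order_trans)
      also have "norm (LL N z j) \<le> 4 * real N * R" unfolding R_def by (rule LL_bound[OF j])
      finally show ?thesis by (simp add: B_def algebra_simps)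
    qed
    define E where "E j = H (z' j) - H (z j) + t * (g (z j) \<bullet> VV N z j)" for j
    have Ej: "\<bar>E j\<bar> \<le> \<eta> * R * (t * RV)" if j: "j < N" for j
    proof -
      have "norm (- t *\<^sub>R VV N z j) \<le> \<epsilon> * (B * R)"
        using Vj[OF j] t by (simp add: mult_mono)
      also have "\<dots> \<le> d / B * (B * R)" using e(4) B R by (intro mult_right_mono) auto
      also have "\<dots> = d * R" using B by simp
      finally have 1: "norm (- t *\<^sub>R VV N z j) \<le> d * R" .
      have 2: "norm (z j) \<le> R" unfolding R_def by (rule norm_le_n2[OF j])
      have "\<bar>E j\<bar> \<le> \<eta> * R * norm (- t *\<^sub>R VV N z j)"
        using tay[OF R(1) 2 1] by (simp add: E_def z'_def)
      also have "\<dots> \<le> \<eta> * R * (t * RV)"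
        using \<eta> R t norm_le_n2[OF j, of "VV N z"] unfolding RV_def
        by (intro mult_left_mono) (auto intro!: mult_left_mono)
      finally show ?thesis .
    qed
    have SE: "\<bar>lam N z * (\<Sum>j<N. E j)\<bar> \<le> t / 4 * n2 N (VV N z)"
    proof -
      have "\<bar>\<Sum>j<N. E j\<bar> \<le> (\<Sum>j<N. \<eta> * R * (t * RV))"
        using Ej by (intro order_trans[OF sum_abs] sum_mono) auto
      also have "\<dots> = real N * \<eta> / \<delta> * t * RV * (\<delta> * R)" using \<delta> by simp
      also have "\<dots> \<le> real N * \<eta> / \<delta> * t * RV * RV"
        using RRV \<eta> \<delta> t RV by (intro mult_left_mono) auto
      also have "\<dots> = t * n2 N (VV N z) / (4 * (C + 1))"
      proof -
        have "real N * \<eta> / \<delta> = 1 / (4 * (C + 1))" using \<delta> N by (simp add: \<eta>_def)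
        then show ?thesis unfolding RV(2)[symmetric] by (simp add: power2_eq_square)
      qed
      finally have "\<bar>lam N z * (\<Sum>j<N. E j)\<bar> \<le> C * (t * n2 N (VV N z) / (4 * (C + 1)))"
        unfolding abs_mult using l C by (intro mult_mono) auto
      also have "\<dots> \<le> t / 4 * n2 N (VV N z)"
        using C t mult_nonneg_nonneg[OF t(1) n2_nonneg[of N "VV N z"]]
        by (simp add: divide_simps) (simp add: algebra_simps)
      finally show ?thesis .
    qed
    have SA: "t\<^sup>2 * act N (VV N z) \<le> t / 4 * n2 N (VV N z)"
    proof -
      have "t\<^sup>2 * act N (VV N z) \<le> t\<^sup>2 * (2 * (real N)\<^sup>2 * n2 N (VV N z))"
        using act_bound[of N "VV N z"] by (intro mult_left_mono) auto
      also have "\<dots> = t * t * (2 * (real N)\<^sup>2) * n2 N (VV N z)" by (simp add: power2_eq_square)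
      also have "\<dots> \<le> t * (1 / (8 * (real N)\<^sup>2)) * (2 * (real N)\<^sup>2) * n2 N (VV N z)"
        using t e(3) by (intro mult_right_mono mult_left_mono) auto
      also have "\<dots> = t / 4 * n2 N (VV N z)" using N by (simp add: field_simps)
      finally show ?thesis .
    qed
    have az: "act N z = lam N z * Phi N z" using Phi_pos[OF z] by (simp add: lam_def)
    have P': "Phi N z' = Phi N z - t * (\<Sum>j<N. g (z j) \<bullet> VV N z j) + (\<Sum>j<N. E j)"
      unfolding Phi_def E_def by (simp add: sum.distrib sum_subtractf sum_distrib_left)
    have A': "act N z' = act N z - t * (\<Sum>j<N. LL N z j \<bullet> VV N z j) + t\<^sup>2 * act N (VV N z)"
      unfolding z'_def by (rule act_expand[OF N])
    have VV2: "(\<Sum>j<N. LL N z j \<bullet> VV N z j) - lam N z * (\<Sum>j<N. g (z j) \<bullet> VV N z j) = n2 N (VV N z)"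
      unfolding n2_def by (simp add: sum_distrib_left VV_def power2_norm_eq_inner inner_diff_left flip: sum_subtractf)
    have "act N z' - lam N z * Phi N z' = - t * ((\<Sum>j<N. LL N z j \<bullet> VV N z j) - lam N z * (\<Sum>j<N. g (z j) \<bullet> VV N z j))
        + t\<^sup>2 * act N (VV N z) - lam N z * (\<Sum>j<N. E j)"
      unfolding A' P' az by (simp add: algebra_simps)
    then have D: "act N z' - lam N z * Phi N z' \<le> - (t / 2) * n2 N (VV N z)"
      unfolding VV2 using SA SE by (simp add: abs_le_iff)
    have nz': "n2 N z' = n2 N z + t\<^sup>2 * n2 N (VV N z)"
    proof -
      have "n2 N z' = n2 N z - 2 * t * (\<Sum>j<N. VV N z j \<bullet> z j) + t\<^sup>2 * n2 N (VV N z)"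
        unfolding n2_def z'_def power2_norm_eq_inner
        by (simp add: inner_diff_left inner_diff_right inner_commute sum.distrib sum_subtractf
            sum_distrib_left power2_eq_square algebra_simps)
      then show ?thesis using VV_orth[OF N z] by simp
    qed
    then have z'pos: "n2 N z' > 0" using z by (simp add: add_pos_nonneg)
    have "Phi N z' \<le> K2 * n2 N z'"
      unfolding Phi_def n2_def sum_distrib_left by (intro sum_mono K)
    also have "\<dots> \<le> K2 * (1 / \<delta>\<^sup>2 * n2 N (VV N z) + 1 * n2 N (VV N z))"
      unfolding nz' using V \<delta> K t e
      by (intro mult_left_mono add_mono mult_right_mono power_le_one) (auto simp: field_simps)
    also have "\<dots> = n2 N (VV N z) / (2 * \<kappa>)" using K by (simp add: \<kappa>_def algebra_simps)
    finally have "\<kappa> * Phi N z' \<le> n2 N (VV N z) / 2" using \<kappa> by (simp add: field_simps)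
    then have "t * (\<kappa> * Phi N z') \<le> t * (n2 N (VV N z) / 2)" using t by (intro mult_left_mono)
    then have "act N z' \<le> (lam N z - t * \<kappa>) * Phi N z'" using D by (simp add: algebra_simps)
    then show "lam N (\<lambda>j. z j - t *\<^sub>R VV N z j) \<le> lam N z - t * \<kappa>"
      unfolding z'_def[symmetric] lam_def[of N z'] using Phi_pos[OF z'pos] by (simp add: divide_le_eq)
  qed
qed

text \<open>The points z below run through the half space spanned by the subspace p = - Dq and one further direction,
  s being the coordinate in that direction. In lam_lower, z lies in the subspace p = Dq.\<close>

lemma lam_upper:
  assumes N: "N > 0" and e: "norm e = 1"
    and K1: "K1 > 0" "\<And>z. K1 * (norm z)\<^sup>2 \<le> H z"
    and z: "\<And>j. j < N \<Longrightarrow> z j = (Iq N (\<lambda>i. r i + s *\<^sub>R e) j, s *\<^sub>R e - r j)"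
    and zp: "n2 N z > 0"
  shows "lam N z \<le> 24 / K1"
proof -
  define q where "q j = fst (z j)" for j
  define p where "p j = snd (z j)" for j
  have pj: "p j = s *\<^sub>R e - r j" if "j < N" for j using z[OF that] by (simp add: p_def)
  have Dqj: "Dq N q j = r j + s *\<^sub>R e" if j: "j < N" for j
  proof -
    have "Dq N q j = Dq N (Iq N (\<lambda>i. r i + s *\<^sub>R e)) j"
      using j N z by (auto simp: Dq_def nxt_def q_def)
    then show ?thesis using Dq_Iq[OF j] by metis
  qed
  have nz: "n2 N z = n2 N q + n2 N p"
    unfolding n2_def q_def p_def by (simp add: norm_prod_def sum.distrib)
  \<comment> \<open>The inner product of s e - r and r + s e is a difference of squares; only the
    extra direction contributes positively.\<close>
  have "act N z = (\<Sum>j<N. s\<^sup>2 - (norm (r j))\<^sup>2)"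
    unfolding act_def q_def[symmetric] p_def[symmetric]
  proof (rule sum.cong[OF refl])
    fix j assume "j \<in> {..<N}"
    then have j: "j < N" by simp
    have "p j \<bullet> Dq N q j = s\<^sup>2 * (norm e)\<^sup>2 - (norm (r j))\<^sup>2"
      unfolding pj[OF j] Dqj[OF j] power2_norm_eq_inner
      by (simp add: inner_diff_left inner_add_right inner_commute power2_eq_square algebra_simps)
    then show "p j \<bullet> Dq N q j = s\<^sup>2 - (norm (r j))\<^sup>2" using e by simp
  qed
  also have "\<dots> \<le> real N * s\<^sup>2"
    by (simp add: sum_subtractf sum_nonneg)
  finally have A: "act N z \<le> real N * s\<^sup>2" .
  have I2: "n2 N (Iq N p) \<le> 4 * n2 N p"
  proof -
    have "n2 N (Iq N p) \<le> 4 * n2 N (Dq N (Iq N p))" by (rule poincare[OF N])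
    also have "n2 N (Dq N (Iq N p)) = n2 N p" unfolding n2_def by (simp add: Dq_Iq)
    finally show ?thesis .
  qed
  \<comment> \<open>It remains to bound \<open>s\<close> by the norm of \<open>z\<close>. Since Dq +
    p is the constant 2 s e, applying \<open>Iq\<close> writes its primitive as q + Iq p. Its
    squared norm is at least s^2 N / 3 and at most 8 |z|^2, whence the 24.\<close>
  have "(2 * s)\<^sup>2 * real N / 12 \<le> n2 N (Iq N (\<lambda>_. (2 * s) *\<^sub>R e))"
    by (rule n2_Iq_const[OF e N])
  also have "\<dots> \<le> (\<Sum>j<N. 2 * (norm (q j))\<^sup>2 + 2 * (norm (Iq N p j))\<^sup>2)"
    unfolding n2_def
  proof (rule sum_mono)
    fix j assume "j \<in> {..<N}"
    then have j: "j < N" by simp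
    have "Iq N (\<lambda>_. (2 * s) *\<^sub>R e) j = Iq N (\<lambda>i. (r i + s *\<^sub>R e) + p i) j"
      unfolding Iq_def using pj j by (simp add: scaleR_add_left[symmetric])
    also have "\<dots> = q j + Iq N p j" unfolding Iq_add[of N "\<lambda>i. r i + s *\<^sub>R e" p] using z[OF j] by (simp add: q_def)
    finally have "norm (Iq N (\<lambda>_. (2 * s) *\<^sub>R e) j) \<le> norm (q j) + norm (Iq N p j)"
      by (simp add: norm_triangle_ineq)
    then have "(norm (Iq N (\<lambda>_. (2 * s) *\<^sub>R e) j))\<^sup>2 \<le> (norm (q j) + norm (Iq N p j))\<^sup>2"
      by (rule power_mono) simp
    also have "\<dots> \<le> 2 * (norm (q j))\<^sup>2 + 2 * (norm (Iq N p j))\<^sup>2"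
      using sum_squares_bound[of "norm (q j)" "norm (Iq N p j)"] by (simp add: power2_sum)
    finally show "(norm (Iq N (\<lambda>_. (2 * s) *\<^sub>R e) j))\<^sup>2 \<le> 2 * (norm (q j))\<^sup>2 + 2 * (norm (Iq N p j))\<^sup>2" .
  qed
  also have "\<dots> = 2 * n2 N q + 2 * n2 N (Iq N p)"
    unfolding n2_def by (simp add: sum.distrib sum_distrib_left)
  also have "\<dots> \<le> 8 * n2 N z"
  proof -
    have "2 * x + 2 * y \<le> 8 * (x + w)" if "y \<le> 4 * w" "0 \<le> x" for x y w :: real
      using that by simp
    from this[OF I2 n2_nonneg[of N q]] show ?thesis unfolding nz .
  qed
  finally have "real N * s\<^sup>2 \<le> 24 * n2 N z" by (simp add: power2_eq_square mult_ac)
  moreover have "K1 * n2 N z \<le> Phi N z"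
    unfolding Phi_def n2_def sum_distrib_left by (intro sum_mono K1)
  ultimately have "K1 * act N z \<le> 24 * Phi N z"
    using mult_left_mono[OF order_trans[OF A], of "24 * n2 N z" K1] K1(1) by linarith
  then show ?thesis unfolding lam_def using Phi_pos[OF zp] K1(1) by (simp add: field_simps)
qed

lemma lam_lower:
  assumes N: "N > 0" and K2: "K2 > 0" "\<And>z. H z \<le> K2 * (norm z)\<^sup>2"
    and z: "\<And>j. j < N \<Longrightarrow> Dq N (\<lambda>i. fst (z i)) j = snd (z j)"
    and zp: "n2 N z > 0"
  shows "lam N z \<ge> 1 / (5 * K2)"
proof -
  define q where "q j = fst (z j)" for j
  define p where "p j = snd (z j)" for j
  have nz: "n2 N z = n2 N q + n2 N p"
    unfolding n2_def q_def p_def by (simp add: norm_prod_def sum.distrib)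
  have D: "n2 N (Dq N q) = n2 N p" unfolding n2_def q_def p_def using z by simp
  have "act N z = n2 N p"
    unfolding act_def n2_def p_def using z by (simp add: power2_norm_eq_inner)
  moreover have "n2 N q \<le> 4 * n2 N p" using poincare[OF N, of q] D by simp
  \<comment> \<open>5 = 1 + 4, where 4 is the Poincare constant.\<close>
  ultimately have "n2 N z \<le> 5 * act N z" unfolding nz by simp
  then have "K2 * n2 N z \<le> K2 * (5 * act N z)" using K2 by (intro mult_left_mono) auto
  moreover have "Phi N z \<le> K2 * n2 N z"
    unfolding Phi_def n2_def sum_distrib_left by (intro sum_mono K2)
  ultimately have "Phi N z \<le> K2 * (5 * act N z)" by linarith
  then show ?thesis
    unfolding lam_def using Phi_pos[OF zp] K2(1) by (simp add: field_simps)
qed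

lemma cont_Dq: "(\<And>j. continuous_on B (\<lambda>r. q r j)) \<Longrightarrow> continuous_on B (\<lambda>r. Dq N (q r) j)"
  unfolding Dq_def nxt_def by (cases "Suc j < N") (auto intro!: continuous_intros)

lemma cont_Ds: "(\<And>j. continuous_on B (\<lambda>r. q r j)) \<Longrightarrow> continuous_on B (\<lambda>r. Ds N (q r) j)"
  unfolding Ds_def prv_def by (cases "j = 0") (auto intro!: continuous_intros)

lemma cont_lam:
  assumes c: "\<And>j. continuous_on B (\<lambda>r. z r j)" and p: "\<And>r. r \<in> B \<Longrightarrow> n2 N (z r) > 0"
  shows "continuous_on B (\<lambda>r. lam N (z r))"
proof -
  have "continuous_on B (\<lambda>r. H (z r j))" for j
    using c by (intro continuous_on_compose2[OF contH]) auto
  then have "continuous_on B (\<lambda>r. Phi N (z r))"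
    unfolding Phi_def by (intro continuous_intros)
  moreover have "continuous_on B (\<lambda>r. act N (z r))"
    unfolding act_def by (intro continuous_intros cont_Dq c)
  ultimately show ?thesis
    unfolding lam_def using p Phi_pos by (intro continuous_on_divide) fastforce+
qed

lemma cont_VV:
  assumes c: "\<And>j. continuous_on B (\<lambda>r. z r j)" and p: "\<And>r. r \<in> B \<Longrightarrow> n2 N (z r) > 0"
  shows "continuous_on B (\<lambda>r. VV N (z r) j)"
proof -
  have "continuous_on B (\<lambda>r. g (z r j))" for j
    using c by (intro continuous_on_compose2[OF contg]) auto
  then show ?thesis
    unfolding VV_def LL_def by (intro continuous_intros cont_Dq cont_Ds cont_lam c p)
qed

text \<open>If there were no almost critical points, iterating the descent step would push the hemisphere h0
  below the level c while fixing its equator, where lam is non-positive. By lam_lower the projection P along the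
  subspace p = Dq would then not vanish on the disc, contradicting the no-retraction theorem.\<close>

theorem approx_critical:
  obtains c C where "0 < c" "\<And>N \<delta>. N > 0 \<Longrightarrow> \<delta> > 0 \<Longrightarrow>
    \<exists>z. n2 N z > 0 \<and> c \<le> lam N z \<and> lam N z \<le> C \<and> n2 N (VV N z) < \<delta>\<^sup>2 * n2 N z"
proof -
  obtain K1 K2 where K: "K1 > 0" "K2 > 0" "\<And>z. K1 * (norm z)\<^sup>2 \<le> H z" "\<And>z. H z \<le> K2 * (norm z)\<^sup>2"
    using H_bounds by blast
  define c where "c = 1 / (5 * K2)"
  define C where "C = 24 / K1"
  have c: "c > 0" and C: "C > 0" using K by (auto simp: c_def C_def)
  obtain e :: 'a where e: "norm e = 1" using nonempty_Basis norm_Basis by blast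
  have "\<exists>z. n2 N z > 0 \<and> c / 2 \<le> lam N z \<and> lam N z \<le> C \<and> n2 N (VV N z) < \<delta>\<^sup>2 * n2 N z"
    if N: "N > 0" and \<delta>: "\<delta> > 0" for N \<delta>
  proof (rule ccontr)
    assume "\<not> ?thesis"
    then have nc: "\<delta>\<^sup>2 * n2 N z \<le> n2 N (VV N z)" if "n2 N z > 0" "c / 2 \<le> lam N z" "lam N z \<le> C" for z
      using that by (meson not_less)
    obtain \<epsilon> \<kappa> where \<epsilon>: "\<epsilon> > 0" and \<kappa>: "\<kappa> > 0" and step: "\<And>z t. n2 N z > 0 \<Longrightarrow> \<bar>lam N z\<bar> \<le> C \<Longrightarrow>
        n2 N (VV N z) \<ge> \<delta>\<^sup>2 * n2 N z \<Longrightarrow> 0 \<le> t \<Longrightarrow> t \<le> \<epsilon>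
       \<Longrightarrow> lam N (\<lambda>j. z j - t *\<^sub>R VV N z j) \<le> lam N z - t * \<kappa>"
      using descent_step[OF N less_imp_le[OF C] \<delta>] by blast
    \<comment> \<open>A continuous cutoff: the full step is made above level c, none below c/2.
      Points with lam at most 0 stay fixed, and only loops with lam above c/2 need a large gradient,
      which is why c/2 is the lower bound finally obtained.\<close>
    define \<rho> where "\<rho> l = max 0 (min 1 (2 * l / c - 1))" for l
    have \<rho>: "\<rho> l \<ge> 0" "\<rho> l \<le> 1" "l \<le> c / 2 \<Longrightarrow> \<rho> l = 0" "l \<ge> c \<Longrightarrow> \<rho> l = 1" for l
      using c by (auto simp: \<rho>_def field_simps)
    define S where "S z j = z j - (\<epsilon> * \<rho> (lam N z)) *\<^sub>R VV N z j" for z j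
    \<comment> \<open>The height of the hemisphere over the point \<open>r\<close> of the unit ball;
      it vanishes exactly where the squared norm is 1, on the equator.\<close>
    define s where "s r = sqrt (1 - n2 N r)" for r :: "nat \<Rightarrow> 'a"
    define h0 where "h0 r j = (Iq N (\<lambda>i. r i + s r *\<^sub>R e) j, s r *\<^sub>R e - r j)" for r j
    define h where "h k r = (S ^^ k) (h0 r)" for k r
    have hS: "h (Suc k) r = S (h k r)" for k r by (simp add: h_def)
    define B where "B = {r::nat \<Rightarrow> 'a. n2 N r \<le> 1}"
    have S_pos: "n2 N (S z) > 0" if z: "n2 N z > 0" for z
    proof -
      define t where "t = \<epsilon> * \<rho> (lam N z)"
      have "n2 N (S z) = n2 N z - 2 * t * (\<Sum>j<N. VV N z j \<bullet> z j) + t\<^sup>2 * n2 N (VV N z)"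
        unfolding n2_def S_def power2_norm_eq_inner t_def[symmetric]
        by (simp add: inner_diff_left inner_diff_right inner_commute sum.distrib sum_subtractf
            sum_distrib_left power2_eq_square algebra_simps)
      then show ?thesis using VV_orth[OF N z] z by (simp add: add_pos_nonneg)
    qed
    have S_lam: "lam N (S z) \<le> lam N z - \<epsilon> * \<rho> (lam N z) * \<kappa>" if z: "n2 N z > 0" "lam N z \<le> C" for z
    proof (cases "lam N z \<le> c / 2")
      case True
      then have "S z = z" unfolding S_def using \<rho>(3) by auto
      with True \<rho>(3) show ?thesis by simp
    next
      case False
      with z c have "\<bar>lam N z\<bar> \<le> C" "\<delta>\<^sup>2 * n2 N z \<le> n2 N (VV N z)" by (auto intro: nc)
      from step[OF z(1) this, of "\<epsilon> * \<rho> (lam N z)"] \<epsilon> \<rho>(1,2)[of "lam N z"] show ?thesis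
        unfolding S_def[abs_def] by (simp add: mult_left_le)
    qed
    have h0D: "Dq N (\<lambda>i. fst (h0 r i)) j = r j + s r *\<^sub>R e" if "j < N" for r j
      using Dq_Iq[OF that] by (simp add: h0_def)
    have h0_pos: "n2 N (h0 r) > 0" if r: "r \<in> B" for r
    proof (rule ccontr)
      assume "\<not> n2 N (h0 r) > 0"
      then have 0: "h0 r j = 0" if "j < N" for j using n2_pos[OF that, of "h0 r"] by auto
      have "Dq N (\<lambda>i. fst (h0 r i)) j = 0" if "j < N" for j
        using 0 that N by (auto simp: Dq_def nxt_def)
      then have 1: "r j + s r *\<^sub>R e = 0" if "j < N" for j using h0D that by metis
      have 2: "s r *\<^sub>R e - r j = 0" if "j < N" for j using 0[OF that] by (simp add: h0_def zero_prod_def)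
      have r0: "r j = 0" if "j < N" for j
      proof -
        have "r j + r j = 0" using 1[OF that] 2[OF that] by simp
        then show ?thesis by (simp flip: scaleR_2)
      qed
      then have "s r = 1" by (simp add: s_def n2_def)
      with 1[OF N] r0[OF N] e show False by simp
    qed
    have h_pos: "n2 N (h k r) > 0" if "r \<in> B" for k r
      by (induction k) (use h0_pos[OF that] S_pos in \<open>auto simp: h_def\<close>)
    have h0_C: "lam N (h0 r) \<le> C" if "r \<in> B" for r
      unfolding C_def using K h0_pos[OF that]
      by (intro lam_upper[OF N e K(1,3), where r = r and s = "s r"]) (auto simp: h0_def)
    \<comment> \<open>Each step either finds the loop below c, where it stays, or lowers lam by
      \<epsilon> \<kappa>. As lam starts below C uniformly in \<open>r\<close>, a single number of
      steps works for the whole disc.\<close>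
    have h_lam: "lam N (h k r) \<le> C \<and> (lam N (h k r) < c \<or> lam N (h k r) \<le> C - real k * (\<epsilon> * \<kappa>))" if r: "r \<in> B" for k r
    proof (induction k)
      case 0
      then show ?case using h0_C[OF r] by (simp add: h_def)
    next
      case (Suc k)
      have "lam N (h (Suc k) r) \<le> lam N (h k r) - \<epsilon> * \<rho> (lam N (h k r)) * \<kappa>"
        unfolding hS using S_lam h_pos[OF r] Suc by blast
      moreover have "\<epsilon> * \<rho> (lam N (h k r)) * \<kappa> \<ge> 0" using \<epsilon> \<kappa> \<rho> by simp
      moreover have "\<epsilon> * \<rho> (lam N (h k r)) * \<kappa> = \<epsilon> * \<kappa>" if "\<not> lam N (h k r) < c" using that \<rho>(4) by simp
      ultimately show ?case using Suc by (cases "lam N (h k r) < c") (auto simp: algebra_simps)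
    qed
    have cr: "continuous_on B (\<lambda>r. r j)" for j
      by (rule continuous_on_product_then_coordinatewise[OF continuous_on_id])
    have cs: "continuous_on B s"
      unfolding s_def n2_def by (intro continuous_intros cr)
    have ch: "continuous_on B (\<lambda>r. h k r j)" for k j
    proof (induction k arbitrary: j)
      case 0
      then show ?case unfolding h_def h0_def Iq_def by (auto intro!: continuous_intros cr cs)
    next
      case (Suc k)
      have "continuous_on B (\<lambda>r. \<rho> (lam N (h k r)))"
        unfolding \<rho>_def using c by (intro continuous_intros cont_lam Suc h_pos) auto
      then show ?case
        unfolding hS S_def by (intro continuous_intros cont_VV Suc h_pos)
    qed
    obtain M where M: "C - real M * (\<epsilon> * \<kappa>) < c"
    proof -
      obtain M where "(C - c) / (\<epsilon> * \<kappa>) < real M" using reals_Archimedean2 by blast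
      then have "C - real M * (\<epsilon> * \<kappa>) < c" using \<epsilon> \<kappa> by (simp add: field_simps)
      then show ?thesis using that by blast
    qed
    \<comment> \<open>On the undeformed hemisphere this is \<open>r\<close> itself, because Dq - p =
      (r + s e) - (s e - r) there. After the deformation that survives on the equator only, which is
      all the no-retraction theorem asks for.\<close>
    define P where "P r j = (1/2) *\<^sub>R (Dq N (\<lambda>i. fst (h M r i)) j - snd (h M r j))" for r j
    have BB: "B = {r. (\<Sum>j<N. (norm (r j))\<^sup>2) \<le> 1}" unfolding B_def n2_def ..
    show False
    proof (rule no_retraction[OF N, of P], unfold BB[symmetric])
      show "continuous_on B (\<lambda>r. P r j)" for j
        unfolding P_def by (intro continuous_intros cont_Dq ch)
    next
      fix r assume r: "r \<in> B"
      show "\<exists>j<N. P r j \<noteq> 0"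
      proof (rule ccontr)
        assume "\<not> ?thesis"
        then have "Dq N (\<lambda>i. fst (h M r i)) j = snd (h M r j)" if "j < N" for j
          using that by (simp add: P_def)
        then have "lam N (h M r) \<ge> c"
          unfolding c_def using K by (intro lam_lower[OF N K(2,4)] h_pos[OF r]) auto
        with h_lam[OF r, of M] M show False by auto
      qed
      fix j assume 1: "(\<Sum>j<N. (norm (r j))\<^sup>2) = 1" and j: "j < N"
      have s0: "s r = 0" using 1 by (simp add: s_def n2_def)
      have "lam N (h0 r) \<le> 0"
      proof -
        have "act N (h0 r) = - (\<Sum>j<N. (norm (r j))\<^sup>2)"
          unfolding act_def sum_negf[symmetric]
        proof (rule sum.cong[OF refl])
          fix i assume "i \<in> {..<N}"
          then have i: "i < N" by simp
          show "snd (h0 r i) \<bullet> Dq N (\<lambda>i. fst (h0 r i)) i = - (norm (r i))\<^sup>2"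
            unfolding h0D[OF i] using s0 by (simp add: h0_def power2_norm_eq_inner)
        qed
        also have "\<dots> \<le> 0" by (simp add: sum_nonneg)
        finally show ?thesis unfolding lam_def using Phi_pos[OF h0_pos[OF r]] by (simp add: divide_le_0_iff)
      qed
      then have "S (h0 r) = h0 r" unfolding S_def using \<rho>(3) c by auto
      then have "h M r = h0 r" unfolding h_def by (induction M) auto
      then show "P r j = r j" unfolding P_def using h0D[OF j, of r] s0 by (simp add: h0_def flip: scaleR_2)
    qed
  qed
  then show ?thesis using that[of "c / 2" C] c by simp
qed

end

section \<open>Passage to the limit\<close>

definition psgn :: "int \<Rightarrow> real" where
  "psgn m = (if even m then 1 else - 1)"

lemma psgn_simps [simp]: "psgn 0 = 1" "psgn 1 = -1" "\<bar>psgn m\<bar> = 1" "psgn m * psgn m = 1"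
  by (auto simp: psgn_def)

lemma psgn_add: "psgn (m + n) = psgn m * psgn n"
  by (auto simp: psgn_def)

text \<open>The extension to all integers for which a shift by \<open>N\<close> is a change of sign;
  it removes the wrap-around cases from the analysis.\<close>

definition ext :: "nat \<Rightarrow> (nat \<Rightarrow> 'a::real_vector) \<Rightarrow> int \<Rightarrow> 'a" where
  "ext N z j = psgn (j div int N) *\<^sub>R z (nat (j mod int N))"

lemma ext_add_mult: "N > 0 \<Longrightarrow> ext N z (r + int N * m) = psgn m *\<^sub>R ext N z r"
  by (simp add: ext_def psgn_add algebra_simps)

lemma ext_of_nat: "j < N \<Longrightarrow> ext N z (int j) = z j"
  by (simp add: ext_def)

lemma ext_nxt: "j < N \<Longrightarrow> ext N z (int j + 1) = nxt N z j"
proof (cases "Suc j < N")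
  case True
  then show ?thesis using ext_of_nat[of "Suc j" N z] by (simp add: nxt_def add.commute)
next
  case False
  moreover assume "j < N"
  ultimately have "int j + 1 = 0 + int N * 1" and "0 < N" by auto
  then show ?thesis using ext_add_mult[of N z 0 1] ext_of_nat[of 0 N z] False by (simp add: nxt_def)
qed

text \<open>A discrete mean value inequality. With \<open>v\<close> a frozen velocity it later
  yields the derivative of the limit curve without any integration.\<close>

lemma int_steps:
  fixes \<zeta> :: "int \<Rightarrow> 'b::real_normed_vector"
  assumes "i \<le> j" "\<And>l. i \<le> l \<Longrightarrow> l < j \<Longrightarrow> norm (\<zeta> (l + 1) - \<zeta> l - v) \<le> e"
  shows "norm (\<zeta> j - \<zeta> i - real_of_int (j - i) *\<^sub>R v) \<le> real_of_int (j - i) * e"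
  using assms
proof (induction j rule: int_ge_induct)
  case base
  then show ?case by simp
next
  case (step j)
  have "norm (\<zeta> (j + 1) - \<zeta> i - real_of_int (j + 1 - i) *\<^sub>R v)
     = norm ((\<zeta> j - \<zeta> i - real_of_int (j - i) *\<^sub>R v) + (\<zeta> (j + 1) - \<zeta> j - v))"
    by (simp add: algebra_simps)
  also have "\<dots> \<le> real_of_int (j - i) * e + e"
    using step by (intro order_trans[OF norm_triangle_ineq] add_mono) auto
  finally show ?case by (simp add: algebra_simps)
qed

context quadratic_hamiltonian
begin

text \<open>Scaling leaves lam unchanged and multiplies VV linearly, so H may be given mean value 1.
  This prevents the loops from shrinking to 0 or growing as \<open>N\<close> tends to
  infinity.\<close>

lemma normalized_critical:
  obtains c C where "0 < c" "\<And>N \<delta>. N > 0 \<Longrightarrow> \<delta> > 0 \<Longrightarrow>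
    \<exists>z. Phi N z = real N \<and> c \<le> lam N z \<and> lam N z \<le> C \<and> (\<forall>j<N. norm (VV N z j) \<le> \<delta>)"
proof -
  obtain K1 where K: "K1 > 0" "\<And>z. K1 * (norm z)\<^sup>2 \<le> H z" using H_bounds by metis
  obtain c C where c: "c > 0" and ac: "\<And>N \<delta>. N > 0 \<Longrightarrow> \<delta> > 0 \<Longrightarrow>
    \<exists>z. n2 N z > 0 \<and> c \<le> lam N z \<and> lam N z \<le> C \<and> n2 N (VV N z) < \<delta>\<^sup>2 * n2 N z"
    using approx_critical by blast
  have "\<exists>z. Phi N z = real N \<and> c \<le> lam N z \<and> lam N z \<le> C \<and> (\<forall>j<N. norm (VV N z j) \<le> \<delta>)"
    if N: "N > 0" and \<delta>: "\<delta> > 0" for N \<delta>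
  proof -
    \<comment> \<open>After normalisation the squared norm is at most N / K1; this tolerance turns
      the relative bound for the whole of VV into the bound \<delta> for each entry.\<close>
    have "\<delta> * sqrt (K1 / real N) > 0" using K N \<delta> by simp
    from ac[OF N this] obtain z where z: "n2 N z > 0" "c \<le> lam N z" "lam N z \<le> C"
      "n2 N (VV N z) < (\<delta> * sqrt (K1 / real N))\<^sup>2 * n2 N z" by blast
    define t where "t = sqrt (real N / Phi N z)"
    have P: "Phi N z > 0" using Phi_pos[OF z(1)] .
    have t: "t > 0" "t\<^sup>2 = real N / Phi N z" using P N by (auto simp: t_def)
    define y where "y j = t *\<^sub>R z j" for j
    have D: "Dq N (\<lambda>i. t *\<^sub>R w i) j = t *\<^sub>R Dq N w j" "Ds N (\<lambda>i. t *\<^sub>R w i) j = t *\<^sub>R Ds N w j" for w :: "nat \<Rightarrow> 'a" and j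
      by (simp_all add: Dq_def Ds_def nxt_def prv_def algebra_simps)
    have Py: "Phi N y = t\<^sup>2 * Phi N z" unfolding Phi_def y_def hom by (simp add: sum_distrib_left)
    have Ay: "act N y = t\<^sup>2 * act N z"
      unfolding act_def y_def by (simp add: D sum_distrib_left power2_eq_square mult_ac)
    have ly: "lam N y = lam N z" unfolding lam_def Py Ay using t N by simp
    have Vy: "VV N y j = t *\<^sub>R VV N z j" for j
      unfolding VV_def ly LL_def by (simp add: y_def D g_hom scaleR_diff_right)
    have "norm (VV N y j) \<le> \<delta>" if j: "j < N" for j
    proof -
      have "K1 * n2 N z \<le> Phi N z" unfolding Phi_def n2_def sum_distrib_left by (intro sum_mono K)
      then have "t\<^sup>2 * (K1 * n2 N z) \<le> real N" using mult_left_mono[of "K1 * n2 N z" "Phi N z" "t\<^sup>2"] t P by simp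
      then have 1: "t\<^sup>2 * (K1 / real N * n2 N z) \<le> 1" using N by (simp add: field_simps)
      have "(norm (VV N z j))\<^sup>2 \<le> (sqrt (n2 N (VV N z)))\<^sup>2"
        by (intro power_mono norm_le_n2[OF j]) auto
      also have "\<dots> = n2 N (VV N z)" by simp
      also have "\<dots> \<le> \<delta>\<^sup>2 * (K1 / real N) * n2 N z" using z(4) K N by (simp add: power_mult_distrib)
      finally have "t\<^sup>2 * (norm (VV N z j))\<^sup>2 \<le> t\<^sup>2 * (\<delta>\<^sup>2 * (K1 / real N) * n2 N z)" by (rule mult_left_mono) simp
      then have "(norm (VV N y j))\<^sup>2 \<le> \<delta>\<^sup>2 * (t\<^sup>2 * (K1 / real N * n2 N z))"
        unfolding Vy norm_scaleR power_mult_distrib power2_abs by (simp only: mult_ac)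
      also have "\<dots> \<le> \<delta>\<^sup>2 * 1" by (intro mult_left_mono 1) auto
      finally show ?thesis using \<delta> by (simp add: power2_le_iff_abs_le abs_le_square_iff)
    qed
    moreover have "Phi N y = real N" unfolding Py t(2) using P by simp
    ultimately show ?thesis using ly z by metis
  qed
  with c that show ?thesis by blast
qed

text \<open>On the diagonal this is the Hamiltonian vector field; the second argument accounts for the
  staggering of the scheme.\<close>

definition vf :: "'a \<times> 'a \<Rightarrow> 'a \<times> 'a \<Rightarrow> 'a \<times> 'a" where
  "vf x y = (snd (g x), - fst (g y))"

text \<open>The second component of VV at j governs the step of q from j to j + 1, whereas the first
  governs the step of p from j - 1 to j. One step of the orbit thus combines VV at two neighbouring
  indices, and the field is evaluated at both ends of the step.\<close>

lemma discrete_orbit: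
  obtains c C where "0 < c" "\<And>N. N > 0 \<Longrightarrow> \<exists>\<zeta> l. c \<le> l \<and> l \<le> C \<and>
     (\<forall>j m. \<zeta> (j + int N * m) = psgn m *\<^sub>R \<zeta> j) \<and> (\<Sum>j<N. H (\<zeta> (int j))) = real N \<and>
     (\<forall>j. norm (\<zeta> (j + 1) - \<zeta> j - (l / real N) *\<^sub>R vf (\<zeta> j) (\<zeta> (j + 1))) \<le> 1 / (real N)\<^sup>2)"
proof -
  obtain c C where c: "c > 0" and ac: "\<And>N \<delta>. N > 0 \<Longrightarrow> \<delta> > 0 \<Longrightarrow>
    \<exists>z. Phi N z = real N \<and> c \<le> lam N z \<and> lam N z \<le> C \<and> (\<forall>j<N. norm (VV N z j) \<le> \<delta>)"
    using normalized_critical by blast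
  have "\<exists>\<zeta> l. c \<le> l \<and> l \<le> C \<and>
     (\<forall>j m. \<zeta> (j + int N * m) = psgn m *\<^sub>R \<zeta> j) \<and> (\<Sum>j<N. H (\<zeta> (int j))) = real N \<and>
     (\<forall>j. norm (\<zeta> (j + 1) - \<zeta> j - (l / real N) *\<^sub>R vf (\<zeta> j) (\<zeta> (j + 1))) \<le> 1 / (real N)\<^sup>2)"
    if N: "N > 0" for N
  proof -
    \<comment> \<open>Two errors of this size, divided by \<open>N\<close>, add up to 1/N^2 per
      step, so that \<open>N\<close> steps accumulate only 1/N.\<close>
    have "1 / (2 * real N) > 0" using N by simp
    from ac[OF N this] obtain z where z: "Phi N z = real N" "c \<le> lam N z" "lam N z \<le> C"
      "\<And>j. j < N \<Longrightarrow> norm (VV N z j) \<le> 1 / (2 * real N)" by blast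
    define \<zeta> where "\<zeta> = ext N z"
    define l where "l = lam N z"
    have ap: "\<zeta> (j + int N * m) = psgn m *\<^sub>R \<zeta> j" for j m
      unfolding \<zeta>_def by (rule ext_add_mult[OF N])
    define E where "E j = \<zeta> (j + 1) - \<zeta> j - (l / real N) *\<^sub>R vf (\<zeta> j) (\<zeta> (j + 1))" for j
    have E_nat: "norm (E (int j)) \<le> 1 / (real N)\<^sup>2" if j: "j < N" for j
    proof -
      have zj: "\<zeta> (int j) = z j" unfolding \<zeta>_def by (rule ext_of_nat[OF j])
      have zj1: "\<zeta> (int j + 1) = nxt N z j" unfolding \<zeta>_def by (rule ext_nxt[OF j])
      \<comment> \<open>\<open>i\<close> and \<open>\<sigma>\<close> describe the successor of j:
        the index wraps to 0 at the end, and then the sign changes.\<close>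
      define i where "i = (if Suc j < N then Suc j else 0)"
      define \<sigma> :: real where "\<sigma> = (if Suc j < N then 1 else - 1)"
      have i: "i < N" using N by (simp add: i_def)
      have nx: "nxt N z j = \<sigma> *\<^sub>R z i" by (simp add: nxt_def i_def \<sigma>_def)
      have pv: "prv N (\<lambda>i. snd (z i)) i = \<sigma> *\<^sub>R snd (z j)"
      proof (cases "Suc j < N")
        case False
        then have "N - 1 = j" using j by simp
        then show ?thesis using False by (simp add: prv_def i_def \<sigma>_def)
      qed (simp add: prv_def i_def \<sigma>_def)
      have s2: "\<sigma> * \<sigma> = 1" "\<bar>\<sigma>\<bar> = 1" by (auto simp: \<sigma>_def)
      have nf: "nxt N (\<lambda>i. fst (z i)) j = fst (nxt N z j)" by (simp add: nxt_def)
      have f: "real N *\<^sub>R fst (E (int j)) = snd (VV N z j)"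
        unfolding E_def zj zj1 vf_def VV_def LL_def Dq_def nf l_def using N
        by (simp add: scaleR_diff_right)
      have s: "real N *\<^sub>R snd (E (int j)) = - \<sigma> *\<^sub>R fst (VV N z i)"
        unfolding E_def zj zj1 vf_def VV_def LL_def Ds_def pv nx l_def g_hom using N s2
        by (simp add: scaleR_diff_right mult.commute mult.left_commute algebra_simps)
      have "norm (E (int j)) \<le> norm (fst (E (int j))) + norm (snd (E (int j)))"
        by (metis norm_Pair_le prod.collapse)
      then have "real N * norm (E (int j)) \<le> real N * norm (fst (E (int j))) + real N * norm (snd (E (int j)))"
        unfolding distrib_left[symmetric] by (intro mult_left_mono) auto
      also have "real N * norm (fst (E (int j))) = norm (snd (VV N z j))" using f[THEN arg_cong[of _ _ norm]] by simp
      also have "real N * norm (snd (E (int j))) = norm (fst (VV N z i))" using s[THEN arg_cong[of _ _ norm]] s2 by simp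
      also have "norm (snd (VV N z j)) + norm (fst (VV N z i)) \<le> 1 / (2 * real N) + 1 / (2 * real N)"
        by (intro add_mono norm_fst_le' norm_snd_le' z i j)
      finally show ?thesis using N by (simp add: field_simps power2_eq_square)
    qed
    have "norm (E j) \<le> 1 / (real N)\<^sup>2" for j
    proof -
      define m where "m = j div int N"
      define r where "r = nat (j mod int N)"
      have r: "r < N" "j = int r + int N * m" using N by (auto simp: r_def m_def nat_less_iff)
      have j1: "j + 1 = (int r + 1) + int N * m" using r by simp
      have "E j = psgn m *\<^sub>R E (int r)"
        unfolding E_def r(2) using ap[of "int r + 1" m] ap[of "int r" m]
        by (simp add: vf_def g_hom algebra_simps)
      then show ?thesis using E_nat[OF r(1)] by simp
    qed
    moreover have "(\<Sum>j<N. H (\<zeta> (int j))) = real N"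
      using z(1) unfolding Phi_def \<zeta>_def by (simp add: ext_of_nat)
    ultimately show ?thesis using ap z unfolding E_def l_def by blast
  qed
  with c that show ?thesis by blast
qed

lemma vf_bound:
  assumes "\<And>z. norm (g z) \<le> K * norm z"
  shows "norm (vf x y) \<le> K * (norm x + norm y)"
proof -
  have "norm (vf x y) \<le> norm (snd (g x)) + norm (fst (g y))"
    unfolding vf_def using norm_Pair_le[of "snd (g x)" "- fst (g y)"] by simp
  also have "\<dots> \<le> K * norm x + K * norm y" by (intro add_mono norm_fst_le' norm_snd_le' assms)
  finally show ?thesis by (simp add: algebra_simps)
qed

definition discrete_orbit_with :: "real \<Rightarrow> real \<Rightarrow> real \<Rightarrow> real \<Rightarrow> nat \<Rightarrow> (int \<Rightarrow> 'a \<times> 'a) \<Rightarrow> real \<Rightarrow> bool" where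
  "discrete_orbit_with c C L B N \<zeta> l \<longleftrightarrow> c \<le> l \<and> l \<le> C \<and>
     (\<forall>j m. \<zeta> (j + int N * m) = psgn m *\<^sub>R \<zeta> j) \<and> (\<Sum>j<N. H (\<zeta> (int j))) = real N \<and>
     (\<forall>j. norm (\<zeta> (j + 1) - \<zeta> j - (l / real N) *\<^sub>R vf (\<zeta> j) (\<zeta> (j + 1))) \<le> 1 / (real N)\<^sup>2) \<and>
     (\<forall>j. norm (\<zeta> j) \<le> B) \<and> (\<forall>j. norm (\<zeta> (j + 1) - \<zeta> j) \<le> L / real N)"

text \<open>The mean value of H bounds the mean of the norms. Steps grow at most linearly with the
  norms of their end points, so their sum, the total variation over \<open>N\<close> steps, is
  bounded too. As the end point is the negative of the starting point, the variation bounds the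
  latter, hence all points; inserted into the step estimate, this gives the Lipschitz bound.\<close>

lemma discrete_orbit_lipschitz:
  obtains c C L B where "0 < c" "0 < L" "\<And>N. N > 0 \<Longrightarrow> \<exists>\<zeta> l. discrete_orbit_with c C L B N \<zeta> l"
proof -
  obtain K1 where K: "K1 > 0" "\<And>z. K1 * (norm z)\<^sup>2 \<le> H z" using H_bounds by metis
  obtain Kg where Kg: "Kg > 0" "\<And>z. norm (g z) \<le> Kg * norm z" using g_bound by blast
  obtain c C where c: "c > 0" and ac: "\<And>N. N > 0 \<Longrightarrow> \<exists>\<zeta> l. c \<le> l \<and> l \<le> C \<and>
     (\<forall>j m. \<zeta> (j + int N * m) = psgn m *\<^sub>R \<zeta> j) \<and> (\<Sum>j<N. H (\<zeta> (int j))) = real N \<and>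
     (\<forall>j. norm (\<zeta> (j + 1) - \<zeta> j - (l / real N) *\<^sub>R vf (\<zeta> j) (\<zeta> (j + 1))) \<le> 1 / (real N)\<^sup>2)"
    using discrete_orbit by blast
  have C: "C > 0" using ac[of 1] c by fastforce
  \<comment> \<open>\<open>B1\<close> bounds the total variation: 1 + 1/K1 bounds the mean norm
    since a is at most 1 + a^2, and each norm occurs in two steps.\<close>
  define B1 where "B1 = 2 * C * Kg * (1 + 1 / K1) + 1"
  have B1: "B1 > 0" using C Kg K by (simp add: B1_def add_pos_pos)
  define L where "L = 4 * C * Kg * B1 + 1"
  have L: "L > 0" using C Kg B1 by (simp add: L_def add_pos_pos)
  have main: "norm (\<zeta> j) \<le> 2 * B1 \<and> norm (\<zeta> (j + 1) - \<zeta> j) \<le> L / real N"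
    if N: "N > 0" and l: "c \<le> l" "l \<le> C" and ap: "\<And>j m. \<zeta> (j + int N * m) = psgn m *\<^sub>R \<zeta> j"
      and S: "(\<Sum>j<N. H (\<zeta> (int j))) = real N"
      and E: "\<And>j. norm (\<zeta> (j + 1) - \<zeta> j - (l / real N) *\<^sub>R vf (\<zeta> j) (\<zeta> (j + 1))) \<le> 1 / (real N)\<^sup>2"
    for N \<zeta> l j
  proof -
    define a where "a j = norm (\<zeta> j)" for j
    have step: "norm (\<zeta> (j + 1) - \<zeta> j) \<le> (C * Kg * (a j + a (j + 1)) + 1) / real N" for j
    proof -
      have "norm (\<zeta> (j + 1) - \<zeta> j) \<le> norm (\<zeta> (j + 1) - \<zeta> j - (l / real N) *\<^sub>R vf (\<zeta> j) (\<zeta> (j + 1)))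
          + norm ((l / real N) *\<^sub>R vf (\<zeta> j) (\<zeta> (j + 1)))"
        by (metis diff_add_cancel norm_triangle_ineq)
      also have "norm ((l / real N) *\<^sub>R vf (\<zeta> j) (\<zeta> (j + 1))) \<le> C / real N * (Kg * (a j + a (j + 1)))"
        using l c C N vf_bound[OF Kg(2)] unfolding a_def norm_scaleR
        by (intro mult_mono) (auto simp: divide_right_mono)
      also have "norm (\<zeta> (j + 1) - \<zeta> j - (l / real N) *\<^sub>R vf (\<zeta> j) (\<zeta> (j + 1))) \<le> 1 / real N"
      proof -
        have "1 / (real N)\<^sup>2 \<le> 1 / real N" using N by (simp add: field_simps power2_eq_square)
        with E[of j] show ?thesis by linarith
      qed
      finally show ?thesis using N by (simp add: field_simps)
    qed
    have S1: "(\<Sum>j<N. a (int j)) \<le> real N * (1 + 1 / K1)"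
    proof -
      have "K1 * (\<Sum>j<N. (a (int j))\<^sup>2) \<le> real N"
        unfolding sum_distrib_left S[symmetric] a_def by (intro sum_mono K)
      then have 1: "(\<Sum>j<N. (a (int j))\<^sup>2) \<le> real N / K1" using K by (simp add: field_simps)
      have "(\<Sum>j<N. a (int j)) \<le> (\<Sum>j<N. 1 + (a (int j))\<^sup>2)"
      proof (rule sum_mono)
        fix j
        show "a (int j) \<le> 1 + (a (int j))\<^sup>2"
          using sum_squares_bound[of "a (int j)" 1] norm_ge_zero[of "\<zeta> (int j)"]
          unfolding a_def mult_1_right one_power2 by linarith
      qed
      also have "\<dots> \<le> real N * (1 + 1 / K1)" using 1 by (simp add: sum.distrib algebra_simps)
      finally show ?thesis .
    qed
    have aN: "a (int N) = a 0" using ap[of 0 1] by (simp add: a_def)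
    have S2: "(\<Sum>j<N. a (int j + 1)) = (\<Sum>j<N. a (int j))"
    proof -
      have "(\<Sum>j<n. a (int j + 1)) = (\<Sum>j<n. a (int j)) + a (int n) - a 0" for n
        by (induction n) (auto simp: add.commute)
      then show ?thesis using aN by simp
    qed
    define TV where "TV = (\<Sum>j<N. norm (\<zeta> (int j + 1) - \<zeta> (int j)))"
    have TV: "TV \<le> B1"
    proof -
      have "TV \<le> (\<Sum>j<N. (C * Kg * (a (int j) + a (int j + 1)) + 1) / real N)"
        unfolding TV_def by (intro sum_mono step)
      also have "\<dots> = (C * Kg * (\<Sum>j<N. a (int j) + a (int j + 1)) + real N) / real N"
        unfolding sum_divide_distrib[symmetric] sum_distrib_left by (subst sum.distrib) simp
      also have "\<dots> = C * Kg * (2 * (\<Sum>j<N. a (int j))) / real N + 1"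
        using N by (simp add: sum.distrib S2 add_divide_distrib)
      also have "\<dots> \<le> C * Kg * (2 * (real N * (1 + 1 / K1))) / real N + 1"
        using S1 C Kg by (intro add_right_mono divide_right_mono mult_left_mono) auto
      also have "\<dots> = B1" using N by (simp add: B1_def)
      finally show ?thesis .
    qed
    have tv: "norm (\<zeta> (int n) - \<zeta> 0) \<le> TV" if "n \<le> N" for n
    proof -
      have "norm (\<zeta> (int n) - \<zeta> 0) \<le> (\<Sum>j<n. norm (\<zeta> (int j + 1) - \<zeta> (int j)))"
      proof (induction n)
        case (Suc n)
        have "norm (\<zeta> (int n + 1) - \<zeta> 0) \<le> norm (\<zeta> (int n + 1) - \<zeta> (int n)) + norm (\<zeta> (int n) - \<zeta> 0)"
          by (metis diff_add_cancel add_diff_eq norm_triangle_ineq)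
        then show ?case using Suc by (simp add: add.commute)
      qed simp
      also have "\<dots> \<le> TV" unfolding TV_def using that by (intro sum_mono2) auto
      finally show ?thesis .
    qed
    have a0: "2 * a 0 \<le> TV"
    proof -
      have "\<zeta> (int N) - \<zeta> 0 = - 2 *\<^sub>R \<zeta> 0" using ap[of 0 1] by (simp add: scaleR_2)
      then have "norm (\<zeta> (int N) - \<zeta> 0) = 2 * a 0" by (simp add: a_def)
      then show ?thesis using tv[of N] by simp
    qed
    have bd: "a j \<le> 2 * B1" for j
    proof -
      define m where "m = j div int N"
      define r where "r = nat (j mod int N)"
      have r: "r < N" "j = int r + int N * m" using N by (auto simp: r_def m_def nat_less_iff)
      have "a j = a (int r)" unfolding a_def r(2) ap by simp
      also have "\<dots> \<le> a 0 + TV"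
        using tv[of r] r norm_triangle_sub[of "\<zeta> (int r)" "\<zeta> 0"] by (simp add: a_def)
      finally show ?thesis using a0 TV B1 norm_ge_zero[of "\<zeta> 0"] unfolding a_def by linarith
    qed
    have "C * Kg * (a j + a (j + 1)) \<le> C * Kg * (2 * B1 + 2 * B1)"
      using bd C Kg by (intro mult_left_mono add_mono) auto
    then have "(C * Kg * (a j + a (j + 1)) + 1) / real N \<le> L / real N"
      using N by (intro divide_right_mono) (auto simp: L_def algebra_simps)
    with step[of j] bd[of j] show ?thesis by (auto simp: a_def)
  qed
  show ?thesis
  proof (rule that[OF c L, where B = "2 * B1"])
    fix N :: nat assume N: "N > 0"
    from ac[OF N] obtain \<zeta> l where \<zeta>: "c \<le> l" "l \<le> C" "\<And>j m. \<zeta> (j + int N * m) = psgn m *\<^sub>R \<zeta> j"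
      "(\<Sum>j<N. H (\<zeta> (int j))) = real N"
      "\<And>j. norm (\<zeta> (j + 1) - \<zeta> j - (l / real N) *\<^sub>R vf (\<zeta> j) (\<zeta> (j + 1))) \<le> 1 / (real N)\<^sup>2"
      by blast
    with main[OF N \<zeta>] show "\<exists>\<zeta> l. discrete_orbit_with c C L (2 * B1) N \<zeta> l"
      unfolding discrete_orbit_with_def by (intro exI[of _ \<zeta>] exI[of _ l]) simp
  qed
qed

end

section \<open>Piecewise linear interpolation of discrete orbits\<close>

lemma int_lipschitz:
  fixes \<zeta> :: "int \<Rightarrow> 'b::real_normed_vector"
  assumes "i \<le> j" "\<And>l. norm (\<zeta> (l + 1) - \<zeta> l) \<le> e"
  shows "norm (\<zeta> j - \<zeta> i) \<le> real_of_int (j - i) * e"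
  using int_steps[of i j \<zeta> 0 e] assms by simp

definition interp :: "nat \<Rightarrow> (int \<Rightarrow> 'b::real_vector) \<Rightarrow> real \<Rightarrow> 'b" where
  "interp N \<zeta> t = \<zeta> \<lfloor>real N * t\<rfloor> + frac (real N * t) *\<^sub>R (\<zeta> (\<lfloor>real N * t\<rfloor> + 1) - \<zeta> \<lfloor>real N * t\<rfloor>)"

lemma interp_grid: "N > 0 \<Longrightarrow> interp N \<zeta> (real_of_int j / real N) = \<zeta> j"
  by (simp add: interp_def)

text \<open>Within one cell the interpolation is affine; otherwise the increment is split at the
  grid points i + 1 and j, and the three lengths add up.\<close>

lemma interp_lipschitz_le:
  fixes \<zeta> :: "int \<Rightarrow> 'b::real_normed_vector"
  assumes N: "N > 0" and L: "\<And>l. norm (\<zeta> (l + 1) - \<zeta> l) \<le> L / real N" and st: "s \<le> t"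
  shows "norm (interp N \<zeta> t - interp N \<zeta> s) \<le> L * (t - s)"
proof -
  define i where "i = \<lfloor>real N * s\<rfloor>"
  define j where "j = \<lfloor>real N * t\<rfloor>"
  define x where "x = real N * s"
  define y where "y = real N * t"
  define e where "e = L / real N"
  have e: "e \<ge> 0" using L[of 0] norm_ge_zero order_trans unfolding e_def by blast
  have ij: "i \<le> j" unfolding i_def j_def using st N by (intro floor_mono mult_left_mono) auto
  have fx: "frac x = x - i" "0 \<le> x - i" "x - i < 1" unfolding frac_def x_def i_def by linarith+
  have fy: "frac y = y - j" "0 \<le> y - j" "y - j < 1" unfolding frac_def y_def j_def by linarith+
  have xy: "x \<le> y" unfolding x_def y_def using st by (simp add: mult_left_mono)
  have e_eq: "e * (y - x) = L * (t - s)" unfolding e_def x_def y_def using N by (simp add: field_simps)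
  have Is: "interp N \<zeta> s = \<zeta> i + (x - i) *\<^sub>R (\<zeta> (i + 1) - \<zeta> i)"
    unfolding interp_def using fx by (simp add: i_def x_def)
  have It: "interp N \<zeta> t = \<zeta> j + (y - j) *\<^sub>R (\<zeta> (j + 1) - \<zeta> j)"
    unfolding interp_def using fy by (simp add: j_def y_def)
  have L': "norm (\<zeta> (l + 1) - \<zeta> l) \<le> e" for l using L e_def by auto
  show ?thesis
  proof (cases "i = j")
    case True
    have "interp N \<zeta> t - interp N \<zeta> s = (y - x) *\<^sub>R (\<zeta> (i + 1) - \<zeta> i)"
      unfolding Is It True by (simp add: algebra_simps)
    then have "norm (interp N \<zeta> t - interp N \<zeta> s) \<le> (y - x) * e"
      using xy L'[of i] by (simp add: mult_left_mono)
    then show ?thesis using e_eq by (simp add: mult.commute)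
  next
    case False
    then have ij1: "i + 1 \<le> j" using ij by simp
    have "interp N \<zeta> t - interp N \<zeta> s
      = (y - j) *\<^sub>R (\<zeta> (j + 1) - \<zeta> j) + (\<zeta> j - \<zeta> (i + 1)) + (i + 1 - x) *\<^sub>R (\<zeta> (i + 1) - \<zeta> i)"
      unfolding Is It by (simp add: algebra_simps)
    also have "norm \<dots> \<le> (y - j) * e + real_of_int (j - (i + 1)) * e + (i + 1 - x) * e"
      using fx fy L'[of j] L'[of i] int_lipschitz[of "i + 1" j \<zeta> e, OF ij1 L']
      by (intro order_trans[OF norm_triangle_ineq] add_mono) (auto simp: mult_left_mono)
    also have "\<dots> = e * (y - x)" by (simp add: algebra_simps)
    finally show ?thesis using e_eq by simp
  qed
qed

lemma interp_lipschitz: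
  fixes \<zeta> :: "int \<Rightarrow> 'b::real_normed_vector"
  assumes N: "N > 0" and L: "\<And>l. norm (\<zeta> (l + 1) - \<zeta> l) \<le> L / real N"
  shows "norm (interp N \<zeta> t - interp N \<zeta> s) \<le> L * \<bar>t - s\<bar>"
  using interp_lipschitz_le[of N \<zeta> L s t, OF assms] interp_lipschitz_le[of N \<zeta> L t s, OF assms]
  by (cases "s \<le> t") (auto simp: norm_minus_commute abs_if)

lemma interp_add_int:
  assumes N: "N > 0" and ap: "\<And>j m. \<zeta> (j + int N * m) = psgn m *\<^sub>R \<zeta> j"
  shows "interp N \<zeta> (t + real_of_int m) = psgn m *\<^sub>R interp N \<zeta> t"
proof -
  have e: "real N * (t + real_of_int m) = real N * t + real_of_int (int N * m)" by (simp add: algebra_simps)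
  have f: "\<lfloor>real N * (t + real_of_int m)\<rfloor> = \<lfloor>real N * t\<rfloor> + int N * m"
    unfolding e by linarith
  have g: "frac (real N * (t + real_of_int m)) = frac (real N * t)"
    unfolding frac_def f by (simp add: algebra_simps)
  have h: "\<lfloor>real N * t\<rfloor> + int N * m + 1 = \<lfloor>real N * t\<rfloor> + 1 + int N * m" by simp
  show ?thesis unfolding interp_def f g h ap by (simp add: algebra_simps)
qed

context quadratic_hamiltonian
begin

text \<open>Multipliers and interpolated orbits converge along a common subsequence. The equation
  passes to the limit through difference quotients of the grid values, the error of the scheme
  vanishing. Conservation of energy and the normalisation in the mean show that the limit is not the
  zero loop.\<close>

theorem antiperiodic_solution:
  obtains \<tau> :: real and z :: "real \<Rightarrow> 'a \<times> 'a" where "\<tau> > 0" "\<And>t. z (t + 1) = - z t"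
    "\<And>t. (z has_vector_derivative \<tau> *\<^sub>R vf (z t) (z t)) (at t)" "\<And>t. H (z t) = 1"
proof -
  obtain K2 where K2: "K2 > 0" "\<And>z. H z \<le> K2 * (norm z)\<^sup>2" using H_bounds by metis
  obtain c C L B where c: "0 < c" and L: "0 < L"
    and ex: "\<And>N. N > 0 \<Longrightarrow> \<exists>\<zeta> l. discrete_orbit_with c C L B N \<zeta> l"
    by (rule discrete_orbit_lipschitz) (rule that)
  have "\<forall>n. \<exists>\<zeta> l. discrete_orbit_with c C L B (Suc n) \<zeta> l" using ex by simp
  then obtain Z0 l0 where P0: "\<And>n. discrete_orbit_with c C L B (Suc n) (Z0 n) (l0 n)" by metis
  have C: "C > 0" using P0[of 0] c by (auto simp: discrete_orbit_with_def)
  have "\<forall>n. l0 n \<in> {c..C}" using P0 by (auto simp: discrete_orbit_with_def)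
  then obtain \<tau> r1 where \<tau>: "\<tau> \<in> {c..C}" and r1: "strict_mono r1" "(l0 \<circ> r1) \<longlonglongrightarrow> \<tau>"
    using compact_Icc[of c C] unfolding compact_def by metis
  define f0 where "f0 n = interp (Suc (r1 n)) (Z0 (r1 n))" for n
  have f0_lip: "norm (f0 n t - f0 n s) \<le> L * \<bar>t - s\<bar>" for n t s
    unfolding f0_def using P0 by (intro interp_lipschitz) (auto simp: discrete_orbit_with_def)
  have f0_bd: "norm (f0 n t) \<le> B + L" if "t \<in> {0..1}" for n t
  proof -
    have "f0 n 0 = Z0 (r1 n) 0" unfolding f0_def using interp_grid[of "Suc (r1 n)" "Z0 (r1 n)" 0] by simp
    then have "norm (f0 n 0) \<le> B" using P0 by (auto simp: discrete_orbit_with_def)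
    moreover have "norm (f0 n t - f0 n 0) \<le> L * 1"
      using L that by (intro order_trans[OF f0_lip] mult_left_mono) auto
    ultimately show ?thesis using norm_triangle_sub[of "f0 n t" "f0 n 0"] by simp
  qed
  have "\<exists>d>0. \<forall>n y. y \<in> {0..1} \<and> norm (x - y) < d \<longrightarrow> norm (f0 n x - f0 n y) < e" if "e > 0" for x e :: real
  proof (intro exI[of _ "e / L"] conjI allI impI)
    show "e / L > 0" using that L by simp
    fix n y assume "y \<in> {0..1} \<and> norm (x - y) < e / L"
    then have "L * \<bar>x - y\<bar> < e" using L by (simp add: field_simps)
    then show "norm (f0 n x - f0 n y) < e" using f0_lip[of n x y] by simp
  qed
  then obtain G r2 where r2: "strict_mono (r2 :: nat \<Rightarrow> nat)"
    and unif: "\<And>e. 0 < e \<Longrightarrow> \<exists>M. \<forall>n x. n \<ge> M \<and> x \<in> {0..1} \<longrightarrow> norm (f0 (r2 n) x - G x) < e"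
    using Arzela_Ascoli[OF compact_Icc[of 0 "1::real"], of f0 "B + L"] f0_bd by metis
  define N where "N n = Suc (r1 (r2 n))" for n
  define Z where "Z n = Z0 (r1 (r2 n))" for n
  define l where "l n = l0 (r1 (r2 n))" for n
  define f where "f n = f0 (r2 n)" for n
  have f_def': "f n = interp (N n) (Z n)" for n by (simp add: f_def f0_def N_def Z_def)
  have P: "discrete_orbit_with c C L B (N n) (Z n) (l n)" for n unfolding N_def Z_def l_def by (rule P0)
  have Npos: "N n > 0" for n by (simp add: N_def)
  have "strict_mono (\<lambda>n. r1 (r2 n))" using strict_mono_o[OF r1(1) r2] by (simp add: o_def)
  then have "n \<le> r1 (r2 n)" for n by (rule seq_suble)
  then have Nn: "n \<le> N n" for n by (simp add: N_def le_SucI)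
  have Ninf: "filterlim (\<lambda>n. real (N n)) at_top sequentially"
    by (rule filterlim_at_top_mono[OF filterlim_real_sequentially]) (simp add: Nn)
  have N0: "(\<lambda>n. a / real (N n)) \<longlonglongrightarrow> 0" for a
    by (rule tendsto_divide_0[OF tendsto_const]) (use Ninf in \<open>simp add: filterlim_at_top_imp_at_infinity\<close>)
  have l_lim: "l \<longlonglongrightarrow> \<tau>" using LIMSEQ_subseq_LIMSEQ[OF r1(2) r2] by (simp add: l_def[abs_def] o_def)
  have lb: "c \<le> l n" "l n \<le> C" for n using P by (auto simp: discrete_orbit_with_def)
  have f_lip: "norm (f n t - f n s) \<le> L * \<bar>t - s\<bar>" for n t s unfolding f_def by (rule f0_lip)
  have f_int: "f n (t + real_of_int m) = psgn m *\<^sub>R f n t" for n t m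
    unfolding f_def' using P by (intro interp_add_int Npos) (auto simp: discrete_orbit_with_def)
  have f_grid: "f n (real_of_int j / real (N n)) = Z n j" for n j
    unfolding f_def' by (rule interp_grid[OF Npos])
  \<comment> \<open>Convergence to \<open>G\<close> is known on the unit interval only;
    antiperiodicity carries the limit to all times.\<close>
  define z where "z t = psgn \<lfloor>t\<rfloor> *\<^sub>R G (frac t)" for t
  have f_lim: "(\<lambda>n. f n t) \<longlonglongrightarrow> z t" for t
  proof -
    have "(\<lambda>n. f n (frac t)) \<longlonglongrightarrow> G (frac t)"
    proof (rule LIMSEQ_I)
      fix e :: real assume "e > 0"
      from unif[OF this] show "\<exists>M. \<forall>n\<ge>M. norm (f n (frac t) - G (frac t)) < e"
        unfolding f_def by (meson atLeastAtMost_iff frac_ge_0 frac_lt_1 less_imp_le)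
    qed
    moreover have "f n t = psgn \<lfloor>t\<rfloor> *\<^sub>R f n (frac t)" for n
      using f_int[of n "frac t" "\<lfloor>t\<rfloor>"] by (simp add: frac_def)
    ultimately show ?thesis unfolding z_def by (auto intro: tendsto_scaleR)
  qed
  have z_anti: "z (t + 1) = - z t" for t
  proof -
    have "(\<lambda>n. f n (t + 1)) \<longlonglongrightarrow> - z t"
      using f_int[of _ t 1] tendsto_minus[OF f_lim[of t]] by simp
    then show ?thesis using LIMSEQ_unique f_lim by blast
  qed
  \<comment> \<open>The field is frozen at \<open>z t0\<close>. Grid points between s and t have
    times within 2 d of t0 for large n, so they lie within 2 L d of \<open>f n t0\<close>, which is
    within L d of \<open>z t0\<close>: hence 3 L d. The field has two arguments with error e each,
    and the multiplier is at most C: hence 2 C e.\<close>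
  have key: "norm (z t - z s - (t - s) *\<^sub>R (\<tau> *\<^sub>R vf (z t0) (z t0))) \<le> (t - s) * (2 * C * e)"
    if e: "e > 0" and st: "s \<le> t" and d: "d > 0" and gd: "\<And>x. norm (x - z t0) < 3 * L * d \<Longrightarrow> norm (g x - g (z t0)) \<le> e"
      and s: "\<bar>s - t0\<bar> \<le> d" and t: "\<bar>t - t0\<bar> \<le> d" for e d s t t0
  proof -
    define i where "i n = \<lfloor>real (N n) * s\<rfloor>" for n
    define j where "j n = \<lfloor>real (N n) * t\<rfloor>" for n
    define v0 where "v0 = vf (z t0) (z t0)"
    have ij: "i n \<le> j n" for n unfolding i_def j_def using st by (intro floor_mono mult_left_mono) auto
    have fl_lim: "(\<lambda>n. real_of_int \<lfloor>real (N n) * u\<rfloor> / real (N n)) \<longlonglongrightarrow> u" for u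
    proof (rule tendsto_sandwich[of "\<lambda>n. u - 1 / real (N n)" _ _ "\<lambda>n. u"])
      have "u - 1 / real (N n) \<le> real_of_int \<lfloor>real (N n) * u\<rfloor> / real (N n)
          \<and> real_of_int \<lfloor>real (N n) * u\<rfloor> / real (N n) \<le> u" for n
      proof -
        have "(real (N n) * u - 1) / real (N n) \<le> real_of_int \<lfloor>real (N n) * u\<rfloor> / real (N n)"
          "real_of_int \<lfloor>real (N n) * u\<rfloor> / real (N n) \<le> (real (N n) * u) / real (N n)"
          by (intro divide_right_mono; linarith)+
        then show ?thesis using Npos[of n] by (simp add: diff_divide_distrib)
      qed
      then show "\<forall>\<^sub>F n in sequentially. u - 1 / real (N n) \<le> real_of_int \<lfloor>real (N n) * u\<rfloor> / real (N n)"
        and "\<forall>\<^sub>F n in sequentially. real_of_int \<lfloor>real (N n) * u\<rfloor> / real (N n) \<le> u" by auto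
      show "(\<lambda>n. u - 1 / real (N n)) \<longlonglongrightarrow> u" using tendsto_diff[OF tendsto_const N0[of 1], of u] by simp
    qed simp
    have Z_lim: "(\<lambda>n. Z n \<lfloor>real (N n) * u\<rfloor>) \<longlonglongrightarrow> z u" for u
    proof -
      have "(\<lambda>n. norm (f n (real_of_int \<lfloor>real (N n) * u\<rfloor> / real (N n)) - f n u)) \<longlonglongrightarrow> 0"
      proof (rule tendsto_sandwich[of "\<lambda>n. 0" _ _ "\<lambda>n. L * \<bar>real_of_int \<lfloor>real (N n) * u\<rfloor> / real (N n) - u\<bar>"])
        have "(\<lambda>n. L * \<bar>real_of_int \<lfloor>real (N n) * u\<rfloor> / real (N n) - u\<bar>) \<longlonglongrightarrow> L * \<bar>u - u\<bar>"
          by (intro tendsto_intros fl_lim)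
        then show "(\<lambda>n. L * \<bar>real_of_int \<lfloor>real (N n) * u\<rfloor> / real (N n) - u\<bar>) \<longlonglongrightarrow> 0" by simp
      qed (use f_lip in auto)
      then have "(\<lambda>n. Z n \<lfloor>real (N n) * u\<rfloor> - f n u) \<longlonglongrightarrow> 0" unfolding f_grid by (rule tendsto_norm_zero_cancel)
      from tendsto_add[OF this f_lim[of u]] show ?thesis by simp
    qed
    have ev: "\<forall>\<^sub>F n in sequentially. norm (f n t0 - z t0) < L * d \<and> 1 / real (N n) < d"
    proof (intro eventually_conj)
      show "\<forall>\<^sub>F n in sequentially. norm (f n t0 - z t0) < L * d"
        using tendstoD[OF f_lim[of t0], of "L * d"] L d by (simp add: dist_norm)
      show "\<forall>\<^sub>F n in sequentially. 1 / real (N n) < d"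
        using order_tendstoD(2)[OF N0[of 1] d] .
    qed
    have est: "norm (Z n (j n) - Z n (i n) - real_of_int (j n - i n) *\<^sub>R ((l n / real (N n)) *\<^sub>R v0))
        \<le> real_of_int (j n - i n) * (2 * C * e / real (N n) + 1 / (real (N n))\<^sup>2)"
      if n: "norm (f n t0 - z t0) < L * d \<and> 1 / real (N n) < d" for n
    proof (rule int_steps[OF ij])
      fix k assume k: "i n \<le> k" "k < j n"
      have near: "norm (g (Z n m) - g (z t0)) \<le> e" if m: "i n \<le> m" "m \<le> j n" for m
      proof (rule gd)
        have 1: "real (N n) * s - 1 < real_of_int m" using m(1) unfolding i_def by linarith
        have 2: "real_of_int m \<le> real (N n) * t" using m(2) unfolding j_def by linarith
        have "(real (N n) * s - 1) / real (N n) < real_of_int m / real (N n)"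
          using 1 Npos[of n] by (intro divide_strict_right_mono) auto
        then have "s - 1 / real (N n) < real_of_int m / real (N n)" using Npos[of n] by (simp add: diff_divide_distrib)
        moreover have "real_of_int m / real (N n) \<le> t" using 2 Npos[of n] by (simp add: pos_divide_le_eq mult.commute)
        ultimately have "\<bar>real_of_int m / real (N n) - t0\<bar> < 2 * d" using n s t by linarith
        then have "L * \<bar>real_of_int m / real (N n) - t0\<bar> < L * (2 * d)" using L by (intro mult_strict_left_mono)
        then have "norm (Z n m - f n t0) < 2 * L * d"
          using f_lip[of n "real_of_int m / real (N n)" t0] unfolding f_grid by linarith
        moreover have "norm (Z n m - z t0) \<le> norm (Z n m - f n t0) + norm (f n t0 - z t0)"
          by (metis add_diff_eq diff_add_cancel norm_triangle_ineq)
        ultimately show "norm (Z n m - z t0) < 3 * L * d" using n by linarith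
      qed
      have "norm (vf (Z n k) (Z n (k + 1)) - v0) \<le> e + e"
      proof -
        have "vf (Z n k) (Z n (k + 1)) - v0 = (snd (g (Z n k) - g (z t0)), - fst (g (Z n (k + 1)) - g (z t0)))"
          by (simp add: vf_def v0_def)
        then have "norm (vf (Z n k) (Z n (k + 1)) - v0) \<le> norm (snd (g (Z n k) - g (z t0))) + norm (fst (g (Z n (k + 1)) - g (z t0)))"
          using norm_Pair_le[of "snd (g (Z n k) - g (z t0))" "- fst (g (Z n (k + 1)) - g (z t0))"] by (simp add: norm_minus_commute)
        also have "\<dots> \<le> e + e" using k by (intro add_mono norm_fst_le' norm_snd_le' near) auto
        finally show ?thesis .
      qed
      then have "norm ((l n / real (N n)) *\<^sub>R (vf (Z n k) (Z n (k + 1)) - v0)) \<le> C / real (N n) * (e + e)"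
        unfolding norm_scaleR using lb[of n] c C by (intro mult_mono) (auto simp: divide_right_mono)
      moreover have "norm (Z n (k + 1) - Z n k - (l n / real (N n)) *\<^sub>R vf (Z n k) (Z n (k + 1))) \<le> 1 / (real (N n))\<^sup>2"
        using P[of n] by (simp add: discrete_orbit_with_def)
      moreover have "Z n (k + 1) - Z n k - (l n / real (N n)) *\<^sub>R v0 =
          (Z n (k + 1) - Z n k - (l n / real (N n)) *\<^sub>R vf (Z n k) (Z n (k + 1))) + (l n / real (N n)) *\<^sub>R (vf (Z n k) (Z n (k + 1)) - v0)"
        by (simp add: algebra_simps)
      ultimately have "norm (Z n (k + 1) - Z n k - (l n / real (N n)) *\<^sub>R v0) \<le> 1 / (real (N n))\<^sup>2 + C / real (N n) * (e + e)"
        by (simp only: norm_triangle_mono)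
      then show "norm (Z n (k + 1) - Z n k - (l n / real (N n)) *\<^sub>R v0) \<le> 2 * C * e / real (N n) + 1 / (real (N n))\<^sup>2"
        by (simp add: algebra_simps)
    qed
    define \<theta> where "\<theta> n = real_of_int (j n) / real (N n) - real_of_int (i n) / real (N n)" for n
    have \<theta>: "\<theta> \<longlonglongrightarrow> t - s" unfolding \<theta>_def j_def i_def by (intro tendsto_intros fl_lim)
    have \<theta>': "real_of_int (j n - i n) = \<theta> n * real (N n)" for n unfolding \<theta>_def using Npos[of n] by (simp add: field_simps)
    have "norm (z t - z s - (t - s) *\<^sub>R (\<tau> *\<^sub>R v0)) \<le> (t - s) * (2 * C * e + 0)"
    proof (rule tendsto_le[OF sequentially_bot])
      show "(\<lambda>n. norm (Z n (j n) - Z n (i n) - \<theta> n *\<^sub>R (l n *\<^sub>R v0))) \<longlonglongrightarrow> norm (z t - z s - (t - s) *\<^sub>R (\<tau> *\<^sub>R v0))"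
        unfolding j_def i_def by (intro tendsto_intros Z_lim \<theta> l_lim)
      show "(\<lambda>n. \<theta> n * (2 * C * e + 1 / real (N n))) \<longlonglongrightarrow> (t - s) * (2 * C * e + 0)"
        by (intro tendsto_intros \<theta> N0)
      show "\<forall>\<^sub>F n in sequentially. norm (Z n (j n) - Z n (i n) - \<theta> n *\<^sub>R (l n *\<^sub>R v0)) \<le> \<theta> n * (2 * C * e + 1 / real (N n))"
        using ev
      proof eventually_elim
        case (elim n)
        then show ?case using est[of n] Npos[of n] unfolding \<theta>'
          by (simp add: algebra_simps power2_eq_square)
      qed
    qed
    then show ?thesis by (simp add: v0_def)
  qed
  have z_der: "(z has_vector_derivative \<tau> *\<^sub>R vf (z t0) (z t0)) (at t0)" for t0
    unfolding has_vector_derivative_def has_derivative_at_alt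
  proof (intro conjI allI impI)
    show "bounded_linear (\<lambda>x. x *\<^sub>R \<tau> *\<^sub>R vf (z t0) (z t0))" by (rule bounded_linear_scaleR_left)
    fix \<eta> :: real assume \<eta>: "\<eta> > 0"
    define e where "e = \<eta> / (2 * C)"
    have e: "e > 0" using \<eta> C by (simp add: e_def)
    have "isCont g (z t0)" using contg continuous_on_eq_continuous_at[OF open_UNIV] by blast
    then obtain d0 where d0: "d0 > 0" "\<And>x. dist x (z t0) < d0 \<Longrightarrow> dist (g x) (g (z t0)) < e"
      unfolding continuous_at_eps_delta using e by metis
    define d where "d = d0 / (3 * L)"
    have d: "d > 0" using d0 L by (simp add: d_def)
    have gd: "norm (g x - g (z t0)) \<le> e" if "norm (x - z t0) < 3 * L * d" for x
      using d0(2)[of x] that L by (simp add: d_def dist_norm)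
    show "\<exists>d>0. \<forall>y. norm (y - t0) < d \<longrightarrow>
        norm (z y - z t0 - (y - t0) *\<^sub>R \<tau> *\<^sub>R vf (z t0) (z t0)) \<le> \<eta> * norm (y - t0)"
    proof (intro exI[of _ d] conjI allI impI d)
      fix y assume y: "norm (y - t0) < d"
      have Ce: "2 * C * e = \<eta>" using C by (simp add: e_def)
      show "norm (z y - z t0 - (y - t0) *\<^sub>R \<tau> *\<^sub>R vf (z t0) (z t0)) \<le> \<eta> * norm (y - t0)"
      proof (cases "t0 \<le> y")
        case True
        have "norm (z y - z t0 - (y - t0) *\<^sub>R (\<tau> *\<^sub>R vf (z t0) (z t0))) \<le> (y - t0) * (2 * C * e)"
          using y d by (intro key[OF e True d gd]) auto
        then show ?thesis using True Ce by (simp add: mult.commute)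
      next
        case False
        then have yt: "y \<le> t0" by simp
        have "norm (z t0 - z y - (t0 - y) *\<^sub>R (\<tau> *\<^sub>R vf (z t0) (z t0))) \<le> (t0 - y) * (2 * C * e)"
          using y d by (intro key[OF e yt d gd]) auto
        also have "(t0 - y) * (2 * C * e) = \<eta> * norm (y - t0)" using yt Ce by simp
        also have "z t0 - z y - (t0 - y) *\<^sub>R (\<tau> *\<^sub>R vf (z t0) (z t0)) = - (z y - z t0 - (y - t0) *\<^sub>R (\<tau> *\<^sub>R vf (z t0) (z t0)))"
          by (simp add: algebra_simps)
        finally show ?thesis unfolding norm_minus_cancel .
      qed
    qed
  qed
  \<comment> \<open>The field is the gradient turned by a right angle, so energy is conserved. The
    discrete orbits had only the mean value of H prescribed; for the limit H is constant.\<close>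
  have orth: "g x \<bullet> vf x x = 0" for x
    by (simp add: vf_def inner_prod_def inner_commute)
  have "((\<lambda>t. H (z t)) has_field_derivative 0) (at t)" for t
  proof -
    have "((\<lambda>t. H (z t)) has_derivative (\<lambda>h. g (z t) \<bullet> (h *\<^sub>R (\<tau> *\<^sub>R vf (z t) (z t))))) (at t)"
      using z_der[of t] unfolding has_vector_derivative_def by (rule has_derivative_compose[OF _ der])
    then show ?thesis by (simp add: orth has_field_derivative_def lambda_zero)
  qed
  then have const: "H (z t) = H (z 0)" for t using DERIV_isconst_all by blast
  define h0 where "h0 = H (z 0)"
  have h0: "h0 > 0"
  proof (rule ccontr)
    assume "\<not> h0 > 0"
    then have z0: "z t = 0" for t using const[of t] pos[of "z t"] H_nonneg[of "z 0"] unfolding h0_def by force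
    have G0: "G x = 0" if "x \<in> {0..<1}" for x
    proof -
      have "\<lfloor>x\<rfloor> = 0" using that by (auto simp: floor_eq_iff)
      then show ?thesis using z0[of x] by (simp add: z_def frac_def)
    qed
    \<comment> \<open>Uniform closeness of \<open>f n\<close> to 0 by this \<eta> makes H at most
      1/2 at all grid points, against mean value 1.\<close>
    define \<eta> where "\<eta> = 1 / sqrt (2 * K2)"
    have \<eta>: "\<eta> > 0" "K2 * \<eta>\<^sup>2 = 1/2" using K2 by (auto simp: \<eta>_def power_divide)
    obtain n where n: "\<And>x. x \<in> {0..1} \<Longrightarrow> norm (f n x - G x) < \<eta>"
      using unif[OF \<eta>(1)] unfolding f_def by blast
    have "H (Z n (int j)) \<le> 1/2" if j: "j < N n" for j
    proof -
      have x: "real j / real (N n) \<in> {0..<1}" using j by auto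
      then have "norm (f n (real_of_int (int j) / real (N n))) < \<eta>" using n[of "real j / real (N n)"] G0[OF x] by auto
      then have "norm (Z n (int j)) < \<eta>" unfolding f_grid .
      then have "(norm (Z n (int j)))\<^sup>2 \<le> \<eta>\<^sup>2" by (intro power_mono) auto
      then have "K2 * (norm (Z n (int j)))\<^sup>2 \<le> K2 * \<eta>\<^sup>2" using K2 by (intro mult_left_mono) auto
      then show ?thesis using K2(2)[of "Z n (int j)"] \<eta> by linarith
    qed
    then have "(\<Sum>j<N n. H (Z n (int j))) \<le> (\<Sum>j<N n. 1/2)" by (intro sum_mono) auto
    moreover have "(\<Sum>j<N n. H (Z n (int j))) = real (N n)" using P[of n] by (simp add: discrete_orbit_with_def)
    ultimately show False using Npos[of n] by simp
  qed
  define w where "w t = (1 / sqrt h0) *\<^sub>R z t" for t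
  show ?thesis
  proof (rule that[of \<tau> w])
    show "\<tau> > 0" using \<tau> c by auto
    show "w (t + 1) = - w t" for t by (simp add: w_def z_anti)
    show "H (w t) = 1" for t unfolding w_def hom using const[of t] h0 by (simp add: h0_def power_divide)
    show "(w has_vector_derivative \<tau> *\<^sub>R vf (w t) (w t)) (at t)" for t
    proof -
      have "vf (w t) (w t) = (1 / sqrt h0) *\<^sub>R vf (z t) (z t)" by (simp add: vf_def w_def g_hom)
      moreover have "(w has_vector_derivative (1 / sqrt h0) *\<^sub>R (\<tau> *\<^sub>R vf (z t) (z t))) (at t)"
        unfolding w_def[abs_def] by (rule bounded_linear.has_vector_derivative[OF bounded_linear_scaleR_right z_der])
      ultimately show ?thesis by (simp add: mult.commute)
    qed
  qed
qed

end

section \<open>Lifting to the covering of the quotient\<close>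

text \<open>Freeness is required on \<open>S\<close> only, since a linear action fixes the origin.
  Isometry of \<open>f\<close> lets balls of one radius serve as the sheets around all points of an
  orbit.\<close>

locale free_isometric_action =
  fixes f :: "'a::real_normed_vector \<Rightarrow> 'a" and m :: nat and S :: "'a set"
  assumes m: "m > 0" and iso: "\<And>x y. norm (f x - f y) = norm (x - y)"
    and period: "\<And>x. (f ^^ m) x = x" and S: "f ` S \<subseteq> S"
    and free: "\<And>x l. x \<in> S \<Longrightarrow> 0 < l \<Longrightarrow> l < m \<Longrightarrow> (f ^^ l) x \<noteq> x"
begin

definition orb :: "'a \<Rightarrow> 'a set" where "orb x = {(f ^^ l) x | l. l < m}"

lemma iso_pow: "norm ((f ^^ l) x - (f ^^ l) y) = norm (x - y)"
  by (induction l) (auto simp: iso)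

lemma S_pow: "x \<in> S \<Longrightarrow> (f ^^ l) x \<in> S"
  using S by (induction l) auto

lemma cont_pow: "continuous_on A (f ^^ l)"
  unfolding continuous_on_iff dist_norm iso_pow by blast

lemma pow_mod: "(f ^^ n) x = (f ^^ (n mod m)) x"
proof -
  have "(f ^^ (m * j)) x = x" for j x by (induction j) (auto simp: funpow_add period)
  then have "(f ^^ (n mod m + m * (n div m))) x = (f ^^ (n mod m)) x" unfolding funpow_add by simp
  moreover have "n mod m + m * (n div m) = n" by simp
  ultimately show ?thesis by metis
qed

lemma pow_in_orb: "(f ^^ n) x \<in> orb x"
  unfolding orb_def using pow_mod[of n x] m by (metis (mono_tags, lifting) mem_Collect_eq mod_less_divisor)

lemma orb_pow: "orb ((f ^^ n) x) = orb x"
proof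
  show "orb ((f ^^ n) x) \<subseteq> orb x"
  proof
    fix y assume "y \<in> orb ((f ^^ n) x)"
    then obtain l where "y = (f ^^ (l + n)) x" by (auto simp: orb_def funpow_add)
    then show "y \<in> orb x" using pow_in_orb by simp
  qed
  show "orb x \<subseteq> orb ((f ^^ n) x)"
  proof
    fix y assume "y \<in> orb x"
    then obtain l where l: "y = (f ^^ l) x" by (auto simp: orb_def)
    have "(f ^^ (l + (m - 1) * n)) ((f ^^ n) x) = (f ^^ (l + m * n)) x"
      using m by (simp flip: funpow_add[THEN fun_cong, unfolded o_apply]) (cases m; simp add: algebra_simps)
    also have "\<dots> = (f ^^ l) x" using pow_mod[of "l + m * n" x] pow_mod[of l x] by simp
    finally show "y \<in> orb ((f ^^ n) x)" using l pow_in_orb by metis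
  qed
qed

lemma orb_eqD: "orb x = orb y \<Longrightarrow> \<exists>l<m. y = (f ^^ l) x"
  using pow_in_orb[of 0 y] by (auto simp: orb_def)

abbreviation Y where "Y \<equiv> quotient_topology (top_of_set S) orb"

lemma topspace_Y: "topspace Y = orb ` S"
proof -
  have "{x \<in> S. orb x \<in> orb ` S} = S" by auto
  then have "openin Y (orb ` S)" by (simp add: openin_quotient_topology)
  then have "orb ` S \<subseteq> topspace Y" by (rule openin_subset)
  moreover have "topspace Y \<subseteq> orb ` S"
    using openin_topspace[of Y] unfolding openin_quotient_topology by simp
  ultimately show ?thesis by blast
qed

lemma continuous_map_orb: "continuous_map (top_of_set S) Y orb"
  unfolding continuous_map_def topspace_Y by (auto simp: openin_quotient_topology)

text \<open>The quotient map is open: the saturation of an open set is the union of its preimages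
  under the powers of \<open>f\<close>.\<close>

lemma openin_orb_ball: "openin Y (orb ` (S \<inter> ball x r))"
proof -
  have "{y \<in> S. orb y \<in> orb ` (S \<inter> ball x r)} = (\<Union>l\<in>{..<m}. S \<inter> (f ^^ l) -` ball x r)" (is "?L = ?R")
  proof
    show "?L \<subseteq> ?R"
    proof
      fix y assume "y \<in> ?L"
      then obtain w where w: "y \<in> S" "w \<in> S \<inter> ball x r" "orb y = orb w" by auto
      from orb_eqD[OF w(3)] obtain l where "l < m" "w = (f ^^ l) y" by blast
      with w show "y \<in> ?R" by auto
    qed
    show "?R \<subseteq> ?L"
    proof
      fix y assume "y \<in> ?R"
      then obtain l where l: "y \<in> S" "(f ^^ l) y \<in> ball x r" by auto
      then have "orb y = orb ((f ^^ l) y)" "(f ^^ l) y \<in> S \<inter> ball x r" using orb_pow S_pow by auto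
      with l show "y \<in> ?L" by blast
    qed
  qed
  moreover have "openin (top_of_set S) (\<Union>l\<in>{..<m}. S \<inter> (f ^^ l) -` ball x r)"
    by (intro openin_Union) (auto intro!: continuous_openin_preimage_gen cont_pow)
  ultimately show ?thesis by (auto simp: openin_quotient_topology)
qed

text \<open>Balls of radius d/2 around the points of the orbit of x are disjoint; this provides
  evenly covered neighbourhoods.\<close>

lemma displacement:
  assumes "x \<in> S"
  obtains d where "d > 0" "\<And>l. 0 < l \<Longrightarrow> l < m \<Longrightarrow> d \<le> norm ((f ^^ l) x - x)"
proof
  \<comment> \<open>The element 1 keeps the set nonempty when m = 1.\<close>
  let ?D = "insert 1 ((\<lambda>l. norm ((f ^^ l) x - x)) ` {0<..<m})"
  show "Min ?D > 0" using free[OF assms] by (subst Min_gr_iff) auto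
  show "Min ?D \<le> norm ((f ^^ l) x - x)" if "0 < l" "l < m" for l using that by (intro Min_le) auto
qed

text \<open>A map into the quotient is lifted by lifting the identity through the pulled back covering.\<close>

lemma lift_quotient_map:
  fixes K :: "'c::real_normed_vector set"
  assumes K: "convex K" and h: "continuous_map (top_of_set K) Y h"
  obtains g where "continuous_on K g" "g ` K \<subseteq> S" "\<And>u. u \<in> K \<Longrightarrow> orb (g u) = h u"
proof -
  \<comment> \<open>The pulled back covering is a subset of a normed space, whereas the quotient is
    an abstract topology on orbits. A section of \<open>X\<close> over \<open>K\<close> is exactly a
    lift of \<open>h\<close>.\<close>
  define X where "X = {p. fst p \<in> K \<and> snd p \<in> S \<and> orb (snd p) = h (fst p)}"
  have hK: "h u \<in> orb ` S" if "u \<in> K" for u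
    using h that unfolding continuous_map_def topspace_Y by auto
  have pre: "openin (top_of_set K) {u \<in> K. h u \<in> orb ` (S \<inter> ball x r)}" for x r
    using openin_continuous_map_preimage[OF h openin_orb_ball] by simp
  have "covering_space X fst K"
  proof
    show "continuous_on X fst" by (intro continuous_intros)
    show "fst ` X = K"
    proof
      show "K \<subseteq> fst ` X"
      proof
        fix u assume u: "u \<in> K"
        then obtain x where "x \<in> S" "h u = orb x" using hK by blast
        with u have "(u, x) \<in> X" by (simp add: X_def)
        then show "u \<in> fst ` X" by force
      qed
    qed (auto simp: X_def)
    fix u0 assume u0: "u0 \<in> K"
    then obtain x0 where x0: "x0 \<in> S" "h u0 = orb x0" using hK by blast
    obtain d where d: "d > 0" "\<And>l. 0 < l \<Longrightarrow> l < m \<Longrightarrow> d \<le> norm ((f ^^ l) x0 - x0)"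
      using displacement[OF x0(1)] by blast
    define r where "r = d / 2"
    have r: "r > 0" using d by (simp add: r_def)
    \<comment> \<open>\<open>T\<close> is the evenly covered neighbourhood, and \<open>U l\<close>
      below is the sheet near the l-th point of the orbit of x0.\<close>
    define T where "T = {u \<in> K. h u \<in> orb ` (S \<inter> ball x0 r)}"
    define U where "U l = {p \<in> X. snd p \<in> ball ((f ^^ l) x0) r}" for l
    have far: "d \<le> norm ((f ^^ l) x0 - (f ^^ l') x0)" if "l < l'" "l' < m" for l l'
    proof -
      have "norm ((f ^^ l) x0 - (f ^^ l) ((f ^^ (l' - l)) x0)) = norm (x0 - (f ^^ (l' - l)) x0)" by (rule iso_pow)
      moreover have "(f ^^ l) ((f ^^ (l' - l)) x0) = (f ^^ l') x0"
        using that by (simp flip: funpow_add[THEN fun_cong, unfolded o_apply])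
      ultimately show ?thesis using d(2)[of "l' - l"] that by (simp add: norm_minus_commute)
    qed
    \<comment> \<open>A sheet is injective over the base: two of its points over u differ by a power
      of \<open>f\<close>, which would move the centre of the ball by less than 2 r = d unless it is
      trivial.\<close>
    have uniq: "x = x'" if x: "(u, x) \<in> U l" "(u, x') \<in> U l" for u x x' l
    proof -
      have "orb x = orb x'" using x by (simp add: U_def X_def)
      then obtain i where i: "i < m" "x' = (f ^^ i) x" using orb_eqD by blast
      have "i = 0"
      proof (rule ccontr)
        assume "i \<noteq> 0"
        then have "d \<le> norm ((f ^^ i) x0 - x0)" using d i by simp
        also have "\<dots> = norm ((f ^^ l) ((f ^^ i) x0) - (f ^^ l) x0)" by (rule iso_pow[symmetric])
        also have "(f ^^ l) ((f ^^ i) x0) = (f ^^ i) ((f ^^ l) x0)"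
          by (simp add: add.commute flip: funpow_add[THEN fun_cong, unfolded o_apply])
        also have "norm ((f ^^ i) ((f ^^ l) x0) - (f ^^ l) x0) \<le>
            norm ((f ^^ i) ((f ^^ l) x0) - (f ^^ i) x) + norm (x' - (f ^^ l) x0)"
          using i by (metis add_diff_eq diff_add_cancel norm_triangle_ineq)
        also have "\<dots> < r + r"
          unfolding iso_pow using x by (intro add_strict_mono) (auto simp: U_def dist_norm norm_minus_commute)
        finally show False by (simp add: r_def)
      qed
      with i show ?thesis by simp
    qed
    have inT: "u \<in> T" if p: "(u, x) \<in> U l" and l: "l < m" for u x l
    proof -
      have "(f ^^ (m - l)) ((f ^^ l) x0) = x0"
        using l period by (simp flip: funpow_add[THEN fun_cong, unfolded o_apply])
      then have "(f ^^ (m - l)) x \<in> ball x0 r"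
        using p iso_pow[of "m - l" "(f ^^ l) x0" x] by (simp add: U_def dist_norm)
      moreover have "(f ^^ (m - l)) x \<in> S" "orb ((f ^^ (m - l)) x) = h u" "u \<in> K"
        using p S_pow orb_pow by (auto simp: U_def X_def)
      ultimately show ?thesis unfolding T_def by force
    qed
    have sheet: "\<exists>x. (u, x) \<in> U l" if u: "u \<in> T" for u l
    proof -
      from u obtain y where y: "u \<in> K" "y \<in> S" "y \<in> ball x0 r" "h u = orb y" by (auto simp: T_def)
      then have "(u, (f ^^ l) y) \<in> U l"
        using S_pow orb_pow iso_pow[of l x0 y] by (simp add: U_def X_def dist_norm)
      then show ?thesis ..
    qed
    show "\<exists>T. u0 \<in> T \<and> openin (top_of_set K) T \<and>
        (\<exists>v. \<Union>v = X \<inter> fst -` T \<and> (\<forall>u\<in>v. openin (top_of_set X) u) \<and> pairwise disjnt v \<and>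
          (\<forall>u\<in>v. \<exists>q. homeomorphism u T fst q))"
    proof (intro exI[of _ T] exI[of _ "U ` {..<m}"] conjI ballI)
      show "u0 \<in> T" using u0 x0 r by (auto simp: T_def)
      show "openin (top_of_set K) T" unfolding T_def by (rule pre)
      show "\<Union>(U ` {..<m}) = X \<inter> fst -` T"
      proof
        show "\<Union>(U ` {..<m}) \<subseteq> X \<inter> fst -` T" using inT by (force simp: U_def)
        show "X \<inter> fst -` T \<subseteq> \<Union>(U ` {..<m})"
        proof
          fix p assume p: "p \<in> X \<inter> fst -` T"
          then obtain y where y: "y \<in> S" "y \<in> ball x0 r" "h (fst p) = orb y" by (auto simp: T_def)
          then have "orb y = orb (snd p)" using p by (simp add: X_def)
          then obtain l where l: "l < m" "snd p = (f ^^ l) y" using orb_eqD by blast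
          then have "p \<in> U l" using p y iso_pow[of l x0 y] by (simp add: U_def dist_norm)
          with l show "p \<in> \<Union>(U ` {..<m})" by blast
        qed
      qed
      show "pairwise disjnt (U ` {..<m})"
      proof -
        have "disjnt (U l) (U l')" if l: "l < l'" "l' < m" for l l'
        proof (rule ccontr)
          assume "\<not> disjnt (U l) (U l')"
          then obtain p where p: "p \<in> U l" "p \<in> U l'" by (auto simp: disjnt_def)
          have "norm ((f ^^ l) x0 - (f ^^ l') x0) \<le> dist ((f ^^ l) x0) (snd p) + dist ((f ^^ l') x0) (snd p)"
            by (metis dist_norm dist_triangle2)
          also have "\<dots> < r + r" using p by (intro add_strict_mono) (auto simp: U_def)
          finally show False using far[OF l] by (simp add: r_def)
        qed
        then have "disjnt (U l) (U l')" if "l < m" "l' < m" "U l \<noteq> U l'" for l l'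
          using that by (metis disjnt_sym nat_neq_iff)
        then show ?thesis by (auto simp: pairwise_def)
      qed
    next
      fix V assume "V \<in> U ` {..<m}"
      then obtain l where l: "l < m" "V = U l" by auto
      have "U l = X \<inter> snd -` ball ((f ^^ l) x0) r" by (auto simp: U_def)
      then show "openin (top_of_set X) V"
        unfolding l by (simp add: continuous_openin_preimage_gen continuous_on_snd)
      \<comment> \<open>The inverse of the sheet. It is continuous because a small ball around
        \<open>q u1\<close> projects to a neighbourhood of \<open>h u1\<close>, and by
        \<open>uniq\<close> the representatives found there are the values of
        \<open>q\<close>.\<close>
      define q where "q u = (SOME x. (u, x) \<in> U l)" for u
      have q: "(u, q u) \<in> U l" if "u \<in> T" for u unfolding q_def by (rule someI_ex[OF sheet[OF that]])
      have "continuous_on T q"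
        unfolding continuous_on_iff
      proof (intro ballI allI impI)
        fix u1 e assume u1: "u1 \<in> T" and e: "(e::real) > 0"
        have "q u1 \<in> ball ((f ^^ l) x0) r" using q[OF u1] by (simp add: U_def)
        then obtain e1 where e1: "e1 > 0" "ball (q u1) e1 \<subseteq> ball ((f ^^ l) x0) r"
          using openE[OF open_ball] by blast
        define e' where "e' = min e e1"
        have e': "e' > 0" "e' \<le> e" "ball (q u1) e' \<subseteq> ball ((f ^^ l) x0) r"
          using e e1 by (auto simp: e'_def)
        have "u1 \<in> {u \<in> K. h u \<in> orb ` (S \<inter> ball (q u1) e')}"
          using q[OF u1] e' by (auto simp: U_def X_def intro!: image_eqI[of _ _ "q u1"])
        then obtain \<delta> where \<delta>: "\<delta> > 0" "\<And>u. u \<in> K \<Longrightarrow> dist u u1 < \<delta> \<Longrightarrow> h u \<in> orb ` (S \<inter> ball (q u1) e')"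
          using pre[of "q u1" e'] unfolding openin_euclidean_subtopology_iff by blast
        have "dist (q u) (q u1) < e" if u: "u \<in> T" "dist u u1 < \<delta>" for u
        proof -
          have uK: "u \<in> K" using u by (simp add: T_def)
          obtain y where y: "y \<in> S" "y \<in> ball (q u1) e'" "h u = orb y" using \<delta>(2)[OF uK u(2)] by blast
          then have "(u, y) \<in> U l" using uK e' by (auto simp: U_def X_def)
          then have "q u = y" using q[OF u(1)] uniq by blast
          then show ?thesis using y e' by (simp add: dist_commute)
        qed
        with \<delta>(1) show "\<exists>\<delta>>0. \<forall>u\<in>T. dist u u1 < \<delta> \<longrightarrow> dist (q u) (q u1) < e" by blast
      qed
      then have "homeomorphism (U l) T fst (\<lambda>u. (u, q u))"
        using q inT l(1) uniq
        by (intro homeomorphismI) (auto intro!: continuous_intros, blast+)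
      then show "\<exists>q. homeomorphism V T fst q" unfolding l by blast
    qed
  qed
  then obtain k where k: "continuous_on K k" "k \<in> K \<rightarrow> X" "\<And>u. u \<in> K \<Longrightarrow> fst (k u) = id u"
    by (rule covering_space_lift[OF _ convex_imp_simply_connected[OF K] convex_imp_locally_path_connected[OF K], of X fst K id])
       auto
  show ?thesis
  proof (rule that[of "\<lambda>u. snd (k u)"])
    show "continuous_on K (\<lambda>u. snd (k u))" using k(1) by (rule continuous_on_snd)
    show "(\<lambda>u. snd (k u)) ` K \<subseteq> S" using k(2) by (auto simp: X_def)
    show "orb (snd (k u)) = h u" if "u \<in> K" for u
    proof -
      have "k u \<in> X" using k(2) that by blast
      then show ?thesis using k(3)[OF that] by (simp add: X_def)
    qed
  qed
qed

text \<open>At each point the lifts differ by a power of \<open>f\<close>, so A is covered by the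
  finitely many closed sets \<open>T l\<close>. Freeness separates \<open>T 0\<close> from the
  others, and connectedness leaves only \<open>T 0\<close>.\<close>

lemma lifts_agree:
  assumes A: "connected A" and g: "continuous_on A g1" "continuous_on A g2" "g1 ` A \<subseteq> S"
    and orb: "\<And>x. x \<in> A \<Longrightarrow> orb (g1 x) = orb (g2 x)"
    and a: "a \<in> A" "g1 a = g2 a" and x: "x \<in> A"
  shows "g1 x = g2 x"
proof (rule ccontr)
  assume neq: "g1 x \<noteq> g2 x"
  define T where "T l = {x \<in> A. g2 x - (f ^^ l) (g1 x) = 0}" for l
  have cl: "closedin (top_of_set A) (T l)" for l
    unfolding T_def
    by (intro continuous_closedin_preimage_constant continuous_intros g continuous_on_compose2[OF cont_pow[of UNIV] g(1)]) auto
  have "\<exists>e1 e2. closedin (top_of_set A) e1 \<and> closedin (top_of_set A) e2 \<and> A \<subseteq> e1 \<union> e2 \<and>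
      e1 \<inter> e2 = {} \<and> e1 \<noteq> {} \<and> e2 \<noteq> {}"
  proof (intro exI conjI)
    show "closedin (top_of_set A) (T 0)" by (rule cl)
    show "closedin (top_of_set A) (\<Union>l\<in>{0<..<m}. T l)" by (intro closedin_Union) (auto intro: cl)
    show sub: "A \<subseteq> T 0 \<union> (\<Union>l\<in>{0<..<m}. T l)"
    proof
      fix y assume y: "y \<in> A"
      from orb_eqD[OF orb[OF y]] obtain l where "l < m" "g2 y = (f ^^ l) (g1 y)" by blast
      with y show "y \<in> T 0 \<union> (\<Union>l\<in>{0<..<m}. T l)" unfolding T_def by (cases "l = 0") auto
    qed
    show "T 0 \<inter> (\<Union>l\<in>{0<..<m}. T l) = {}"
      using free g(3) unfolding T_def by (auto simp: image_subset_iff)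
    show "T 0 \<noteq> {}" using a by (auto simp: T_def)
    have "x \<notin> T 0" using neq by (auto simp: T_def)
    then show "(\<Union>l\<in>{0<..<m}. T l) \<noteq> {}" using sub x by blast
  qed
  with A show False unfolding connected_closedin by blast
qed

text \<open>Lift the free homotopy to the square. Over the edge where it is constant the lift is
  constant; the two edges traced by the base point lift the same path and agree there, hence also at
  the other end. So the lift of the given loop closes up. It is the image of \<open>c\<close> under
  a power of \<open>f\<close>, which is injective, so \<open>c\<close> would close up as
  well.\<close>

theorem noncontractible:
  assumes c: "continuous_on {0..1} c" "c ` {0..1} \<subseteq> S" and per: "orb (c 1) = orb (c 0)" and open_path: "c 1 \<noteq> c 0"
  shows "noncontractible_loop Y (\<lambda>s::real. orb (c s))"
  unfolding noncontractible_loop_def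
proof (intro conjI notI)
  have "continuous_map (top_of_set {0..1}) (top_of_set S) c" using c by auto
  from continuous_map_compose[OF this continuous_map_orb]
  show "continuous_map (top_of_set {0..1}) Y (\<lambda>s. orb (c s))" by (simp add: o_def)
  show "orb (c 0) = orb (c 1)" using per by simp
  assume "\<exists>y. homotopic_with (\<lambda>h. h 0 = h 1) (top_of_set {0..1}) Y (\<lambda>s. orb (c s)) (\<lambda>_. y)"
  then obtain y h where h: "continuous_map (prod_topology (top_of_set {0..1::real}) (top_of_set {0..1})) Y h"
    "\<And>s. h (0, s) = orb (c s)" "\<And>s. h (1, s) = y" "\<And>t. t \<in> {0..1} \<Longrightarrow> h (t, 0) = h (t, 1)"
    unfolding homotopic_with_def by blast
  define I where "I = {0..1::real}"
  have I: "connected I" "0 \<in> I" "1 \<in> I" by (auto simp: I_def)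
  have "continuous_map (top_of_set (I \<times> I)) Y h" using h(1) by (simp add: I_def)
  then obtain g where g: "continuous_on (I \<times> I) g" "g ` (I \<times> I) \<subseteq> S" "\<And>u. u \<in> I \<times> I \<Longrightarrow> orb (g u) = h u"
    by (rule lift_quotient_map[rotated]) (auto simp: I_def convex_Times)
  have gt: "continuous_on I (\<lambda>s. g (t, s))" "continuous_on I (\<lambda>s. g (s, t))" if "t \<in> I" for t
    using that by (auto intro!: continuous_on_compose2[OF g(1)] continuous_intros)
  have gS: "g (t, s) \<in> S" if "t \<in> I" "s \<in> I" for t s using g(2) that by auto
  have e1: "g (1, 0) = g (1, 1)"
    by (rule lifts_agree[of I "\<lambda>s. g (1, 0)" "\<lambda>s. g (1, s)" 0 1])
       (use I gS in \<open>auto intro!: gt simp: g(3) h(3)\<close>)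
  have e0: "g (0, 0) = g (0, 1)"
    by (rule lifts_agree[of I "\<lambda>t. g (t, 0)" "\<lambda>t. g (t, 1)" 1 0])
       (use I gS e1 h(4) in \<open>auto intro!: gt simp: g(3) I_def[symmetric]\<close>)
  have "orb (c 0) = orb (g (0, 0))" using g(3) h(2) I by simp
  then obtain l where l: "g (0, 0) = (f ^^ l) (c 0)" using orb_eqD by blast
  have "(f ^^ l) (c 1) = g (0, 1)"
  proof (rule lifts_agree[of I "\<lambda>s. (f ^^ l) (c s)" "\<lambda>s. g (0, s)" 0 1])
    show "continuous_on I (\<lambda>s. (f ^^ l) (c s))"
      using c by (intro continuous_on_compose2[OF cont_pow[of UNIV]]) (auto simp: I_def)
    show "(\<lambda>s. (f ^^ l) (c s)) ` I \<subseteq> S" using c S_pow by (auto simp: I_def)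
  qed (use I l in \<open>auto intro!: gt simp: g(3) h(2) orb_pow\<close>)
  then have "(f ^^ l) (c 1) = (f ^^ l) (c 0)" using e0 l by simp
  then have "c 1 = c 0" using iso_pow[of l "c 1" "c 0"] by simp
  with open_path show False by simp
qed

end

section \<open>The gauge of a star-shaped hypersurface\<close>

text \<open>Caratheodory's form of differentiability: the remainder is absorbed by a rank-one
  correction along y - p. It allows an implicit equation to be solved for increments when the
  implicit function is only known to be continuous.\<close>

lemma has_derivative_caratheodory:
  fixes f :: "'a::real_inner \<Rightarrow> real"
  assumes "(f has_derivative (\<lambda>h. \<nu> \<bullet> h)) (at p)"
  obtains \<Psi> where "isCont \<Psi> p" "\<Psi> p = \<nu>" "\<And>y. f y - f p = \<Psi> y \<bullet> (y - p)"
proof -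
  define R where "R y = f y - f p - \<nu> \<bullet> (y - p)" for y
  define \<Psi> where "\<Psi> y = \<nu> + (R y / (norm (y - p))\<^sup>2) *\<^sub>R (y - p)" for y
  have "((\<lambda>y. R y / norm (y - p)) \<longlongrightarrow> 0) (at p)"
    using assms unfolding has_derivative_at_within R_def by (simp add: divide_inverse mult.commute)
  then have "((\<lambda>y. norm (R y / norm (y - p))) \<longlongrightarrow> 0) (at p)" by (rule tendsto_norm_zero)
  moreover have "norm (R y / norm (y - p)) = norm (\<Psi> y - \<nu>)" for y
    by (simp add: \<Psi>_def power2_eq_square)
  ultimately have "((\<lambda>y. \<Psi> y - \<nu>) \<longlongrightarrow> 0) (at p)" by (simp add: tendsto_norm_zero_iff)
  then have "(\<Psi> \<longlongrightarrow> \<nu>) (at p)" by (simp add: LIM_zero_iff)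
  then have "isCont \<Psi> p" by (simp add: isCont_def \<Psi>_def)
  moreover have "f y - f p = \<Psi> y \<bullet> (y - p)" for y
    by (cases "y = p") (auto simp: \<Psi>_def R_def inner_add_left simp flip: power2_norm_eq_inner)
  ultimately show ?thesis using that[of \<Psi>] by (simp add: \<Psi>_def)
qed

lemma caratheodory_has_derivative:
  fixes f :: "'a::real_inner \<Rightarrow> real"
  assumes c: "isCont \<Psi> p" and e: "\<forall>\<^sub>F y in at p. f y - f p = \<Psi> y \<bullet> (y - p)"
  shows "(f has_derivative (\<lambda>h. \<Psi> p \<bullet> h)) (at p)"
  unfolding has_derivative_at_within
proof
  show "bounded_linear ((\<bullet>) (\<Psi> p))" by (rule bounded_linear_inner_right)
  show "((\<lambda>y. (f y - f p - \<Psi> p \<bullet> (y - p)) /\<^sub>R norm (y - p)) \<longlongrightarrow> 0) (at p)"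
  proof (rule Lim_null_comparison)
    show "((\<lambda>y. norm (\<Psi> y - \<Psi> p)) \<longlongrightarrow> 0) (at p)"
      using c by (intro tendsto_norm_zero) (simp add: isCont_def LIM_zero_iff)
    show "\<forall>\<^sub>F y in at p. norm ((f y - f p - \<Psi> p \<bullet> (y - p)) /\<^sub>R norm (y - p)) \<le> norm (\<Psi> y - \<Psi> p)"
      using e
    proof eventually_elim
      case (elim y)
      have "\<bar>f y - f p - \<Psi> p \<bullet> (y - p)\<bar> \<le> norm (\<Psi> y - \<Psi> p) * norm (y - p)"
        unfolding elim inner_diff_left[symmetric] by (rule Cauchy_Schwarz_ineq2)
      then show ?case by (cases "y = p") (auto simp: field_simps)
    qed
  qed
qed

section \<open>Gradients and tangent vectors of level sets\<close>

definition grad :: "('a::euclidean_space \<Rightarrow> real) \<Rightarrow> 'a \<Rightarrow> 'a" where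
  "grad f x = (\<Sum>b\<in>Basis. frechet_derivative f (at x) b *\<^sub>R b)"

lemma grad_inner:
  assumes "f differentiable (at x)"
  shows "grad f x \<bullet> v = frechet_derivative f (at x) v"
proof -
  have l: "linear (frechet_derivative f (at x))" by (rule linear_frechet_derivative[OF assms])
  have "frechet_derivative f (at x) v = frechet_derivative f (at x) (\<Sum>b\<in>Basis. (v \<bullet> b) *\<^sub>R b)"
    by (simp add: euclidean_representation)
  also have "\<dots> = (\<Sum>b\<in>Basis. (v \<bullet> b) * frechet_derivative f (at x) b)"
    by (simp add: linear_sum[OF l] linear_scale[OF l])
  also have "\<dots> = grad f x \<bullet> v" unfolding grad_def inner_sum_left by (simp add: inner_commute mult.commute)
  finally show ?thesis by simp
qed

lemma has_derivative_grad:
  "f differentiable (at x) \<Longrightarrow> (f has_derivative (\<lambda>v. grad f x \<bullet> v)) (at x)"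
  using frechet_derivative_works[of f "at x"] by (simp add: grad_inner)

lemma grad_eq:
  assumes "(f has_derivative (\<lambda>v. \<nu> \<bullet> v)) (at x)"
  shows "grad f x = \<nu>"
  unfolding grad_def frechet_derivative_at[OF assms, symmetric] by (rule euclidean_representation_sum_fun[THEN fun_cong, unfolded id_def, simplified] euclidean_representation)

text \<open>Only iterated derivatives along lists of length 0 and 1 enter.\<close>

lemma smooth_on_imp_C1:
  fixes f :: "'a::euclidean_space \<Rightarrow> real"
  assumes "open U" "smooth_on U f"
  shows "x \<in> U \<Longrightarrow> f differentiable (at x)" and "continuous_on U (grad f)"
proof -
  have d: "iter_deriv f vs differentiable_on U" for vs using assms by (simp add: smooth_on_def)
  show "x \<in> U \<Longrightarrow> f differentiable (at x)"
    using d[of "[]"] assms(1) by (simp add: differentiable_on_eq_differentiable_at)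
  have "continuous_on U (\<lambda>x. frechet_derivative f (at x) v)" for v
    using differentiable_imp_continuous_on[OF d[of "[v]"]] by simp
  then show "continuous_on U (grad f)"
    unfolding grad_def by (intro continuous_intros)
qed

text \<open>A zero of f on the line y + s u is found between -2 |f y| and 2 |f y| by the intermediate
  value theorem.\<close>

lemma zero_near:
  fixes f :: "'a::euclidean_space \<Rightarrow> real"
  assumes d: "\<And>s. \<bar>s\<bar> \<le> 2 * \<bar>f y\<bar> \<Longrightarrow> f differentiable (at (y + s *\<^sub>R u)) \<and> grad f (y + s *\<^sub>R u) \<bullet> u \<ge> 1/2"
  obtains s where "\<bar>s\<bar> \<le> 2 * \<bar>f y\<bar>" "f (y + s *\<^sub>R u) = 0"
proof -
  define a where "a = 2 * \<bar>f y\<bar>"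
  define \<phi> where "\<phi> s = f (y + s *\<^sub>R u)" for s
  have D: "(\<phi> has_real_derivative grad f (y + s *\<^sub>R u) \<bullet> u) (at s)" if "\<bar>s\<bar> \<le> a" for s
  proof -
    have "(\<phi> has_derivative (\<lambda>h. grad f (y + s *\<^sub>R u) \<bullet> (h *\<^sub>R u))) (at s)"
      unfolding \<phi>_def
      by (rule has_derivative_compose[OF _ has_derivative_grad])
         (use d that in \<open>auto simp: a_def intro!: derivative_eq_intros\<close>)
    then show ?thesis by (simp add: has_field_derivative_def mult_commute_abs)
  qed
  have mono: "\<phi> s - s/2 \<le> \<phi> t - t/2" if "- a \<le> s" "s \<le> t" "t \<le> a" for s t
  proof (rule DERIV_nonneg_imp_nondecreasing[OF that(2)])
    fix x assume "s \<le> x" "x \<le> t"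
    then have x: "\<bar>x\<bar> \<le> a" using that by auto
    have "((\<lambda>s. \<phi> s - s/2) has_real_derivative grad f (y + x *\<^sub>R u) \<bullet> u - 1/2) (at x)"
      using D[OF x] by (auto intro!: derivative_eq_intros)
    then show "\<exists>y. ((\<lambda>s. \<phi> s - s/2) has_real_derivative y) (at x) \<and> y \<ge> 0" using d[of x] x by (auto simp: a_def)
  qed
  have a: "a \<ge> 0" by (simp add: a_def)
  have p0: "\<phi> 0 = f y" by (simp add: \<phi>_def)
  have "\<phi> (- a) \<le> 0" using mono[of "- a" 0] a p0 by (simp add: a_def)
  moreover have "\<phi> a \<ge> 0" using mono[of 0 a] a p0 by (simp add: a_def)
  moreover have "continuous_on {- a..a} \<phi>"
    by (rule DERIV_continuous_on[OF has_field_derivative_at_within[OF D]]) auto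
  moreover have "- a \<le> a" using a by simp
  ultimately obtain s where "s \<ge> - a" "s \<le> a" "\<phi> s = 0" using IVT'[of \<phi> "- a" 0 a] by blast
  then show ?thesis using that[of s] by (auto simp: a_def \<phi>_def)
qed

text \<open>The line p + t v leaves S only by o(t), and a shift of that order along \<open>u\<close>
  brings it back. Tangent vectors need curves differentiable at time 0 only, so the shift may be
  chosen separately for each t, without continuity and without the implicit function
  theorem.\<close>

lemma kernel_subset_tangent_space:
  fixes S :: "'a::euclidean_space set"
  assumes U: "open U" "p \<in> U" and f: "smooth_on U f" "grad f p \<noteq> 0" and SU: "S \<inter> U = {x\<in>U. f x = 0}" and p: "p \<in> S"
    and v: "grad f p \<bullet> v = 0"
  shows "v \<in> tangent_space S p"
proof -
  define \<nu> where "\<nu> = grad f p"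
  \<comment> \<open>Normalised so that f has derivative 1 along \<open>u\<close>; nearby the
    derivative stays above 1/2, as \<open>zero_near\<close> requires.\<close>
  define u where "u = \<nu> /\<^sub>R (\<nu> \<bullet> \<nu>)"
  have u: "grad f p \<bullet> u = 1" using f(2) by (simp add: u_def \<nu>_def)
  have fp: "f p = 0" using p U SU by auto
  have df: "f differentiable (at x)" if "x \<in> U" for x using smooth_on_imp_C1(1)[OF U(1) f(1) that] .
  have "isCont (\<lambda>x. grad f x \<bullet> u) p"
    using smooth_on_imp_C1(2)[OF U(1) f(1)] U by (auto intro!: continuous_intros simp: continuous_on_eq_continuous_at)
  then have "((\<lambda>x. grad f x \<bullet> u) \<longlongrightarrow> 1) (nhds p)"
    using tendsto_at_iff_tendsto_nhds[of "\<lambda>x. grad f x \<bullet> u" p] u by (simp add: isCont_def)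
  then have "\<forall>\<^sub>F x in nhds p. grad f x \<bullet> u > 1/2" by (rule order_tendstoD(1)) simp
  moreover have "\<forall>\<^sub>F x in nhds p. x \<in> U" using U by (rule eventually_nhds_in_open)
  ultimately have "\<forall>\<^sub>F x in nhds p. x \<in> U \<and> grad f x \<bullet> u > 1/2" by eventually_elim simp
  then obtain \<rho> where \<rho>: "\<rho> > 0" "\<And>x. dist x p < \<rho> \<Longrightarrow> x \<in> U \<and> grad f x \<bullet> u > 1/2"
    unfolding eventually_nhds_metric by blast
  define e where "e t = f (p + t *\<^sub>R v)" for t
  have e_small: "\<exists>d>0. \<forall>t. \<bar>t\<bar> < d \<longrightarrow> \<bar>e t\<bar> \<le> \<eta> * \<bar>t\<bar>" if "\<eta> > 0" for \<eta>
  proof -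
    have "((\<lambda>t. f (p + t *\<^sub>R v)) has_derivative (\<lambda>h. grad f (p + 0 *\<^sub>R v) \<bullet> (h *\<^sub>R v))) (at 0)"
      by (rule has_derivative_compose[OF _ has_derivative_grad]) (use df U in \<open>auto intro!: derivative_eq_intros\<close>)
    then have "(e has_derivative (\<lambda>h. 0)) (at 0)" using v by (simp add: e_def[abs_def])
    then show ?thesis using that fp unfolding has_derivative_at_alt by (auto simp: e_def)
  qed
  obtain d1 where d1: "d1 > 0" "\<And>t. \<bar>t\<bar> < d1 \<Longrightarrow> \<bar>e t\<bar> \<le> 1 * \<bar>t\<bar>" using e_small[of 1] by auto
  \<comment> \<open>As |s| is at most 2 |e t| and hence at most 2 |t|, this keeps p + t v + s u
    within \<rho> of p.\<close>
  define d where "d = min d1 (\<rho> / (1 + norm v + 2 * norm u))"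
  have den: "1 + norm v + 2 * norm u > 0" by (simp add: add_pos_nonneg)
  have d: "d > 0" using d1 \<rho> den by (simp add: d_def)
  have "\<exists>s. \<bar>s\<bar> \<le> 2 * \<bar>e t\<bar> \<and> p + t *\<^sub>R v + s *\<^sub>R u \<in> S" if t: "\<bar>t\<bar> < d" for t
  proof -
    have et: "\<bar>e t\<bar> \<le> \<bar>t\<bar>" using d1(2)[of t] t by (simp add: d_def)
    have near: "dist (p + t *\<^sub>R v + s *\<^sub>R u) p < \<rho>" if "\<bar>s\<bar> \<le> 2 * \<bar>e t\<bar>" for s
    proof -
      have "dist (p + t *\<^sub>R v + s *\<^sub>R u) p \<le> \<bar>t\<bar> * norm v + \<bar>s\<bar> * norm u"
        using norm_triangle_ineq[of "t *\<^sub>R v" "s *\<^sub>R u"] by (simp add: dist_norm)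
      also have "\<dots> \<le> \<bar>t\<bar> * norm v + (2 * \<bar>t\<bar>) * norm u"
        using that et by (intro add_left_mono mult_right_mono) auto
      also have "\<dots> \<le> \<bar>t\<bar> * (1 + norm v + 2 * norm u)" by (simp add: algebra_simps)
      also have "\<dots> < \<rho>" using t den unfolding d_def by (simp add: pos_less_divide_eq)
      finally show ?thesis .
    qed
    obtain s where s: "\<bar>s\<bar> \<le> 2 * \<bar>e t\<bar>" "f (p + t *\<^sub>R v + s *\<^sub>R u) = 0"
      using zero_near[of f "p + t *\<^sub>R v" u] near \<rho>(2) df unfolding e_def by (metis less_imp_le)
    then show ?thesis using near[OF s(1)] \<rho>(2) SU by blast
  qed
  then obtain s where s: "\<And>t. \<bar>t\<bar> < d \<Longrightarrow> \<bar>s t\<bar> \<le> 2 * \<bar>e t\<bar> \<and> p + t *\<^sub>R v + s t *\<^sub>R u \<in> S" by metis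
  \<comment> \<open>The curve must lie in S at all times, so it rests at p once t is no longer
    small.\<close>
  define c where "c t = (if \<bar>t\<bar> < d then p + t *\<^sub>R v + s t *\<^sub>R u else p)" for t
  have e0: "e 0 = 0" using fp by (simp add: e_def)
  have c0: "c 0 = p" using s[of 0] d e0 by (simp add: c_def)
  have "(c has_vector_derivative v) (at 0)"
    unfolding has_vector_derivative_def has_derivative_at_alt
  proof (intro conjI allI impI)
    show "bounded_linear (\<lambda>x. x *\<^sub>R v)" by (rule bounded_linear_scaleR_left)
    fix \<eta> :: real assume \<eta>: "\<eta> > 0"
    then obtain d2 where d2: "d2 > 0" "\<And>t. \<bar>t\<bar> < d2 \<Longrightarrow> \<bar>e t\<bar> \<le> \<eta> / (2 * (norm u + 1)) * \<bar>t\<bar>"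
      using e_small[of "\<eta> / (2 * (norm u + 1))"] by (auto simp: add_nonneg_pos)
    show "\<exists>d>0. \<forall>y. norm (y - 0) < d \<longrightarrow> norm (c y - c 0 - (y - 0) *\<^sub>R v) \<le> \<eta> * norm (y - 0)"
    proof (intro exI[of _ "min d d2"] conjI allI impI)
      show "min d d2 > 0" using d d2 by simp
      fix y :: real assume "norm (y - 0) < min d d2"
      then have y: "\<bar>y\<bar> < d" "\<bar>y\<bar> < d2" by auto
      have "norm (c y - c 0 - (y - 0) *\<^sub>R v) = \<bar>s y\<bar> * norm u" using y by (simp add: c0) (simp add: c_def)
      also have "\<dots> \<le> 2 * (\<eta> / (2 * (norm u + 1)) * \<bar>y\<bar>) * (norm u + 1)"
        using s[OF y(1)] d2(2)[OF y(2)] by (intro mult_mono) auto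
      also have "\<dots> = \<eta> * \<bar>y\<bar>"
      proof -
        have "norm u + 1 > 0" using norm_ge_zero[of u] by linarith
        then show ?thesis by (simp add: divide_simps)
      qed
      finally show "norm (c y - c 0 - (y - 0) *\<^sub>R v) \<le> \<eta> * norm (y - 0)" by simp
    qed
  qed
  moreover have "c t \<in> S" for t using s p by (simp add: c_def)
  ultimately show ?thesis using c0 unfolding tangent_space_def by blast
qed


section \<open>Radial function and squared gauge\<close>

locale star_hypersurface =
  fixes S :: "'a::euclidean_space set"
  assumes star: "star_shaped_hypersurface S"
begin

lemma constant_tangent: "p \<in> S \<Longrightarrow> 0 \<in> tangent_space S p"
  unfolding tangent_space_def by (auto intro!: exI[of _ "\<lambda>_. p"])

lemma transversal: "p \<in> S \<Longrightarrow> (1/2) *\<^sub>R p \<notin> tangent_space S p"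
  using star by (simp add: star_shaped_hypersurface_def)

text \<open>At the origin the radial vector is zero, which is tangent through the constant curve;
  transversality thus excludes the origin.\<close>

lemma zero_notin: "0 \<notin> S"
  using transversal[of 0] constant_tangent[of 0] by auto

text \<open>Two points of S on one ray would put the whole segment between them into S, making the
  radial direction tangent at its midpoint.\<close>

lemma radial_unique:
  assumes p: "p \<in> S" "t *\<^sub>R p \<in> S"
  shows "t \<le> 1"
proof (rule ccontr)
  assume "\<not> t \<le> 1"
  then have t: "t > 1" by simp
  obtain D where D: "compact D" "0 \<in> D" "\<And>x. x \<in> D \<Longrightarrow> closed_segment 0 x \<subseteq> D" "S = frontier D"
    using star unfolding star_shaped_hypersurface_def by blast
  have clD: "closed D" using D(1) by (rule compact_imp_closed)
  then have SD: "S = D - interior D" using D(4) by (simp add: frontier_def)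
  have scale: "c *\<^sub>R x \<in> D" if "x \<in> D" "0 \<le> c" "c \<le> 1" for c x
    using D(3)[OF that(1)] that by (auto simp: closed_segment_def)
  have sp: "s *\<^sub>R p \<in> S" if s: "1 \<le> s" "s \<le> t" for s
  proof -
    have "s *\<^sub>R p = (s / t) *\<^sub>R (t *\<^sub>R p)" using t by simp
    also have "\<dots> \<in> D" by (rule scale) (use p(2) SD s t in auto)
    finally have 1: "s *\<^sub>R p \<in> D" .
    \<comment> \<open>Shrinking by 1/s maps D into itself, so p would be interior too.\<close>
    have "s *\<^sub>R p \<notin> interior D"
    proof
      assume i: "s *\<^sub>R p \<in> interior D"
      have "(1 / s) *\<^sub>R (s *\<^sub>R p) \<in> (\<lambda>x. (1 / s) *\<^sub>R x) ` interior D" using i by (rule imageI)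
      then have "p \<in> (\<lambda>x. (1 / s) *\<^sub>R x) ` interior D" using s by simp
      moreover have "open ((\<lambda>x. (1 / s) *\<^sub>R x) ` interior D)" using s by (intro open_scaling) auto
      moreover have "(\<lambda>x. (1 / s) *\<^sub>R x) ` interior D \<subseteq> D"
        using s scale interior_subset by fastforce
      ultimately have "p \<in> interior D" by (meson interiorI)
      with p(1) SD show False by simp
    qed
    with 1 SD show ?thesis by simp
  qed
  \<comment> \<open>The midpoint factor; \<open>\<delta>\<close> is chosen so that s0 (1 - \<delta>)
    and s0 (1 + \<delta>) are the end values 1 and t. The curve below has half its position as
    velocity, the Liouville vector.\<close>
  define s0 where "s0 = (1 + t) / 2"
  define \<delta> where "\<delta> = (t - 1) / (t + 1)"
  have s0: "1 < s0" "s0 < t" using t by (auto simp: s0_def)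
  have \<delta>: "\<delta> > 0" "s0 * (1 + \<delta>) = t" "s0 * (1 - \<delta>) = 1" using t by (auto simp: \<delta>_def s0_def field_simps)
  define c where "c \<tau> = (if \<bar>\<tau>\<bar> < \<delta> then (s0 * (1 + \<tau> / 2)) *\<^sub>R p else s0 *\<^sub>R p)" for \<tau>
  have "c \<tau> \<in> S" for \<tau>
  proof (cases "\<bar>\<tau>\<bar> < \<delta>")
    case True
    have "s0 * (1 - \<delta>) \<le> s0 * (1 + \<tau> / 2)" "s0 * (1 + \<tau> / 2) \<le> s0 * (1 + \<delta>)"
      using True s0 by (auto intro!: mult_left_mono)
    then show ?thesis using True sp unfolding \<delta> by (simp add: c_def)
  qed (use s0 sp in \<open>auto simp: c_def\<close>)
  moreover have "c 0 = s0 *\<^sub>R p" by (simp add: c_def)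
  moreover have "(c has_vector_derivative (1/2) *\<^sub>R (s0 *\<^sub>R p)) (at 0)"
  proof (rule has_vector_derivative_transform_within_open)
    show "((\<lambda>\<tau>. (s0 * (1 + \<tau> / 2)) *\<^sub>R p) has_vector_derivative (1/2) *\<^sub>R (s0 *\<^sub>R p)) (at 0)"
      by (auto intro!: derivative_eq_intros simp: has_vector_derivative_def)
    show "open {-\<delta><..<\<delta>}" "0 \<in> {-\<delta><..<\<delta>}" using \<delta> by auto
  qed (auto simp: c_def)
  ultimately have "(1/2) *\<^sub>R (s0 *\<^sub>R p) \<in> tangent_space S (s0 *\<^sub>R p)"
    unfolding tangent_space_def by blast
  then show False using transversal[of "s0 *\<^sub>R p"] sp[of s0] s0 by simp
qed

lemma ray_meets:
  assumes "z \<noteq> 0"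
  obtains r where "r > 0" "r *\<^sub>R z \<in> S"
proof -
  obtain D where D: "compact D" "0 \<in> D" "S = frontier D"
    using star unfolding star_shaped_hypersurface_def by blast
  have "closed D" using D(1) by (rule compact_imp_closed)
  then have "0 \<in> interior D" using D zero_notin by (simp add: frontier_def)
  from ray_to_frontier[OF compact_imp_bounded[OF D(1)] this assms] D(3) that
  show ?thesis by (metis add_0)
qed

lemma compact_S: "compact S"
  using star unfolding star_shaped_hypersurface_def using compact_frontier by blast

text \<open>The reciprocal of the Minkowski gauge: the factor that carries z onto S.\<close>

definition rad :: "'a \<Rightarrow> real" where
  "rad z = (if z = 0 then 0 else (THE r. r > 0 \<and> r *\<^sub>R z \<in> S))"

lemma rad_unique:
  assumes "r > 0" "r *\<^sub>R z \<in> S" "s > 0" "s *\<^sub>R z \<in> S"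
  shows "r = s"
proof -
  have "a \<le> b" if "a > 0" "a *\<^sub>R z \<in> S" "b > 0" "b *\<^sub>R z \<in> S" for a b
  proof -
    have "(a / b) *\<^sub>R (b *\<^sub>R z) \<in> S" using that by simp
    from radial_unique[OF that(4) this] that show ?thesis by (simp add: divide_le_eq)
  qed
  with assms show ?thesis by (meson order_antisym)
qed

lemma rad_eqI: "r > 0 \<Longrightarrow> r *\<^sub>R z \<in> S \<Longrightarrow> rad z = r"
  using zero_notin rad_unique unfolding rad_def by (auto intro!: the_equality)

lemma rad: "z \<noteq> 0 \<Longrightarrow> rad z > 0" "z \<noteq> 0 \<Longrightarrow> rad z *\<^sub>R z \<in> S"
  by (metis ray_meets rad_eqI)+

lemma rad_scale:
  assumes "t > 0"
  shows "rad (t *\<^sub>R z) = rad z / t"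
proof (cases "z = 0")
  case False
  then show ?thesis using assms rad[OF False] by (intro rad_eqI) auto
qed (simp add: rad_def)

text \<open>Radial projection of the compact S onto the unit sphere is a continuous bijection, hence
  a homeomorphism, and \<open>rad\<close> is read off from its inverse.\<close>

lemma cont_rad: "continuous_on (- {0}) rad"
proof -
  have "\<exists>q. homeomorphism S (sphere 0 1) (\<lambda>x. x /\<^sub>R norm x) q"
  proof (rule homeomorphism_compact[OF compact_S])
    show "continuous_on S (\<lambda>x. x /\<^sub>R norm x)" using zero_notin by (auto intro!: continuous_intros)
    show "(\<lambda>x. x /\<^sub>R norm x) ` S = sphere 0 1"
    proof
      show "(\<lambda>x. x /\<^sub>R norm x) ` S \<subseteq> sphere 0 1"
      proof clarsimp
        fix x assume "x \<in> S"
        then have "x \<noteq> 0" using zero_notin by metis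
        then show "inverse (norm x) * norm x = 1" by simp
      qed
      show "sphere 0 1 \<subseteq> (\<lambda>x. x /\<^sub>R norm x) ` S"
      proof
        fix u :: 'a assume u: "u \<in> sphere 0 1"
        then have "u \<noteq> 0" by auto
        from rad[OF this] u show "u \<in> (\<lambda>x. x /\<^sub>R norm x) ` S"
          by (intro image_eqI[of _ _ "rad u *\<^sub>R u"]) auto
      qed
    qed
    show "inj_on (\<lambda>x. x /\<^sub>R norm x) S"
    proof (rule inj_onI)
      fix x y assume xy: "x \<in> S" "y \<in> S" "x /\<^sub>R norm x = y /\<^sub>R norm y"
      have nz: "norm x > 0" "norm y > 0" using xy zero_notin by auto
      have "norm x *\<^sub>R (x /\<^sub>R norm x) = x" "norm y *\<^sub>R (y /\<^sub>R norm y) = y" using nz by simp_all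
      then have e: "norm x *\<^sub>R (x /\<^sub>R norm x) = x" "norm y *\<^sub>R (x /\<^sub>R norm x) = y" unfolding xy(3) by metis+
      then have "norm x = norm y" using rad_unique[of "norm x" "x /\<^sub>R norm x" "norm y"] xy nz by metis
      then show "x = y" using e by metis
    qed
  qed
  then obtain q where q: "homeomorphism S (sphere 0 1) (\<lambda>x. x /\<^sub>R norm x) q" by blast
  have "rad z = norm (q (z /\<^sub>R norm z)) / norm z" if z: "z \<noteq> 0" for z
  proof -
    define x where "x = q (z /\<^sub>R norm z)"
    have u: "z /\<^sub>R norm z \<in> sphere 0 1" using z by simp
    then have x: "x \<in> S" "x /\<^sub>R norm x = z /\<^sub>R norm z"
      using q unfolding homeomorphism_def x_def by auto
    have nx: "norm x > 0" using x(1) zero_notin by auto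
    have "(norm x / norm z) *\<^sub>R z = norm x *\<^sub>R (z /\<^sub>R norm z)" by (simp add: divide_inverse)
    also have "\<dots> = x" unfolding x(2)[symmetric] using nx by simp
    finally show ?thesis using x(1) nx z unfolding x_def[symmetric] by (intro rad_eqI) auto
  qed
  moreover have "continuous_on (- {0}) (\<lambda>z. norm (q (z /\<^sub>R norm z)) / norm z)"
  proof -
    have "continuous_on (sphere 0 1) q" using q by (simp add: homeomorphism_def)
    then have "continuous_on (- {0}) (\<lambda>z. q (z /\<^sub>R norm z))"
      by (rule continuous_on_compose2) (auto intro!: continuous_intros, metis left_inverse norm_eq_zero)
    then show ?thesis by (auto intro!: continuous_intros)
  qed
  ultimately show ?thesis using continuous_on_cong[of "- {0}" "- {0}" rad] by force
qed

text \<open>At the origin \<open>rad\<close> is 0, and the convention \<open>inverse 0 = 0\<close>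
  gives the right value there.\<close>

definition sq_gauge :: "'a \<Rightarrow> real" where
  "sq_gauge z = inverse ((rad z)\<^sup>2)"

text \<open>Implicit differentiation of f (rad y y) = 0. Transversality makes the denominator
  nonzero, because a vector in the kernel of the gradient is tangent; continuity of
  \<open>rad\<close> suffices thanks to the Caratheodory form.\<close>

lemma gauge_derivative:
  assumes U: "open U" and f: "smooth_on U f" and nz: "\<And>x. x \<in> U \<Longrightarrow> grad f x \<noteq> 0" and SU: "S \<inter> U = {x\<in>U. f x = 0}"
    and w: "w \<noteq> 0" "rad w *\<^sub>R w \<in> U"
  defines "\<nu> \<equiv> grad f (rad w *\<^sub>R w)"
  shows "\<nu> \<bullet> w \<noteq> 0"
    and "(sq_gauge has_derivative (\<lambda>h. ((2 / ((rad w)\<^sup>2 * (\<nu> \<bullet> w))) *\<^sub>R \<nu>) \<bullet> h)) (at w)"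
proof -
  define p where "p = rad w *\<^sub>R w"
  have p: "p \<in> S" "p \<in> U" using rad w by (auto simp: p_def)
  have rw: "rad w > 0" using rad w by simp
  show nw: "\<nu> \<bullet> w \<noteq> 0"
  proof
    assume "\<nu> \<bullet> w = 0"
    then have "grad f p \<bullet> ((1/2) *\<^sub>R p) = 0" by (simp add: \<nu>_def p_def)
    from kernel_subset_tangent_space[OF U p(2) f nz[OF p(2)] SU p(1) this] transversal[OF p(1)]
    show False by simp
  qed
  obtain \<Psi> where \<Psi>: "isCont \<Psi> p" "\<Psi> p = \<nu>" "\<And>y. f y - f p = \<Psi> y \<bullet> (y - p)"
    using has_derivative_caratheodory[OF has_derivative_grad[OF smooth_on_imp_C1(1)[OF U f p(2)]]]
    unfolding \<nu>_def p_def[symmetric] by blast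
  have rc: "isCont rad w" using cont_rad w(1) by (simp add: continuous_on_eq_continuous_at open_Compl)
  define \<Phi> where "\<Phi> y = \<Psi> (rad y *\<^sub>R y)" for y
  have P: "isCont (\<lambda>y. rad y *\<^sub>R y) w" using rc by (intro continuous_intros)
  have \<Phi>c: "isCont \<Phi> w" unfolding \<Phi>_def[abs_def] using isCont_o2[OF P, of \<Psi>] \<Psi>(1) by (simp add: p_def)
  have \<Phi>w: "\<Phi> w = \<nu>" using \<Psi>(2) by (simp add: \<Phi>_def p_def)
  \<comment> \<open>Obtained by splitting rad y y - p into (rad y - rad w) y + rad w (y - w) and
    solving for rad y - rad w.\<close>
  define \<xi> where "\<xi> y = (- rad w / (\<Phi> y \<bullet> y)) *\<^sub>R \<Phi> y" for y
  have "isCont \<xi> w" unfolding \<xi>_def[abs_def] using \<Phi>c nw \<Phi>w by (intro continuous_intros) auto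
  moreover have "\<forall>\<^sub>F y in at w. rad y - rad w = \<xi> y \<bullet> (y - w)"
  proof -
    have "((\<lambda>y. \<Phi> y \<bullet> y) \<longlongrightarrow> \<nu> \<bullet> w) (at w)"
      using \<Phi>c unfolding isCont_def \<Phi>w by (intro tendsto_intros)
    then have 1: "\<forall>\<^sub>F y in at w. \<Phi> y \<bullet> y \<noteq> 0" using nw by (rule tendsto_imp_eventually_ne)
    have 2: "\<forall>\<^sub>F y in at w. y \<noteq> 0" by (rule eventually_neq_at_within)
    have "((\<lambda>y. rad y *\<^sub>R y) \<longlongrightarrow> p) (at w)" using P unfolding isCont_def p_def .
    then have 3: "\<forall>\<^sub>F y in at w. rad y *\<^sub>R y \<in> U" using U p(2) by (rule topological_tendstoD)
    from 1 2 3 show ?thesis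
    proof eventually_elim
      case (elim y)
      have "rad y *\<^sub>R y \<in> S \<inter> U" using rad elim by simp
      then have "f (rad y *\<^sub>R y) = 0" using SU by blast
      moreover have "f p = 0" using SU p by blast
      ultimately have "0 = \<Phi> y \<bullet> (rad y *\<^sub>R y - p)" using \<Psi>(3)[of "rad y *\<^sub>R y"] by (simp add: \<Phi>_def)
      also have "rad y *\<^sub>R y - p = (rad y - rad w) *\<^sub>R y + rad w *\<^sub>R (y - w)" by (simp add: p_def algebra_simps)
      finally have "(rad y - rad w) * (\<Phi> y \<bullet> y) = - rad w * (\<Phi> y \<bullet> (y - w))" by (simp add: inner_add_right)
      then show ?case using elim by (simp add: \<xi>_def field_simps)
    qed
  qed
  ultimately have rd: "(rad has_derivative (\<lambda>h. \<xi> w \<bullet> h)) (at w)" by (rule caratheodory_has_derivative)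
  have "((\<lambda>y. (rad y)\<^sup>2) has_derivative (\<lambda>h. 2 * rad w * (\<xi> w \<bullet> h))) (at w)"
    using has_derivative_power[OF rd, of 2] by (simp add: mult_ac)
  from Deriv.has_derivative_inverse[OF _ this]
  have "(sq_gauge has_derivative (\<lambda>h. - (inverse ((rad w)\<^sup>2) * (2 * rad w * (\<xi> w \<bullet> h)) * inverse ((rad w)\<^sup>2)))) (at w)"
    unfolding sq_gauge_def[abs_def] using rw by simp
  moreover have "- (inverse ((rad w)\<^sup>2) * (2 * rad w * (\<xi> w \<bullet> h)) * inverse ((rad w)\<^sup>2))
      = ((2 / ((rad w)\<^sup>2 * (\<nu> \<bullet> w))) *\<^sub>R \<nu>) \<bullet> h" for h
    using rw nw unfolding \<xi>_def \<Phi>w by (simp add: field_simps power2_eq_square)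
  ultimately show "(sq_gauge has_derivative (\<lambda>h. ((2 / ((rad w)\<^sup>2 * (\<nu> \<bullet> w))) *\<^sub>R \<nu>) \<bullet> h)) (at w)"
    by simp
qed

lemma gauge_pos: "z \<noteq> 0 \<Longrightarrow> sq_gauge z > 0"
  using rad(1)[of z] by (simp add: sq_gauge_def)

lemma gauge_0 [simp]: "sq_gauge 0 = 0"
  by (simp add: sq_gauge_def rad_def)

lemma gauge_eq_1: "sq_gauge z = 1 \<longleftrightarrow> z \<in> S"
proof (cases "z = 0")
  case False
  have "sq_gauge z = 1 \<longleftrightarrow> (rad z)\<^sup>2 = 1" by (simp add: sq_gauge_def)
  also have "\<dots> \<longleftrightarrow> rad z = 1" using rad(1)[OF False] by (simp add: power2_eq_1_iff)
  also have "\<dots> \<longleftrightarrow> z \<in> S" using rad(2)[OF False] rad_eqI[of 1 z] by auto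
  finally show ?thesis .
qed (use zero_notin in auto)

lemma local_defining:
  assumes "z \<noteq> 0"
  obtains U f where "open U" "rad z *\<^sub>R z \<in> U" "smooth_on U f" "\<And>x. x \<in> U \<Longrightarrow> grad f x \<noteq> 0"
    "S \<inter> U = {x\<in>U. f x = 0}"
proof -
  have "smooth_hypersurface S" using star by (simp add: star_shaped_hypersurface_def)
  from this[unfolded smooth_hypersurface_def, rule_format, OF rad(2)[OF assms]]
  obtain U f where U: "open U" "rad z *\<^sub>R z \<in> U" "smooth_on U f"
      "\<forall>x\<in>U. frechet_derivative f (at x) \<noteq> (\<lambda>_. 0)" "S \<inter> U = {x\<in>U. f x = 0}"
    by (elim exE conjE) (rule that)
  have "grad f x \<noteq> 0" if x: "x \<in> U" for x
  proof
    assume "grad f x = 0"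
    then have "frechet_derivative f (at x) v = 0" for v
      using grad_inner[OF smooth_on_imp_C1(1)[OF U(1,3) x], of v] by simp
    with bspec[OF U(4) x] show False by auto
  qed
  then show ?thesis using that[OF U(1-3) _ U(5)] by simp
qed

lemma gauge_has_grad_off_0: "z \<noteq> 0 \<Longrightarrow> (sq_gauge has_derivative (\<lambda>h. grad sq_gauge z \<bullet> h)) (at z)"
proof -
  assume z: "z \<noteq> 0"
  obtain U f where U: "open U" "rad z *\<^sub>R z \<in> U" "smooth_on U f" "\<And>x. x \<in> U \<Longrightarrow> grad f x \<noteq> 0"
    "S \<inter> U = {x\<in>U. f x = 0}" using local_defining[OF z] by blast
  from gauge_derivative(2)[OF U(1,3,4,5) z U(2)] show ?thesis
    by (intro has_derivative_grad) (auto simp: differentiable_def)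
qed

text \<open>One defining function f serves for all rays near z, so the formula of
  \<open>gauge_derivative\<close> holds on a whole neighbourhood, where it is visibly
  continuous.\<close>

lemma cont_grad_gauge: "continuous_on (- {0}) (grad sq_gauge)"
proof (rule continuous_at_imp_continuous_on, rule ballI)
  fix z :: 'a assume "z \<in> - {0}"
  then have z: "z \<noteq> 0" by simp
  obtain U f where U: "open U" "rad z *\<^sub>R z \<in> U" "smooth_on U f" "\<And>x. x \<in> U \<Longrightarrow> grad f x \<noteq> 0"
    "S \<inter> U = {x\<in>U. f x = 0}" using local_defining[OF z] by blast
  define W where "W = {w \<in> - {0}. rad w *\<^sub>R w \<in> U}"
  have rc: "continuous_on (- {0}) (\<lambda>w. rad w *\<^sub>R w)" using cont_rad by (intro continuous_intros)
  have W: "open W" "z \<in> W"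
    using continuous_open_preimage[OF rc _ U(1)] z U(2) by (auto simp: W_def Int_def vimage_def open_Compl)
  define \<nu> where "\<nu> w = grad f (rad w *\<^sub>R w)" for w
  have "continuous_on W \<nu>"
    unfolding \<nu>_def by (rule continuous_on_compose2[OF smooth_on_imp_C1(2)[OF U(1,3)] continuous_on_subset[OF rc]]) (auto simp: W_def)
  moreover have "continuous_on W rad" by (rule continuous_on_subset[OF cont_rad]) (auto simp: W_def)
  moreover have "\<nu> w \<bullet> w \<noteq> 0" "rad w \<noteq> 0" if "w \<in> W" for w
    using gauge_derivative(1)[OF U(1,3,4,5), of w] rad(1)[of w] that by (auto simp: W_def \<nu>_def)
  ultimately have "continuous_on W (\<lambda>w. (2 / ((rad w)\<^sup>2 * (\<nu> w \<bullet> w))) *\<^sub>R \<nu> w)"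
    by (intro continuous_intros) auto
  moreover have "grad sq_gauge w = (2 / ((rad w)\<^sup>2 * (\<nu> w \<bullet> w))) *\<^sub>R \<nu> w" if "w \<in> W" for w
    unfolding \<nu>_def by (rule grad_eq[OF gauge_derivative(2)[OF U(1,3,4,5)]]) (use that in \<open>auto simp: W_def\<close>)
  ultimately have "continuous_on W (grad sq_gauge)" using continuous_on_cong[of W W "grad sq_gauge"] by force
  with W show "isCont (grad sq_gauge) z" by (simp add: continuous_on_eq_continuous_at)
qed

text \<open>S keeps a distance B from the origin, so the squared gauge is at most |z|^2 /
  B^2.\<close>

lemma gauge_has_derivative_0: "(sq_gauge has_derivative (\<lambda>h. 0)) (at 0)"
proof -
  obtain B where B: "B > 0" "\<And>x. x \<in> S \<Longrightarrow> B \<le> norm x"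
  proof -
    have "0 \<in> - S" "open (- S)" using zero_notin compact_S by (auto intro: compact_imp_closed)
    then obtain B where "B > 0" "ball 0 B \<subseteq> - S" using openE by blast
    then show ?thesis using that[of B] by (force simp: not_less[symmetric])
  qed
  have bd: "sq_gauge z \<le> (norm z)\<^sup>2 / B\<^sup>2" for z
  proof (cases "z = 0")
    case False
    have "B \<le> rad z * norm z" using B(2)[OF rad(2)[OF False]] rad(1)[OF False] by simp
    then have "B\<^sup>2 \<le> (rad z * norm z)\<^sup>2" using B by (intro power_mono) auto
    then show ?thesis using rad(1)[OF False] B by (simp add: sq_gauge_def field_simps power_mult_distrib)
  qed simp
  show ?thesis
    unfolding has_derivative_at_alt
  proof (intro conjI allI impI bounded_linear_zero)
    fix e :: real assume e: "e > 0"
    show "\<exists>d>0. \<forall>y. norm (y - 0) < d \<longrightarrow> norm (sq_gauge y - sq_gauge 0 - 0) \<le> e * norm (y - 0)"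
    proof (intro exI[of _ "e * B\<^sup>2"] conjI allI impI)
      show "e * B\<^sup>2 > 0" using e B by simp
      fix y :: 'a assume y: "norm (y - 0) < e * B\<^sup>2"
      have "sq_gauge y \<ge> 0" using gauge_pos[of y] by (cases "y = 0") auto
      moreover have "sq_gauge y * B\<^sup>2 \<le> norm y * norm y"
        using bd[of y] B(1) by (simp add: pos_le_divide_eq) (simp add: power2_eq_square)
      moreover have "norm y * norm y \<le> (e * B\<^sup>2) * norm y" using y by (intro mult_right_mono) auto
      ultimately have "sq_gauge y \<ge> 0" "sq_gauge y * B\<^sup>2 \<le> (e * norm y) * B\<^sup>2"
        by (simp_all add: mult_ac)
      then show "norm (sq_gauge y - sq_gauge 0 - 0) \<le> e * norm (y - 0)"
        using mult_right_le_imp_le[of "sq_gauge y" "B\<^sup>2" "e * norm y"] B by simp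
    qed
  qed
qed

lemma gauge_has_grad: "(sq_gauge has_derivative (\<lambda>h. grad sq_gauge z \<bullet> h)) (at z)"
proof (cases "z = 0")
  case True
  have "(sq_gauge has_derivative (\<lambda>h. 0 \<bullet> h)) (at 0)" using gauge_has_derivative_0 by simp
  with grad_eq[OF this] True show ?thesis by simp
qed (rule gauge_has_grad_off_0)

lemma gauge_hom:
  assumes sym: "\<And>x. x \<in> S \<Longrightarrow> - x \<in> S"
  shows "sq_gauge (t *\<^sub>R z) = t\<^sup>2 * sq_gauge z"
proof -
  have p: "sq_gauge (t *\<^sub>R z) = t\<^sup>2 * sq_gauge z" if "t > 0" for t z
    using that by (simp add: sq_gauge_def rad_scale power_divide field_simps)
  have m: "sq_gauge (- z) = sq_gauge z" for z
  proof (cases "z = 0")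
    case False
    have "rad (- z) = rad z" using rad[OF False] sym[of "rad z *\<^sub>R z"] by (intro rad_eqI) auto
    then show ?thesis by (simp add: sq_gauge_def)
  qed simp
  consider "t > 0" | "t = 0" | "t < 0" by linarith
  then show ?thesis
  proof cases
    case 3
    then show ?thesis using p[of "- t" z] m[of "t *\<^sub>R z"] by simp
  qed (auto simp: p)
qed

end

section \<open>Reeb orbits\<close>

definition toC :: "(real^'n) \<times> (real^'n) \<Rightarrow> complex^'n" where
  "toC a = (\<chi> j. Complex (fst a $ j) (snd a $ j))"

definition ofC :: "complex^'n \<Rightarrow> (real^'n) \<times> (real^'n)" where
  "ofC z = (\<chi> j. Re (z $ j), \<chi> j. Im (z $ j))"

lemma toC_ofC [simp]: "toC (ofC z) = z"
  by (simp add: toC_def ofC_def vec_eq_iff)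

lemma ofC_toC [simp]: "ofC (toC a) = a"
  by (simp add: toC_def ofC_def vec_eq_iff prod_eq_iff)

lemma bounded_linear_toC: "bounded_linear (toC :: _ \<Rightarrow> complex^'n::finite)"
  by (intro linear_conv_bounded_linear[THEN iffD1] linearI) (auto simp: toC_def vec_eq_iff complex_eq_iff)

lemma bounded_linear_ofC: "bounded_linear (ofC :: complex^'n::finite \<Rightarrow> _)"
  by (intro linear_conv_bounded_linear[THEN iffD1] linearI) (auto simp: ofC_def vec_eq_iff prod_eq_iff)

lemma inner_toC: "z \<bullet> toC a = ofC z \<bullet> a"
  by (simp add: toC_def ofC_def inner_vec_def inner_prod_def inner_complex_def sum.distrib)

context star_hypersurface
begin

lemma tangent_orthogonal:
  assumes "w \<in> tangent_space S p"
  shows "grad sq_gauge p \<bullet> w = 0"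
proof -
  obtain c where c: "\<And>t. c t \<in> S" "c 0 = p" "(c has_vector_derivative w) (at 0)"
    using assms unfolding tangent_space_def by blast
  have "((\<lambda>t. sq_gauge (c t)) has_derivative (\<lambda>h. grad sq_gauge (c 0) \<bullet> (h *\<^sub>R w))) (at 0)"
    using c(3) unfolding has_vector_derivative_def by (rule has_derivative_compose[OF _ gauge_has_grad])
  moreover have "sq_gauge (c t) = 1" for t using c(1) gauge_eq_1 by simp
  ultimately have "((\<lambda>t::real. 1::real) has_derivative (\<lambda>h. grad sq_gauge p \<bullet> (h *\<^sub>R w))) (at 0)"
    using c(2) by simp
  from has_derivative_unique[OF this has_derivative_const]
  have "grad sq_gauge p \<bullet> (1 *\<^sub>R w) = 0" by meson
  then show ?thesis by simp
qed

end

text \<open>Both forms see v only through i v. If i v is the gradient of the squared gauge, the Reeb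
  conditions become orthogonality of the gradient to tangent vectors and Euler's identity.\<close>

lemma dliouville_inner: "dliouville v w = - ((\<chi> j. \<i> * v $ j) \<bullet> w)"
  by (simp add: dliouville_def inner_vec_def inner_complex_def flip: sum_negf)

lemma liouville_inner: "liouville_form p v = (1/2) * (p \<bullet> (\<chi> j. \<i> * v $ j))"
  by (simp add: liouville_form_def inner_vec_def inner_complex_def)

theorem antiperiodic_reeb_orbit:
  fixes S :: "(complex^'n::finite) set"
  assumes star: "star_shaped_hypersurface S" and sym: "\<And>x. x \<in> S \<Longrightarrow> - x \<in> S"
  obtains \<gamma> T where "T > 0" "reeb_trajectory S \<gamma>" "\<gamma> T = - \<gamma> 0"
proof -
  interpret star_hypersurface S by standard (rule star)
  define H where "H a = sq_gauge (toC a)" for a :: "(real^'n) \<times> (real^'n)"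
  define g where "g a = ofC (grad sq_gauge (toC a))" for a :: "(real^'n) \<times> (real^'n)"
  interpret toC: bounded_linear "toC :: _ \<Rightarrow> complex^'n" by (rule bounded_linear_toC)
  have toC_0: "toC a = (0 :: complex^'n) \<longleftrightarrow> a = 0" for a by (metis ofC_toC toC.zero)
  interpret quadratic_hamiltonian H g
  proof
    fix a :: "(real^'n) \<times> (real^'n)" and t :: real
    have "(H has_derivative (\<lambda>w. grad sq_gauge (toC a) \<bullet> toC w)) (at a)"
      unfolding H_def[abs_def]
      by (rule has_derivative_compose[OF toC.has_derivative[OF has_derivative_ident] gauge_has_grad])
    then show "(H has_derivative (\<lambda>w. g a \<bullet> w)) (at a)" by (simp add: inner_toC g_def)
    show "continuous_on (- {0}) g"
      unfolding g_def[abs_def]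
      by (intro bounded_linear.continuous_on[OF bounded_linear_ofC] continuous_on_compose2[OF cont_grad_gauge]
          bounded_linear.continuous_on[OF bounded_linear_toC] continuous_on_id) (auto simp: toC_0)
    show "H (t *\<^sub>R a) = t\<^sup>2 * H a" unfolding H_def toC.scaleR by (rule gauge_hom[OF sym])
    show "H a > 0" if "a \<noteq> 0" using that unfolding H_def by (intro gauge_pos) (simp add: toC_0)
  qed
  obtain \<tau> :: real and z where z: "\<tau> > 0" "\<And>t. z (t + 1) = - z t"
    "\<And>t. (z has_vector_derivative \<tau> *\<^sub>R vf (z t) (z t)) (at t)" "\<And>t. H (z t) = 1"
    using antiperiodic_solution by blast
  \<comment> \<open>Slowing down by \<tau> removes the multiplier from the equation; one antiperiod
    then takes time \<tau>.\<close>
  define \<gamma> where "\<gamma> t = toC (z (t / \<tau>))" for t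
  define G where "G t = grad sq_gauge (\<gamma> t)" for t
  define v where "v t = toC (vf (z (t / \<tau>)) (z (t / \<tau>)))" for t
  \<comment> \<open>With q as real and p as imaginary part, \<open>vf\<close> on the diagonal is - i
    times the gradient.\<close>
  have iv: "(\<chi> j. \<i> * v t $ j) = G t" for t
    by (simp add: v_def vf_def g_def G_def \<gamma>_def toC_def ofC_def vec_eq_iff complex_eq_iff)
  have \<gamma>S: "\<gamma> t \<in> S" for t using z(4) gauge_eq_1 unfolding \<gamma>_def H_def by blast
  have \<gamma>d: "(\<gamma> has_vector_derivative v t) (at t)" for t
  proof -
    have "((\<lambda>t. t / \<tau>) has_vector_derivative 1 / \<tau>) (at t)"
      using z(1) by (auto intro!: derivative_eq_intros simp: has_vector_derivative_def)
    from vector_diff_chain_at[OF this z(3)]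
    have "((\<lambda>t. z (t / \<tau>)) has_vector_derivative (1 / \<tau>) *\<^sub>R \<tau> *\<^sub>R vf (z (t / \<tau>)) (z (t / \<tau>))) (at t)"
      by (simp add: o_def)
    from toC.has_vector_derivative[OF this] z(1) show ?thesis
      unfolding \<gamma>_def[abs_def] v_def by simp
  qed
  have "is_reeb_vector S (\<gamma> t) (v t)" for t
    unfolding is_reeb_vector_def
  proof (intro conjI ballI)
    have "((\<lambda>s. \<gamma> (t + s)) has_vector_derivative v t) (at 0)"
    proof -
      have "((\<lambda>s. t + s) has_vector_derivative 1) (at 0)"
        by (auto intro!: derivative_eq_intros simp: has_vector_derivative_def)
      from vector_diff_chain_at[OF this, of \<gamma> "v t"] \<gamma>d[of t] show ?thesis by (simp add: o_def)
    qed
    then show "v t \<in> tangent_space S (\<gamma> t)"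
      unfolding tangent_space_def using \<gamma>S by (auto intro!: exI[of _ "\<lambda>s. \<gamma> (t + s)"])
    have "\<gamma> t \<bullet> G t = g (z (t / \<tau>)) \<bullet> z (t / \<tau>)"
      unfolding \<gamma>_def G_def g_def by (metis inner_commute inner_toC)
    then have "\<gamma> t \<bullet> G t = 2" unfolding euler using z(4) by simp
    then show "liouville_form (\<gamma> t) (v t) = 1" by (simp add: liouville_inner iv)
    show "dliouville (v t) w = 0" if "w \<in> tangent_space S (\<gamma> t)" for w
      using tangent_orthogonal[OF that] by (simp add: dliouville_inner iv G_def)
  qed
  then have "reeb_trajectory S \<gamma>" unfolding reeb_trajectory_def using \<gamma>S \<gamma>d by blast
  moreover have "\<gamma> \<tau> = - \<gamma> 0" using z(1) z(2)[of 0] toC.scaleR[of "-1" "z 0"] by (simp add: \<gamma>_def)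
  ultimately show ?thesis using that[of \<tau> \<gamma>] z(1) by blast
qed

section \<open>The linear action of the cyclic group\<close>

lemma phi_pow:
  "(phi k m ^^ l) z = (\<chi> j. exp (2 * of_real pi * \<i> * of_int (k j) * of_nat l / of_nat m) * z $ j)"
proof (induction l)
  case (Suc l)
  show ?case
    unfolding funpow.simps o_apply Suc unfolding phi_def
    by (simp add: vec_eq_iff exp_add[symmetric] ring_distribs add_divide_distrib flip: mult.assoc)
qed simp

lemma phi_isometry: "norm (phi k m x - phi k m y) = norm (x - y :: complex^'n::finite)"
proof -
  have "norm (exp (2 * of_real pi * \<i> * of_int (k j) / of_nat m) :: complex) = 1" for j
    by (simp add: norm_exp_eq_Re)
  then have "norm ((phi k m x - phi k m y) $ j) = norm ((x - y) $ j)" for j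
    by (simp add: phi_def norm_mult flip: right_diff_distrib)
  then show ?thesis by (simp add: norm_vec_def)
qed

lemma phi_period: "m > 0 \<Longrightarrow> (phi k m ^^ m) z = z"
proof -
  assume m: "m > 0"
  have "exp (2 * of_real pi * \<i> * of_int (k j) * of_nat m / of_nat m) = (1 :: complex)" for j
    using m exp_integer_2pi[of "of_int (k j)"] by (simp add: mult_ac)
  then show ?thesis unfolding phi_pow by (simp add: vec_eq_iff)
qed

text \<open>One nonzero coordinate is enough: fixing it means that m divides k j times l, hence l by
  coprimality.\<close>

lemma phi_free:
  assumes "coprime (k j) (int m)" "z $ j \<noteq> 0" "0 < l" "l < m"
  shows "(phi k m ^^ l) z \<noteq> z"
proof
  assume "(phi k m ^^ l) z = z"
  then have "(phi k m ^^ l) z $ j = z $ j" by simp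
  then have "exp (2 * of_real pi * \<i> * of_int (k j) * of_nat l / of_nat m) = (1 :: complex)"
    unfolding phi_pow using assms(2) by simp
  then obtain n :: int where "2 * pi * of_int (k j) * of_nat l / of_nat m = of_int (2 * n) * pi"
    unfolding exp_eq_1 by auto
  then have "real_of_int (k j) * real l = real_of_int n * real m"
    using assms(3,4) by (simp add: field_simps)
  then have "real_of_int (k j * int l) = real_of_int (n * int m)" by simp
  then have "k j * int l = n * int m" by (simp only: of_int_eq_iff)
  then have "int m dvd k j * int l" by simp
  then have "int m dvd int l" using assms(1) by (simp add: coprime_dvd_mult_right_iff coprime_commute)
  then show False using assms(3,4) by (auto dest: dvd_imp_le)
qed

lemma phi_half:
  assumes "m > 0" "even m" "\<And>j. odd (k j)"
  shows "(phi k m ^^ (m div 2)) z = - z"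
proof -
  have "exp (2 * of_real pi * \<i> * of_int (k j) * of_nat (m div 2) / of_nat m) = (- 1 :: complex)" for j
  proof -
    obtain h where h: "m = 2 * h" using assms(2) by blast
    obtain n where n: "k j = 2 * n + 1" using assms(3)[of j] by (auto elim: oddE)
    have "2 * of_real pi * \<i> * of_int (k j) * of_nat (m div 2) / of_nat m = (2 * of_int n * of_real pi) * \<i> + of_real pi * (\<i> :: complex)"
      using assms(1) unfolding h n by (simp add: field_simps)
    then show ?thesis using exp_integer_2pi[of "of_int n"] by (simp add: exp_add)
  qed
  then show ?thesis unfolding phi_pow by (simp add: vec_eq_iff)
qed

theorem theorem2:
  fixes k :: "'n::finite \<Rightarrow> int" and m :: nat and \<Sigma> :: "(complex^'n) set"
  assumes "CARD('n) \<ge> 2"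
    and "m \<ge> 2" and "even m"
    and "\<forall>j. coprime (k j) (int m)"
    and "compact \<Sigma>" and "connected \<Sigma>" and "star_shaped_hypersurface \<Sigma>"
    and "phi k m ` \<Sigma> = \<Sigma>"
  shows "\<exists>\<gamma> T. T > 0 \<and> reeb_trajectory \<Sigma> \<gamma> \<and>
           zm_orbit k m (\<gamma> T) = zm_orbit k m (\<gamma> 0) \<and>
           noncontractible_loop (zm_quotient k m \<Sigma>) (\<lambda>s. zm_orbit k m (\<gamma> (s * T)))"
proof -
  interpret star_hypersurface \<Sigma> by standard (rule assms(7))
  interpret free_isometric_action "phi k m" m \<Sigma>
  proof
    show "m > 0" using assms(2) by simp
    then show "(phi k m ^^ m) x = x" for x by (rule phi_period)
    show "phi k m ` \<Sigma> \<subseteq> \<Sigma>" using assms(8) by simp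
    show "norm (phi k m x - phi k m y) = norm (x - y)" for x y by (rule phi_isometry)
    fix x l assume x: "x \<in> \<Sigma>" and l: "0 < l" "l < m"
    obtain j where "x $ j \<noteq> 0" using x zero_notin by (metis vec_eq_iff zero_index)
    then show "(phi k m ^^ l) x \<noteq> x" using assms(4) l by (intro phi_free) auto
  qed
  have "odd (k j)" for j
    using assms(3,4) by (metis coprime_common_divisor even_of_nat odd_one)
  then have half: "(phi k m ^^ (m div 2)) x = - x" for x using assms(2,3) by (intro phi_half) auto
  \<comment> \<open>Central symmetry comes from invariance under the half power of
    \<open>phi\<close>; it makes the squared gauge even.\<close>
  have "- x \<in> \<Sigma>" if "x \<in> \<Sigma>" for x using S_pow[OF that, of "m div 2"] half by simp
  from antiperiodic_reeb_orbit[OF assms(7) this] obtain \<gamma> T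
    where \<gamma>: "T > 0" "reeb_trajectory \<Sigma> \<gamma>" "\<gamma> T = - \<gamma> 0" by metis
  have orb: "orb = zm_orbit k m" by (simp add: fun_eq_iff orb_def zm_orbit_def)
  have \<gamma>S: "\<gamma> t \<in> \<Sigma>" for t using \<gamma>(2) by (simp add: reeb_trajectory_def)
  have "isCont \<gamma> t" for t
    using \<gamma>(2) has_vector_derivative_continuous unfolding reeb_trajectory_def by blast
  then have c\<gamma>: "continuous_on UNIV \<gamma>" by (simp add: continuous_at_imp_continuous_on)
  have per: "zm_orbit k m (\<gamma> T) = zm_orbit k m (\<gamma> 0)"
    using orb_pow[of "m div 2" "\<gamma> 0"] unfolding half \<gamma>(3) orb by simp
  have "\<gamma> 0 \<noteq> 0" using \<gamma>S zero_notin by metis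
  have "- \<gamma> 0 \<noteq> \<gamma> 0"
  proof
    assume "- \<gamma> 0 = \<gamma> 0"
    then have "\<gamma> 0 + \<gamma> 0 = 0" by (metis add.left_inverse)
    then have "2 *\<^sub>R \<gamma> 0 = 0" by (simp add: scaleR_2)
    with \<open>\<gamma> 0 \<noteq> 0\<close> show False by simp
  qed
  \<comment> \<open>The path ends at the antipode of its starting point: the same orbit, but a
    different point.\<close>
  then have "noncontractible_loop Y (\<lambda>s. orb (\<gamma> (s * T)))"
    using per \<gamma>S \<gamma>(3)
    by (intro noncontractible continuous_on_compose2[OF c\<gamma>] continuous_intros) (auto simp: orb)
  then show ?thesis using \<gamma> per unfolding orb zm_quotient_def by blast
qed

end
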